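(* Let $v=v_n\ge 0$ be integers such that the limit $\alpha=\lim_{n\to\infty} v/n\in[0,\infty]$ exists. For each $n$ let $(\zeta_1,\dots,\zeta_n)$ be a random vector in $\{z\in\mathbb{C}:\operatorname{Re} z>0\}^n$ whose joint density with respect to Lebesgue measure on $\mathbb{C}^n$ is $$f(z_1,\dots,z_n)=C\prod_{1\le j<k\le n}|z_j^2-z_k^2|^2\prod_{j=1}^n|z_j|^{2(v+1)}K_v(2n|z_j|^2),\qquad \operatorname{Re}(z_j)>0 \text{ for all } j.$$ Then for every $x>1$, $$\lim_{n\to\infty}\frac1n\log\mathbb{P}\left(\left(\frac{n}{n+v}\right)^{1/2}\max_{1\le i\le n}|\zeta_i|^2\ge x\right)=-I_\alpha^{(r)}(x),$$ and for every $0<x<1$, $$\lim_{n\to\infty}\frac1{n^2}\log\mathbb{P}\left(\left(\frac{n}{n+v}\right)^{1/2}\max_{1\le i\le n}|\zeta_i|^2\le x\right)=-I_\alpha^{(l)}(x),$$ where for $\alpha\in(0,\infty)$ $$I_\alpha^{(r)}(x)=\alpha\log\frac{1+\alpha}{\alpha+\kappa_\alpha(x)}+2\bigl(\kappa_\alpha(x)-\log x-1\bigr),$$ $$I_\alpha^{(l)}(x)=\left(\alpha+\frac{\alpha^2}{2}\right)\log\frac{1+\alpha}{\kappa_\alpha(x)+\alpha}-\log x-\frac{(\alpha+3-\kappa_\alpha(x))(1-\kappa_\alpha(x))}{2},$$ $$\kappa_\alpha(x)=\frac{2(1+\alpha)x^2}{\alpha+\sqrt{\alpha^2+4(1+\alpha)x^2}},$$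 and the functions for $\alpha=0$ and $\alpha=+\infty$ are defined, for fixed $x$, by $I_0^{(r)}(x)=\lim_{\beta\to0^+}I_\beta^{(r)}(x)$, $I_0^{(l)}(x)=\lim_{\beta\to0^+}I_\beta^{(l)}(x)$, $I_{+\infty}^{(r)}(x)=\lim_{\beta\to+\infty}I_\beta^{(r)}(x)$ and $I_{+\infty}^{(l)}(x)=\lim_{\beta\to+\infty}I_\beta^{(l)}(x)$, with $\beta\in(0,\infty)$.
   Context: $K_v$ denotes the modified Bessel function of the second kind of order $v$; $C=C_{n,v}$ is the normalizing constant making $f$ a probability density. *)

theory Defs
  imports "HOL-Real_Asymp.Real_Asymp" "HOL-Probability.Probability"
begin

text \<open>
  The modified Bessel function of the second kind for real argument \<open>x > 0\<close> and real order,
  through its integral representation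
  \<open>K\<^sub>\<nu>(x) = \<integral>\<^sub>0\<^sup>\<infinity> exp (-x cosh t) cosh (\<nu> t) dt\<close>. For \<open>x \<le> 0\<close> the value is meaningless.
\<close>

definition bessel_K :: "real \<Rightarrow> real \<Rightarrow> real" where
  "bessel_K \<nu> x = (LBINT t:{0..}. exp (- (x * cosh t)) * cosh (\<nu> * t))"

lemma bessel_K_integrable:
  fixes \<nu> x :: real
  assumes "x > 0"
  shows "set_integrable lborel {0..} (\<lambda>t. exp (- (x * cosh t)) * cosh (\<nu> * t))"
proof (rule set_integrable_bound)
  let ?C = "exp ((\<bar>\<nu>\<bar> + 1)\<^sup>2 / x)"
  have "set_integrable lebesgue {0..} (\<lambda>t. exp (- (1 * t)) :: real)"
    using integrable_on_exp_minus_to_infinity[of 1 0]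
    by (intro nonnegative_absolutely_integrable_1) auto
  then have "set_integrable lborel {0..} (\<lambda>t. exp (- t) :: real)"
    by (simp add: set_integrable_def integrable_completion)
  then show "set_integrable lborel {0..} (\<lambda>t. ?C * exp (- t))"
    by (intro set_integrable_mult_right) simp
  show "set_borel_measurable lborel {0..} (\<lambda>t. exp (- (x * cosh t)) * cosh (\<nu> * t))"
    unfolding set_borel_measurable_def
    by (intro borel_measurable_scaleR borel_measurable_indicator)
       (auto intro!: borel_measurable_continuous_onI continuous_intros)
  have "exp (- (x * cosh t)) * cosh (\<nu> * t) \<le> ?C * exp (- t)" if "t \<ge> 0" for t
  proof -
    have "cosh t \<ge> t\<^sup>2 / 4"
    proof -
      have "t\<^sup>2 / 2 \<le> exp t"
        using exp_lower_Taylor_quadratic[OF that] that by linarith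
      then show ?thesis
        unfolding cosh_def by (simp add: field_simps add_pos_pos add_increasing2)
    qed
    then have "exp (- (x * cosh t)) \<le> exp (- (x * (t\<^sup>2 / 4)))"
      using assms by simp
    moreover have "cosh (\<nu> * t) \<le> exp (\<bar>\<nu>\<bar> * t)"
    proof -
      have "\<nu> * t \<le> \<bar>\<nu>\<bar> * t" "- (\<nu> * t) \<le> \<bar>\<nu>\<bar> * t"
        using that abs_ge_self[of \<nu>] abs_ge_minus_self[of \<nu>] mult_right_mono by fastforce+
      then have "exp (\<nu> * t) \<le> exp (\<bar>\<nu>\<bar> * t)" "exp (- (\<nu> * t)) \<le> exp (\<bar>\<nu>\<bar> * t)" by simp_all
      then have "exp (\<nu> * t) + exp (- (\<nu> * t)) \<le> 2 * exp (\<bar>\<nu>\<bar> * t)" by linarith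
      then show ?thesis by (simp add: cosh_def)
    qed
    ultimately have "exp (- (x * cosh t)) * cosh (\<nu> * t) \<le> exp (- (x * (t\<^sup>2 / 4))) * exp (\<bar>\<nu>\<bar> * t)"
      by (intro mult_mono) (auto simp: cosh_def)
    also have "\<dots> = exp (\<bar>\<nu>\<bar> * t - x * (t\<^sup>2 / 4))" by (simp flip: exp_add)
    also have "\<dots> \<le> exp ((\<bar>\<nu>\<bar> + 1)\<^sup>2 / x - t)"
    proof -
      have "0 \<le> (x * t / 2 - (\<bar>\<nu>\<bar> + 1))\<^sup>2 / x" using assms by simp
      also have "\<dots> = x * (t\<^sup>2 / 4) - (\<bar>\<nu>\<bar> + 1) * t + (\<bar>\<nu>\<bar> + 1)\<^sup>2 / x"
        using assms by (simp add: field_simps power2_eq_square)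
      finally show ?thesis by (simp add: algebra_simps)
    qed
    finally show ?thesis by (simp flip: exp_add)
  qed
  then show "AE t in lborel. t \<in> {0..} \<longrightarrow>
      norm (exp (- (x * cosh t)) * cosh (\<nu> * t)) \<le> norm (?C * exp (- t))"
    by (intro AE_I2) (auto simp: abs_mult)
qed

definition lborel_vec :: "nat \<Rightarrow> (nat \<Rightarrow> complex) measure" where
  "lborel_vec n = (\<Pi>\<^sub>M j\<in>{1..n}. lborel)"

definition chiral_weight :: "nat \<Rightarrow> nat \<Rightarrow> (nat \<Rightarrow> complex) \<Rightarrow> real" where
  "chiral_weight n v z =
    (if \<forall>j\<in>{1..n}. Re (z j) > 0 then
       (\<Prod>k=1..n. \<Prod>j=1..<k. (norm ((z j)\<^sup>2 - (z k)\<^sup>2))\<^sup>2) *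
       (\<Prod>j=1..n. norm (z j) ^ (2 * (v + 1)) * bessel_K (real v) (2 * real n * (norm (z j))\<^sup>2))
     else 0)"

definition chiral_const :: "nat \<Rightarrow> nat \<Rightarrow> real" where
  "chiral_const n v = 1 / enn2real (\<integral>\<^sup>+z. ennreal (chiral_weight n v z) \<partial>lborel_vec n)"

definition chiral_density :: "nat \<Rightarrow> nat \<Rightarrow> (nat \<Rightarrow> complex) \<Rightarrow> real" where
  "chiral_density n v z = chiral_const n v * chiral_weight n v z"

definition kappa :: "real \<Rightarrow> real \<Rightarrow> real" where
  "kappa \<beta> x = 2 * (1 + \<beta>) * x\<^sup>2 / (\<beta> + sqrt (\<beta>\<^sup>2 + 4 * (1 + \<beta>) * x\<^sup>2))"

definition rate_right_fin :: "real \<Rightarrow> real \<Rightarrow> real" where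
  "rate_right_fin \<beta> x =
     \<beta> * ln ((1 + \<beta>) / (\<beta> + kappa \<beta> x)) + 2 * (kappa \<beta> x - ln x - 1)"

definition rate_left_fin :: "real \<Rightarrow> real \<Rightarrow> real" where
  "rate_left_fin \<beta> x =
     (\<beta> + \<beta>\<^sup>2 / 2) * ln ((1 + \<beta>) / (kappa \<beta> x + \<beta>)) - ln x
       - (\<beta> + 3 - kappa \<beta> x) * (1 - kappa \<beta> x) / 2"

text \<open>The following limits exist, so that the extension to \<open>\<beta> = 0\<close> and \<open>\<beta> = \<infinity>\<close> below is well defined.\<close>

lemma sqrt_four_times_square: "x > 0 \<Longrightarrow> (4 * x\<^sup>2) powr (1 / 2) = 2 * (x::real)"
  by (simp add: powr_half_sqrt real_sqrt_mult)
lemma sqrt_four_times_square2: "x > 0 \<Longrightarrow> (x * (x * 4)) powr (1 / 2) = 2 * (x::real)"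
  using sqrt_four_times_square[of x] by (simp add: power2_eq_square mult_ac)

lemma rate_left_fin_at_0:
  "x > 0 \<Longrightarrow> ((\<lambda>\<beta>. rate_left_fin \<beta> x) \<longlongrightarrow> - ln x - (1-x)*(3-x)/2) (at_right 0)"
  unfolding rate_left_fin_def kappa_def
  by (real_asymp simp: sqrt_four_times_square) (simp add: sqrt_four_times_square2 field_simps power2_eq_square)

lemma rate_right_fin_at_0:
  "x > 0 \<Longrightarrow> ((\<lambda>\<beta>. rate_right_fin \<beta> x) \<longlongrightarrow> 2*(x-1-ln x)) (at_right 0)"
  unfolding rate_right_fin_def kappa_def
  by (real_asymp simp: sqrt_four_times_square) (simp add: sqrt_four_times_square2 field_simps power2_eq_square)

lemma rate_left_fin_at_infinity:
  "x > 0 \<Longrightarrow> ((\<lambda>\<beta>. rate_left_fin \<beta> x) \<longlongrightarrow> - ln x - (1-x\<^sup>2)*(3-x\<^sup>2)/4) at_top"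
  unfolding rate_left_fin_def kappa_def by (real_asymp simp: field_simps power2_eq_square)

lemma rate_right_fin_at_infinity:
  "x > 0 \<Longrightarrow> ((\<lambda>\<beta>. rate_right_fin \<beta> x) \<longlongrightarrow> x\<^sup>2 - 1 - 2*ln x) at_top"
  unfolding rate_right_fin_def kappa_def by (real_asymp simp: field_simps power2_eq_square)

text \<open>The extension of a family indexed by \<open>\<beta> \<in> (0, \<infinity>)\<close> to \<open>[0, \<infinity>]\<close> by pointwise limits.\<close>

definition extend_by_limits :: "(real \<Rightarrow> real \<Rightarrow> real) \<Rightarrow> ereal \<Rightarrow> real \<Rightarrow> real" where
  "extend_by_limits I \<alpha> x =
    (if \<alpha> = 0 then Lim (at_right 0) (\<lambda>\<beta>. I \<beta> x)
     else if \<alpha> = \<infinity> then Lim at_top (\<lambda>\<beta>. I \<beta> x)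
     else I (real_of_ereal \<alpha>) x)"

definition rate_right :: "ereal \<Rightarrow> real \<Rightarrow> real" where
  "rate_right = extend_by_limits rate_right_fin"

definition rate_left :: "ereal \<Rightarrow> real \<Rightarrow> real" where
  "rate_left = extend_by_limits rate_left_fin"

end

theory Submission
  imports Defs "Jordan_Normal_Form.Determinant"
begin

text \<open>
  The squares \<open>z\<^sub>j\<^sup>2\<close> interact only through a Vandermonde product, and the one-particle weight is
  radial. If \<open>\<bar>V\<bar>\<^sup>2\<close> is expanded by Leibniz' formula and integrated term by term, rotation invariance
  kills every term that pairs two different powers. What remains factorises: the probability that
  all the numbers \<open>W\<^sub>i = n\<^sup>2 \<bar>\<zeta>\<^sub>i\<bar>\<^sup>4\<close> lie in a Borel set \<open>B\<close> equals the product over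
  \<open>k = 1, \<dots>, n\<close> of the masses \<open>\<mu>\<^sub>k(B)\<close>, where \<open>\<mu>\<^sub>k\<close> is one fixed law on \<open>[0, \<infinity>)\<close>, the law of a
  product of two independent gamma variables of parameters \<open>1\<close> and \<open>v + 1\<close>, reweighted by
  \<open>w\<^bsup>k-1\<^esup>\<close> (lemma \<open>joint_law\<close>). The integral formula for \<open>K\<^sub>v\<close> reduces its moments to a gamma and a
  beta integral. All that is used of them is that reweighting \<open>\<mu>\<^sub>k\<close> by another factor \<open>w\<close> gives
  \<open>\<mu>\<^bsub>k+1\<^esub>\<close> with the normalising constant \<open>k (k + v)\<close>, the mean of \<open>\<mu>\<^sub>k\<close>.

  The event in question compares the \<open>W\<^sub>i\<close> with the threshold \<open>R = x\<^sup>2 n (n + v)\<close>. Passing from \<open>\<mu>\<^sub>k\<close> to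
  \<open>\<mu>\<^bsub>k'\<^esub>\<close> is an exponential change of measure in \<open>log w\<close>. It gives the Chernoff bounds
  \<open>\<mu>\<^sub>k[R, \<infinity>) \<le> \<Prod>\<^bsub>k \<le> i < k'\<^esub> i (i + v) / R\<close> and
  \<open>\<mu>\<^sub>k[0, R] \<le> \<Prod>\<^bsub>k' \<le> i < k\<^esub> R / (i (i + v))\<close>, and both are sharp on the exponential scale if
  \<open>k' (k' + v)\<close> is close to \<open>R\<close>, because \<open>\<mu>\<^bsub>k'\<^esub>\<close> is then concentrated near \<open>R\<close>. With \<open>\<beta> = v / n\<close> this
  means \<open>k' \<approx> \<kappa>\<^sub>\<beta>(x) n\<close>. For \<open>x > 1\<close> the factor \<open>k = n\<close> decides, up to a factor \<open>n\<close>; for \<open>x < 1\<close> every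
  \<open>k > \<kappa>\<^sub>\<beta>(x) n\<close> contributes, which is why the speed is \<open>n\<^sup>2\<close>.

  The logarithms of these products are Riemann sums of \<open>log (u (u + \<beta>) / (x\<^sup>2 (1 + \<beta>)))\<close> over
  \<open>[1, \<kappa>]\<close>, and of the same function times \<open>1 - u\<close> over \<open>[\<kappa>, 1]\<close>. Explicit primitives identify the
  integrals with the two rate functions at \<open>\<beta>\<close>, and the error is \<open>O(1/n)\<close> with a constant that depends
  on \<open>x\<close> alone (lemmas \<open>right_sum_approx\<close>, \<open>left_sum_approx\<close>). Since this is uniform in \<open>\<beta>\<close>, the cases
  \<open>\<alpha> = 0\<close> and \<open>\<alpha> = \<infinity>\<close> need no separate treatment: it suffices to let \<open>\<beta> = v\<^sub>n / n\<close> tend to \<open>\<alpha>\<close> in the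
  rate functions.
\<close>

section \<open>Lebesgue measure on the complex plane\<close>

lemma lborel_complex_eq_distr:
  "(lborel :: complex measure) = distr (lborel \<Otimes>\<^sub>M lborel) borel (\<lambda>(x, y). Complex x y)"
proof (rule lborel_eqI)
  fix l u :: complex
  assume le: "\<And>b. b \<in> Basis \<Longrightarrow> l \<bullet> b \<le> u \<bullet> b"
  have *: "(\<lambda>(x, y). Complex x y) -` box l u = {Re l<..<Re u} \<times> {Im l<..<Im u}"
    by (auto simp: box_def Basis_complex_def)
  have m: "(\<lambda>(x, y). Complex x y) \<in> borel_measurable (lborel \<Otimes>\<^sub>M lborel)"
  proof -
    have [measurable]: "(\<lambda>p. Complex (fst p) (snd p)) \<in> borel_measurable (borel \<Otimes>\<^sub>M borel)"
      unfolding borel_prod by (intro borel_measurable_continuous_onI continuous_intros)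
    show ?thesis unfolding case_prod_unfold by measurable
  qed
  have "Re l \<le> Re u" "Im l \<le> Im u"
    using le[of 1] le[of \<i>] by (auto simp: Basis_complex_def)
  then show "emeasure (distr (lborel \<Otimes>\<^sub>M lborel) borel (\<lambda>(x, y). Complex x y)) (box l u)
      = (\<Prod>b\<in>Basis. (u - l) \<bullet> b)"
    by (subst emeasure_distr[OF m])
       (auto simp: * space_pair_measure lborel.emeasure_pair_measure_Times Basis_complex_def
          ennreal_mult'' complex_eq_iff)
qed simp

lemma nn_integral_lborel_complex:
  fixes F :: "complex \<Rightarrow> ennreal"
  assumes [measurable]: "F \<in> borel_measurable borel"
  shows "(\<integral>\<^sup>+z. F z \<partial>lborel) = (\<integral>\<^sup>+x. \<integral>\<^sup>+y. F (Complex x y) \<partial>lborel \<partial>lborel)"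
    and "(\<integral>\<^sup>+z. F z \<partial>lborel) = (\<integral>\<^sup>+y. \<integral>\<^sup>+x. F (Complex x y) \<partial>lborel \<partial>lborel)"
proof -
  have m[measurable]: "(\<lambda>p. Complex (fst p) (snd p)) \<in> borel_measurable (borel \<Otimes>\<^sub>M borel)"
    unfolding borel_prod by (intro borel_measurable_continuous_onI continuous_intros)
  have 1: "(\<integral>\<^sup>+z. F z \<partial>lborel) = (\<integral>\<^sup>+p. F (Complex (fst p) (snd p)) \<partial>(lborel \<Otimes>\<^sub>M lborel))"
    by (subst lborel_complex_eq_distr) (simp add: nn_integral_distr case_prod_unfold)
  have 2: "(\<lambda>p. F (Complex (fst p) (snd p))) \<in> borel_measurable (lborel \<Otimes>\<^sub>M lborel)"
    by measurable
  show "(\<integral>\<^sup>+z. F z \<partial>lborel) = (\<integral>\<^sup>+x. \<integral>\<^sup>+y. F (Complex x y) \<partial>lborel \<partial>lborel)"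
    unfolding 1 using 2 by (subst lborel.nn_integral_fst[symmetric]) auto
  show "(\<integral>\<^sup>+z. F z \<partial>lborel) = (\<integral>\<^sup>+y. \<integral>\<^sup>+x. F (Complex x y) \<partial>lborel \<partial>lborel)"
    unfolding 1 using 2 by (subst lborel_pair.nn_integral_snd[symmetric]) auto
qed

text \<open>
  By Fubini a shear only translates each line parallel to an axis.
\<close>
lemma nn_integral_complex_shear:
  fixes F :: "complex \<Rightarrow> ennreal"
  assumes F[measurable]: "F \<in> borel_measurable borel"
  shows "(\<integral>\<^sup>+z. F (Complex (Re z + t * Im z) (Im z)) \<partial>lborel) = (\<integral>\<^sup>+z. F z \<partial>lborel)"
    and "(\<integral>\<^sup>+z. F (Complex (Re z) (Im z + t * Re z)) \<partial>lborel) = (\<integral>\<^sup>+z. F z \<partial>lborel)"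
proof -
  have m1[measurable]: "(\<lambda>z. Complex (Re z + t * Im z) (Im z)) \<in> borel_measurable borel"
   and m2[measurable]: "(\<lambda>z. Complex (Re z) (Im z + t * Re z)) \<in> borel_measurable borel"
    by (intro borel_measurable_continuous_onI continuous_intros)+
  have mx[measurable]: "(\<lambda>x. Complex x y) \<in> borel_measurable borel"
   and my[measurable]: "(\<lambda>y. Complex x y) \<in> borel_measurable borel" for x y
    by (intro borel_measurable_continuous_onI continuous_intros)+
  have "(\<integral>\<^sup>+x. F (Complex x y) \<partial>lborel) = (\<integral>\<^sup>+x. F (Complex (x + t * y) y) \<partial>lborel)" for y
    using nn_integral_real_affine[of "\<lambda>x. F (Complex x y)" 1 "t * y"] by (simp add: add_ac)
  then show "(\<integral>\<^sup>+z. F (Complex (Re z + t * Im z) (Im z)) \<partial>lborel) = (\<integral>\<^sup>+z. F z \<partial>lborel)"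
    by (simp add: nn_integral_lborel_complex(2))
  have "(\<integral>\<^sup>+y. F (Complex x y) \<partial>lborel) = (\<integral>\<^sup>+y. F (Complex x (y + t * x)) \<partial>lborel)" for x
    using nn_integral_real_affine[of "\<lambda>y. F (Complex x y)" 1 "t * x"] by (simp add: add_ac)
  then show "(\<integral>\<^sup>+z. F (Complex (Re z) (Im z + t * Re z)) \<partial>lborel) = (\<integral>\<^sup>+z. F z \<partial>lborel)"
    by (simp add: nn_integral_lborel_complex(1))
qed

text \<open>
  A rotation by an angle other than \<open>\<pi>\<close> is a product of three shears: horizontal with factor
  \<open>- tan (\<theta>/2)\<close>, vertical with factor \<open>sin \<theta>\<close>, and the first one again.
\<close>
lemma nn_integral_complex_rotate:
  fixes F :: "complex \<Rightarrow> ennreal"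
  assumes F[measurable]: "F \<in> borel_measurable borel"
    and c: "norm c = 1" "c \<noteq> -1"
  shows "(\<integral>\<^sup>+z. F (c * z) \<partial>lborel) = (\<integral>\<^sup>+z. F z \<partial>lborel)"
proof -
  have sq: "(Re c)\<^sup>2 + (Im c)\<^sup>2 = 1" using c by (simp add: cmod_def)
  have "Re c \<noteq> -1" using sq c by (auto simp: complex_eq_iff)
  \<comment> \<open>this is \<open>- tan (\<theta>/2)\<close> for \<open>c = cis \<theta>\<close>\<close>
  define t where "t = - Im c / (1 + Re c)"
  define S where "S = (\<lambda>z. Complex (Re z + t * Im z) (Im z))"
  define S' where "S' = (\<lambda>z. Complex (Re z) (Im z + Im c * Re z))"
  have m1[measurable]: "S \<in> borel_measurable borel"
   and m2[measurable]: "S' \<in> borel_measurable borel"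
    unfolding S_def S'_def by (intro borel_measurable_continuous_onI continuous_intros)+
  have Sz: "S z = Complex (Re z + t * Im z) (Im z)"
   and S'z: "S' z = Complex (Re z) (Im z + Im c * Re z)" for z
    by (simp_all add: S_def S'_def)
  have t1: "1 + t * Im c = Re c"
    using sq \<open>Re c \<noteq> -1\<close> unfolding t_def by (simp add: field_simps power2_eq_square)
  have t2: "t + t * (1 + t * Im c) = - Im c"
  proof -
    have "t * (1 + Re c) = - Im c"
      using \<open>Re c \<noteq> -1\<close> by (simp add: t_def field_simps add_eq_0_iff)
    then show ?thesis unfolding t1 by (simp add: algebra_simps)
  qed
  have "S (S' (S z)) = c * z" for z
  proof -
    have "Re (S (S' (S z))) = Re z * (1 + t * Im c) + Im z * (t + t * (1 + t * Im c))"
      by (simp add: S_def S'_def algebra_simps)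
    moreover have "Im (S (S' (S z))) = Im z * (1 + t * Im c) + Re z * Im c"
      by (simp add: S_def S'_def algebra_simps)
    ultimately show ?thesis unfolding t1 t2[unfolded t1]
      using t2 unfolding t1 by (simp add: complex_eq_iff algebra_simps)
  qed
  then have "(\<integral>\<^sup>+z. F (c * z) \<partial>lborel) = (\<integral>\<^sup>+z. F (S (S' (S z))) \<partial>lborel)" by simp
  also have "\<dots> = (\<integral>\<^sup>+z. F (S (S' z)) \<partial>lborel)"
    using nn_integral_complex_shear(1)[of "\<lambda>z. F (S (S' z))" t] by (simp flip: Sz)
  also have "\<dots> = (\<integral>\<^sup>+z. F (S z) \<partial>lborel)"
    using nn_integral_complex_shear(2)[of "\<lambda>z. F (S z)" "Im c"] by (simp flip: S'z)
  also have "\<dots> = (\<integral>\<^sup>+z. F z \<partial>lborel)"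
    using nn_integral_complex_shear(1)[of F t] by (simp flip: Sz)
  finally show ?thesis .
qed

lemma lborel_complex_rotate:
  assumes "norm (c :: complex) = 1"
  shows "distr lborel borel ((*) c) = lborel"
proof (rule measure_eqI)
  fix A :: "complex set" assume "A \<in> sets (distr lborel borel ((*) c))"
  then have A[measurable]: "A \<in> sets borel" by simp
  have "(\<integral>\<^sup>+z. indicator A (c * z) \<partial>lborel) = (\<integral>\<^sup>+z. indicator A z \<partial>lborel :: ennreal)"
  proof (cases "c = -1")
    case False
    then show ?thesis using nn_integral_complex_rotate[of "indicator A" c] assms by simp
  next
    case True
    have "(\<integral>\<^sup>+z. indicator A (\<i> * (\<i> * z)) \<partial>lborel) = (\<integral>\<^sup>+z. indicator A z \<partial>lborel :: ennreal)"
      using nn_integral_complex_rotate[of "indicator A" \<i>]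
        nn_integral_complex_rotate[of "\<lambda>z. indicator A (\<i> * z)" \<i>]
      by (simp add: complex_eq_iff)
    then show ?thesis using True by (simp flip: mult.assoc)
  qed
  then have "(\<integral>\<^sup>+z. indicator A z \<partial>distr lborel borel ((*) c)) = (\<integral>\<^sup>+z. indicator A z \<partial>lborel :: ennreal)"
    by (subst nn_integral_distr) auto
  then show "emeasure (distr lborel borel ((*) c)) A = emeasure lborel A" by simp
qed simp

lemma integral_complex_rotate:
  fixes F :: "complex \<Rightarrow> complex"
  assumes [measurable]: "F \<in> borel_measurable borel" and "norm c = 1"
  shows "(\<integral>z. F (c * z) \<partial>lborel) = (\<integral>z. F z \<partial>lborel)"
  using integral_distr[of "(*) c" lborel borel F] lborel_complex_rotate[of c] assms(2) by simp

text \<open>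
  The weight lives on the right half-plane, which is not invariant under rotations. The integrands
  to be considered are functions of \<open>z\<^sup>2\<close>, and for those the integral over the plane is
  twice the integral over the half-plane.
\<close>
lemma half_plane_integral_even:
  fixes F :: "complex \<Rightarrow> complex"
  assumes F: "integrable lborel F" and even: "\<And>z. F (- z) = F z"
  shows "integrable lborel (\<lambda>z. indicator {z. 0 < Re z} z *\<^sub>R F z)"
    and "2 * (\<integral>z. indicator {z. 0 < Re z} z *\<^sub>R F z \<partial>lborel) = (\<integral>z. F z \<partial>lborel)"
proof -
  have [measurable]: "F \<in> borel_measurable borel" using F by auto
  have m[measurable]: "{z. 0 < Re z} \<in> sets borel" "{z. Re z < 0} \<in> sets borel" by measurable
  show i1: "integrable lborel (\<lambda>z. indicator {z. 0 < Re z} z *\<^sub>R F z)"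
    by (intro integrable_mult_indicator F) auto
  have i2: "integrable lborel (\<lambda>z. indicator {z. Re z < 0} z *\<^sub>R F z)"
    by (intro integrable_mult_indicator F) auto
  have "(\<integral>z. indicator {z. 0 < Re z} z *\<^sub>R F z \<partial>lborel) = (\<integral>z. indicator {z. 0 < Re z} (-1 * z) *\<^sub>R F (-1 * z) \<partial>lborel)"
    by (rule integral_complex_rotate[symmetric]) auto
  also have "\<dots> = (\<integral>z. indicator {z. Re z < 0} z *\<^sub>R F z \<partial>lborel)"
    by (intro Bochner_Integration.integral_cong refl) (auto simp: even indicator_def)
  finally have eq: "(\<integral>z. indicator {z. 0 < Re z} z *\<^sub>R F z \<partial>lborel) = (\<integral>z. indicator {z. Re z < 0} z *\<^sub>R F z \<partial>lborel)" .
  have null: "{z. Re z = 0} \<in> null_sets lborel"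
  proof (rule null_setsI)
    have 0: "(\<integral>\<^sup>+x. indicator {z. Re z = 0} (Complex x y) \<partial>lborel) = 0" for y
    proof -
      have "(\<integral>\<^sup>+x. indicator {z. Re z = 0} (Complex x y) \<partial>lborel) = (\<integral>\<^sup>+x. indicator {0::real} x \<partial>lborel)"
        by (intro nn_integral_cong) (auto simp: indicator_def)
      then show ?thesis by (subst (asm) nn_integral_indicator) auto
    qed
    have "emeasure lborel {z::complex. Re z = 0} = (\<integral>\<^sup>+z. indicator {z. Re z = 0} z \<partial>lborel)" by simp
    also have "\<dots> = 0"
      by (subst nn_integral_lborel_complex(2)) (simp_all only: 0, auto)
    finally show "emeasure lborel {z::complex. Re z = 0} = 0" .
  qed simp
  have "(\<integral>z. F z \<partial>lborel) = (\<integral>z. indicator {z. 0 < Re z} z *\<^sub>R F z + indicator {z. Re z < 0} z *\<^sub>R F z \<partial>lborel)"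
    by (intro integral_cong_AE) (use AE_not_in[OF null] in \<open>auto elim!: eventually_mono simp: indicator_def\<close>)
  also have "\<dots> = 2 * (\<integral>z. indicator {z. 0 < Re z} z *\<^sub>R F z \<partial>lborel)"
    using i1 i2 by (simp add: eq)
  finally show "2 * (\<integral>z. indicator {z. 0 < Re z} z *\<^sub>R F z \<partial>lborel) = (\<integral>z. F z \<partial>lborel)" by simp
qed

section \<open>The Vandermonde determinant\<close>

text \<open>
  Multiplying the matrix of powers \<open>w\<^sub>i\<^sup>k\<close> by the unitriangular coefficient matrix of the monic
  polynomials \<open>\<Prod>\<^bsub>j<k\<^esub> (X - w\<^sub>j)\<close> makes it lower triangular without changing the determinant. The
  left-hand side is the product of the new diagonal, the right-hand side Leibniz' formula.
\<close>
lemma vandermonde_expansion: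
  fixes w :: "nat \<Rightarrow> 'a :: idom"
  shows "(\<Prod>k<n. \<Prod>j<k. w k - w j) =
    (\<Sum>p | p permutes {0..<n}. signof p * (\<Prod>i=0..<n. w i ^ p i))"
proof -
  define q where "q k = (\<Prod>j<k. [:- w j, 1:])" for k
  have poly_q: "poly (q k) x = (\<Prod>j<k. x - w j)" for k x
    by (simp add: q_def poly_prod)
  have lead: "lead_coeff (q k) = 1 \<and> degree (q k) = k" for k
  proof (induction k)
    case (Suc k)
    then have "q k \<noteq> 0" by (metis leading_coeff_0_iff zero_neq_one)
    have qS: "q (Suc k) = q k * [:- w k, 1:]" by (simp add: q_def)
    show ?case using Suc \<open>q k \<noteq> 0\<close>
      unfolding qS by (subst lead_coeff_mult, subst degree_mult_eq) auto
  qed (simp add: q_def)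
  define A where "A = mat n n (\<lambda>(i, k). w i ^ k)"
  define U where "U = mat n n (\<lambda>(m, k). coeff (q k) m)"
  have [simp]: "A \<in> carrier_mat n n" "U \<in> carrier_mat n n" by (auto simp: A_def U_def)
  have AU: "A * U = mat n n (\<lambda>(i, k). \<Prod>j<k. w i - w j)"
  proof (rule eq_matI)
    fix i k assume "i < dim_row (mat n n (\<lambda>(i, k). \<Prod>j<k. w i - w j))"
      "k < dim_col (mat n n (\<lambda>(i, k). \<Prod>j<k. w i - w j))"
    then have ik: "i < n" "k < n" by auto
    have "(A * U) $$ (i, k) = (\<Sum>m<n. w i ^ m * coeff (q k) m)"
      using ik by (auto simp: A_def U_def scalar_prod_def atLeast0LessThan intro!: sum.cong)
    also have "\<dots> = (\<Sum>m\<le>k. coeff (q k) m * w i ^ m)"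
      using ik lead[of k] by (intro sum.mono_neutral_cong_right) (auto simp: coeff_eq_0)
    also have "\<dots> = poly (q k) (w i)" using lead[of k] by (simp add: poly_altdef)
    finally show "(A * U) $$ (i, k) = mat n n (\<lambda>(i, k). \<Prod>j<k. w i - w j) $$ (i, k)"
      using ik by (simp add: poly_q)
  qed (auto simp: A_def U_def)
  have "det (A * U) = (\<Prod>k<n. \<Prod>j<k. w k - w j)"
    unfolding AU by (subst det_lower_triangular[of n])
      (auto simp: prod_list_diag_prod atLeast0LessThan intro!: prod_zero)
  moreover have "det U = 1"
  proof -
    have "upper_triangular U" using lead by (auto simp: U_def upper_triangular_def coeff_eq_0)
    then have "det U = (\<Prod>k<n. coeff (q k) k)"
      by (subst det_upper_triangular[of _ n]) (auto simp: prod_list_diag_prod atLeast0LessThan U_def)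
    also have "\<dots> = 1" using lead by (intro prod.neutral) metis
    finally show ?thesis .
  qed
  moreover have "det (A * U) = det A * det U" by (rule det_mult[of _ n]) auto
  moreover have "det A = (\<Sum>p | p permutes {0..<n}. signof p * (\<Prod>i=0..<n. w i ^ p i))"
  proof -
    have "p i < n" if "p permutes {0..<n}" "i < n" for p i
      using permutes_in_image[OF that(1), of i] that(2) by auto
    then show ?thesis by (subst det_def'[of _ n]) (auto simp: A_def intro!: sum.cong prod.cong)
  qed
  ultimately show ?thesis by simp
qed

section \<open>Integrating out the interaction\<close>

lemma norm_power_mult_bound:
  fixes z :: complex
  shows "norm z ^ (2 * p) * norm z ^ (2 * q) \<le> norm z ^ (4 * p) + norm z ^ (4 * q)"
proof -
  have "x * y \<le> x\<^sup>2 + y\<^sup>2" for x y :: real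
    using sum_squares_bound[of x y] zero_le_power2[of x] zero_le_power2[of y] by linarith
  from this[of "norm z ^ (2 * p)" "norm z ^ (2 * q)"] show ?thesis
    by (simp flip: power_mult)
qed

text \<open>
  Under \<open>z \<mapsto> c z\<close> with \<open>\<bar>c\<bar> = 1\<close> the function \<open>\<rho>(\<bar>z\<bar>) z\<^bsup>2p\<^esup> (cnj z)\<^bsup>2q\<^esup>\<close> is multiplied by
  \<open>c\<^bsup>2(p-q)\<^esup>\<close>, so its integral vanishes unless \<open>p = q\<close>.
\<close>
lemma radial_moments_orthogonal:
  fixes \<rho> :: "real \<Rightarrow> real" and p q :: nat
  assumes [measurable]: "\<rho> \<in> borel_measurable borel" and nonneg: "\<And>r. \<rho> r \<ge> 0"
    and int: "\<And>a. a \<in> {p, q} \<Longrightarrow> integrable lborel (\<lambda>z::complex. norm z ^ (4 * a) * \<rho> (norm z))"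
  defines "h \<equiv> \<lambda>z. indicator {z. 0 < Re z} z *\<^sub>R (complex_of_real (\<rho> (norm z)) * z ^ (2 * p) * cnj z ^ (2 * q))"
  shows "integrable lborel h"
    and "integral\<^sup>L lborel h =
      (if p = q then complex_of_real (1 / 2 * (\<integral>z. norm z ^ (4 * p) * \<rho> (norm (z::complex)) \<partial>lborel)) else 0)"
proof -
  define F where "F z = complex_of_real (\<rho> (norm z)) * z ^ (2 * p) * cnj z ^ (2 * q)" for z
  have [measurable]: "cnj \<in> borel_measurable borel"
    by (intro borel_measurable_continuous_onI continuous_intros)
  have F: "integrable lborel F"
  proof (rule Bochner_Integration.integrable_bound)
    show "integrable lborel (\<lambda>z::complex. norm z ^ (4 * p) * \<rho> (norm z) + norm z ^ (4 * q) * \<rho> (norm z))"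
      by (intro Bochner_Integration.integrable_add int) auto
    show "F \<in> borel_measurable lborel" unfolding F_def by measurable
    have "norm (F z) \<le> norm z ^ (4 * p) * \<rho> (norm z) + norm z ^ (4 * q) * \<rho> (norm z)" for z
      using mult_right_mono[OF norm_power_mult_bound[of z p q] nonneg[of "norm z"]] nonneg[of "norm z"]
      by (simp add: F_def norm_mult norm_power algebra_simps)
    then show "AE z in lborel. norm (F z) \<le> norm (norm z ^ (4 * p) * \<rho> (norm z) + norm z ^ (4 * q) * \<rho> (norm z))"
      by (auto intro!: AE_I2 order_trans[OF _ abs_ge_self])
  qed
  have even: "F (- z) = F z" for z by (simp add: F_def)
  have h: "h = (\<lambda>z. indicator {z. 0 < Re z} z *\<^sub>R F z)" by (simp add: h_def F_def)
  show "integrable lborel h" unfolding h by (rule half_plane_integral_even[OF F even])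
  have half: "integral\<^sup>L lborel h = (\<integral>z. F z \<partial>lborel) / 2"
    using half_plane_integral_even(2)[OF F even, symmetric] unfolding h by simp
  show "integral\<^sup>L lborel h =
      (if p = q then complex_of_real (1 / 2 * (\<integral>z. norm z ^ (4 * p) * \<rho> (norm (z::complex)) \<partial>lborel)) else 0)"
  proof (cases "p = q")
    case True
    have "F z = complex_of_real (norm z ^ (4 * p) * \<rho> (norm z))" for z
    proof -
      have "z ^ (2 * q) * cnj z ^ (2 * q) = complex_of_real ((norm z)\<^sup>2) ^ (2 * q)"
        by (simp only: complex_norm_square power_mult_distrib)
      also have "\<dots> = complex_of_real (norm z ^ (4 * q))"
        by (simp flip: power_mult)
      finally show ?thesis using True by (simp add: F_def mult.assoc)
    qed
    then show ?thesis using True half by (simp flip: integral_complex_of_real)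
  next
    case False
    \<comment> \<open>A rotation by this angle multiplies the integrand by -1.\<close>
    define c where "c = cis (pi / (2 * (real p - real q)))"
    have "c ^ (2 * p) * cnj c ^ (2 * q) = cis ((2 * real p - 2 * real q) * (pi / (2 * (real p - real q))))"
      by (simp add: c_def cis_cnj Complex.DeMoivre cis_mult algebra_simps diff_divide_distrib add_divide_distrib)
    also have "(2 * real p - 2 * real q) * (pi / (2 * (real p - real q))) = pi"
      using False by (simp add: field_simps)
    finally have c: "c ^ (2 * p) * cnj c ^ (2 * q) = -1" by simp
    have nc: "norm c = 1" by (simp add: c_def)
    have "F (c * z) = - F z" for z
    proof -
      have "F (c * z) = (c ^ (2 * p) * cnj c ^ (2 * q)) * F z"
        by (simp add: F_def norm_mult nc power_mult_distrib)
      then show ?thesis using c by simp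
    qed
    then have "(\<integral>z. F z \<partial>lborel) = (\<integral>z. - F z \<partial>lborel)"
      using integral_complex_rotate[OF _ nc, of F] F by auto
    then have "(\<integral>z. F z \<partial>lborel) = 0" by simp
    then show ?thesis using half False by simp
  qed
qed

text \<open>
  In the double sum over permutations \<open>p\<close>, \<open>q\<close> that represents \<open>\<bar>V\<bar>\<^sup>2\<close>, orthogonality leaves the
  \<open>n!\<close> diagonal terms, each of which is the product of the radial moments. Applied to \<open>\<rho>\<close> and to
  \<open>\<rho>\<close> restricted to a set of radii, this makes the radii independent.
\<close>
lemma nn_integral_vandermonde_radial:
  fixes \<rho> :: "real \<Rightarrow> real"
  assumes [measurable]: "\<rho> \<in> borel_measurable borel" and nonneg: "\<And>r. \<rho> r \<ge> 0"
    and int: "\<And>a. a < n \<Longrightarrow> integrable lborel (\<lambda>z::complex. norm z ^ (4 * a) * \<rho> (norm z))"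
  shows "(\<integral>\<^sup>+z. ennreal (if \<forall>j\<in>{1..n}. Re (z j) > 0 then
        (\<Prod>k=1..n. \<Prod>j=1..<k. (norm ((z j)\<^sup>2 - (z k)\<^sup>2))\<^sup>2) * (\<Prod>j=1..n. \<rho> (norm (z j))) else 0)
        \<partial>lborel_vec n)
    = ennreal (fact n * (\<Prod>a<n. 1 / 2 * (\<integral>z. norm z ^ (4 * a) * \<rho> (norm (z::complex)) \<partial>lborel)))"
    (is "(\<integral>\<^sup>+z. ennreal (?f z) \<partial>_) = _")
proof -
  interpret product_sigma_finite "\<lambda>_::nat. lborel :: complex measure" by standard
  define m where "m a = 1 / 2 * (\<integral>z. norm z ^ (4 * a) * \<rho> (norm (z::complex)) \<partial>lborel)" for a
  define h where "h p q z = indicator {z. 0 < Re z} z *\<^sub>R (complex_of_real (\<rho> (norm z)) * z ^ (2 * p) * cnj z ^ (2 * q))" for p q z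
  have hint: "integrable lborel (h p q)" "integral\<^sup>L lborel (h p q) = (if p = q then complex_of_real (m p) else 0)"
    if "p < n" "q < n" for p q
  proof -
    have *: "\<And>a. a \<in> {p, q} \<Longrightarrow> integrable lborel (\<lambda>z::complex. norm z ^ (4 * a) * \<rho> (norm z))"
      using that int by auto
    show "integrable lborel (h p q)" "integral\<^sup>L lborel (h p q) = (if p = q then complex_of_real (m p) else 0)"
      unfolding h_def[abs_def] m_def by (rule radial_moments_orthogonal[OF assms(1) nonneg *]; assumption)+
  qed
  let ?P = "{p. p permutes {0..<n}}"
  have fin: "finite ?P" by (intro finite_permutations) auto
  have less: "p i < n" if "p \<in> ?P" "i < n" for p i
    using permutes_in_image[of p "{0..<n}" i] that by auto
  define G where "G z = (\<Sum>p\<in>?P. \<Sum>q\<in>?P. signof p * signof q * (\<Prod>j=1..n. h (p (j - 1)) (q (j - 1)) (z j)))" for z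
  have shift: "(\<Prod>j=1..n. g j) = (\<Prod>i=0..<n. g (Suc i))" for g :: "nat \<Rightarrow> 'b::comm_monoid_mult"
    by (rule prod.reindex_bij_witness[of _ Suc "\<lambda>j. j - 1"]) auto
  have shift': "(\<Prod>j=1..<Suc k. g j) = (\<Prod>i<k. g (Suc i))" for g :: "nat \<Rightarrow> 'b::comm_monoid_mult" and k
    by (rule prod.reindex_bij_witness[of _ Suc "\<lambda>j. j - 1"]) auto
  have G: "complex_of_real (?f z) = G z" for z
  proof (cases "\<forall>j\<in>{1..n}. Re (z j) > 0")
    case True
    define w where "w i = (z (Suc i))\<^sup>2" for i
    define V where "V = (\<Prod>k<n. \<Prod>j<k. w k - w j)"
    have "(\<Prod>k=1..n. \<Prod>j=1..<k. (norm ((z j)\<^sup>2 - (z k)\<^sup>2))\<^sup>2)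
        = (\<Prod>k=0..<n. \<Prod>j=1..<Suc k. (norm ((z j)\<^sup>2 - (z (Suc k))\<^sup>2))\<^sup>2)"
      by (rule shift)
    also have "\<dots> = (\<Prod>k=0..<n. \<Prod>j<k. (norm (w k - w j))\<^sup>2)"
      by (simp only: shift' w_def norm_minus_commute)
    also have "\<dots> = (norm V)\<^sup>2"
      by (simp add: V_def prod_norm[symmetric] prod_power_distrib atLeast0LessThan)
    finally have V2: "(\<Prod>k=1..n. \<Prod>j=1..<k. (norm ((z j)\<^sup>2 - (z k)\<^sup>2))\<^sup>2) = (norm V)\<^sup>2" .
    have "complex_of_real (?f z) = complex_of_real ((norm V)\<^sup>2) * (\<Prod>i=0..<n. complex_of_real (\<rho> (norm (z (Suc i)))))"
      by (simp only: if_P[OF True] V2 shift of_real_mult of_real_prod)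
    also have "complex_of_real ((norm V)\<^sup>2) = V * cnj V" by (rule complex_norm_square)
    also have "V = (\<Sum>p\<in>?P. signof p * (\<Prod>i=0..<n. w i ^ p i))"
      unfolding V_def by (rule vandermonde_expansion)
    also have "cnj (\<Sum>p\<in>?P. signof p * (\<Prod>i=0..<n. w i ^ p i)) = (\<Sum>q\<in>?P. signof q * (\<Prod>i=0..<n. cnj (w i) ^ q i))"
      by simp
    also have "(\<Sum>p\<in>?P. signof p * (\<Prod>i=0..<n. w i ^ p i)) * (\<Sum>q\<in>?P. signof q * (\<Prod>i=0..<n. cnj (w i) ^ q i))
        * (\<Prod>i=0..<n. complex_of_real (\<rho> (norm (z (Suc i)))))
      = (\<Sum>p\<in>?P. \<Sum>q\<in>?P. signof p * signof q * (\<Prod>i=0..<n. w i ^ p i * cnj (w i) ^ q i * complex_of_real (\<rho> (norm (z (Suc i))))))"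
      by (subst sum_product, simp only: sum_distrib_right prod.distrib, intro sum.cong refl, simp only: mult_ac)
    also have "\<dots> = G z"
      unfolding G_def shift
      using True by (intro sum.cong refl arg_cong2[of _ _ _ _ "(*)"] prod.cong)
        (auto simp: h_def w_def indicator_def mult_ac simp flip: power_mult)
    finally show ?thesis .
  next
    case False
    then obtain j where "j \<in> {1..n}" "\<not> Re (z j) > 0" by auto
    then have 0: "(\<Prod>j=1..n. h (p (j - 1)) (q (j - 1)) (z j)) = 0" for p q
      by (intro prod_zero) (auto simp: h_def intro!: bexI[of _ j])
    have "G z = 0"
      unfolding G_def
    proof (intro sum.neutral ballI)
      fix p q :: "nat \<Rightarrow> nat"
      show "signof p * signof q * (\<Prod>j=1..n. h (p (j - 1)) (q (j - 1)) (z j)) = 0"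
        unfolding 0[of p q] by simp
    qed
    then show ?thesis by (simp only: if_not_P[OF False] of_real_0)
  qed
  define H where "H p q z = (\<Prod>j=1..n. h (p (j - 1)) (q (j - 1)) (z j))" for p q :: "nat \<Rightarrow> nat" and z
  have GH: "G = (\<lambda>z. \<Sum>p\<in>?P. \<Sum>q\<in>?P. signof p * signof q * H p q z)"
    unfolding G_def[abs_def] H_def ..
  have ilt: "p (j - 1) < n" if "p \<in> ?P" "j \<in> {1..n}" for p j
    using less[OF that(1), of "j - 1"] that(2) by auto
  have Hi: "integrable (lborel_vec n) (H p q)"
    and HI: "integral\<^sup>L (lborel_vec n) (H p q) = (\<Prod>j=1..n. integral\<^sup>L lborel (h (p (j - 1)) (q (j - 1))))"
    if "p \<in> ?P" "q \<in> ?P" for p q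
    unfolding H_def lborel_vec_def
  proof -
    have hj: "integrable lborel (h (p (j - 1)) (q (j - 1)))" if "j \<in> {1..n}" for j
      by (rule hint(1)[OF ilt[OF \<open>p \<in> ?P\<close> that] ilt[OF \<open>q \<in> ?P\<close> that]])
    show "integrable (Pi\<^sub>M {1..n} (\<lambda>j. lborel)) (\<lambda>z. \<Prod>j=1..n. h (p (j - 1)) (q (j - 1)) (z j))"
      by (rule product_integrable_prod[OF _ hj]) auto
    show "(\<integral>z. (\<Prod>j=1..n. h (p (j - 1)) (q (j - 1)) (z j)) \<partial>Pi\<^sub>M {1..n} (\<lambda>j. lborel))
        = (\<Prod>j=1..n. integral\<^sup>L lborel (h (p (j - 1)) (q (j - 1))))"
      by (rule product_integral_prod[OF _ hj]) auto
  qed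
  have Gi: "integrable (lborel_vec n) G"
    unfolding GH by (intro Bochner_Integration.integrable_sum integrable_mult_right Hi)
  define f where "f = ?f"
  have Gf: "complex_of_real (f z) = G z" for z unfolding f_def by (rule G)
  have fG: "f = (\<lambda>z. Re (G z))" by (simp flip: Gf)
  have fi: "integrable (lborel_vec n) f"
    unfolding fG using Gi by (rule integrable_Re)
  have f0: "f z \<ge> 0" for z
    unfolding f_def by (auto intro!: mult_nonneg_nonneg prod_nonneg nonneg)
  have "complex_of_real (\<integral>z. f z \<partial>lborel_vec n) = (\<integral>z. G z \<partial>lborel_vec n)"
    by (simp flip: integral_complex_of_real add: Gf)
  also have "\<dots> = (\<Sum>p\<in>?P. (\<integral>z. (\<Sum>q\<in>?P. signof p * signof q * H p q z) \<partial>lborel_vec n))"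
    unfolding GH
    by (intro Bochner_Integration.integral_sum Bochner_Integration.integrable_sum integrable_mult_right Hi)
  also have "\<dots> = (\<Sum>p\<in>?P. \<Sum>q\<in>?P. (\<integral>z. signof p * signof q * H p q z \<partial>lborel_vec n))"
    by (intro sum.cong refl Bochner_Integration.integral_sum integrable_mult_right Hi)
  also have "\<dots> = (\<Sum>p\<in>?P. \<Sum>q\<in>?P. signof p * signof q *
      (\<Prod>j=1..n. integral\<^sup>L lborel (h (p (j - 1)) (q (j - 1)))))"
    by (intro sum.cong refl) (simp only: Bochner_Integration.integral_mult_right[OF Hi] HI)
  also have "\<dots> = (\<Sum>p\<in>?P. \<Sum>q\<in>?P. if p = q then (\<Prod>a<n. complex_of_real (m a)) else 0)"
  proof (intro sum.cong refl)
    fix p q assume pq: "p \<in> ?P" "q \<in> ?P"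
    show "signof p * signof q * (\<Prod>j=1..n. integral\<^sup>L lborel (h (p (j - 1)) (q (j - 1))))
       = (if p = q then (\<Prod>a<n. complex_of_real (m a)) else 0)"
    proof (cases "p = q")
      case True
      have "(\<Prod>j=1..n. integral\<^sup>L lborel (h (p (j - 1)) (q (j - 1)))) = (\<Prod>i=0..<n. complex_of_real (m (p i)))"
        unfolding shift using True less[OF pq(1)] by (intro prod.cong) (auto simp: hint)
      also have "\<dots> = (\<Prod>i=0..<n. complex_of_real (m i))"
        using prod.permute[of p "{0..<n}" "\<lambda>i. complex_of_real (m i)"] pq by (simp add: o_def)
      finally show ?thesis using True by (auto simp: sign_def atLeast0LessThan)
    next
      case False
      then obtain i where i: "p i \<noteq> q i" by auto
      then have "i < n" using pq by (metis (mono_tags) mem_Collect_eq permutes_def atLeastLessThan_iff zero_le)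
      then have "(\<Prod>j=1..n. integral\<^sup>L lborel (h (p (j - 1)) (q (j - 1)))) = 0"
        unfolding shift using i less[OF pq(1)] less[OF pq(2)]
        by (intro prod_zero) (auto simp: hint intro!: bexI[of _ i])
      then show ?thesis using False by simp
    qed
  qed
  also have "\<dots> = complex_of_real (fact n * (\<Prod>a<n. m a))"
    using fin by (simp add: card_permutations)
  finally have "(\<integral>z. f z \<partial>lborel_vec n) = fact n * (\<Prod>a<n. m a)"
    by (simp only: of_real_eq_iff)
  moreover have "(\<integral>\<^sup>+z. ennreal (f z) \<partial>lborel_vec n) = ennreal (\<integral>z. f z \<partial>lborel_vec n)"
    by (intro nn_integral_eq_integral fi AE_I2 f0)
  ultimately show ?thesis by (simp only: f_def m_def)
qed

section \<open>Moments of the Bessel weight\<close>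

lemma emeasure_norm_square_le:
  "emeasure lborel {z::complex. (norm z)\<^sup>2 \<le> r} = ennreal (pi * max 0 r)"
proof (cases "r \<ge> 0")
  case True
  have "(norm z)\<^sup>2 \<le> r \<longleftrightarrow> norm z \<le> sqrt r" for z :: complex
    using real_sqrt_le_iff[of "(norm z)\<^sup>2" r] by simp
  then have "{z::complex. (norm z)\<^sup>2 \<le> r} = cball 0 (sqrt r)"
    by (simp add: cball_def)
  then show ?thesis using True by (simp add: emeasure_cball unit_ball_vol_2)
next
  case False
  then have "{z::complex. (norm z)\<^sup>2 \<le> r} = {}"
    by (auto simp: not_le intro: order_less_le_trans)
  then show ?thesis using False by simp
qed

text \<open>
  Polar coordinates without angles: both measures give mass \<open>\<pi> r\<close> to \<open>[0, r]\<close>.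
\<close>
lemma distr_norm_square:
  "distr lborel borel (\<lambda>z::complex. (norm z)\<^sup>2) = density lborel (\<lambda>s. ennreal pi * indicator {0..} s)"
proof (rule measure_eqI_generator_eq[where E = "range (\<lambda>x::real. {..x})" and \<Omega> = UNIV and A = "\<lambda>i. {..real i}"])
  have 1: "emeasure (distr lborel borel (\<lambda>z::complex. (norm z)\<^sup>2)) {..r} = ennreal (pi * max 0 r)" for r
    by (subst emeasure_distr) (auto simp: vimage_def emeasure_norm_square_le)
  have 2: "emeasure (density lborel (\<lambda>s. ennreal pi * indicator {0..} s)) {..r} = ennreal (pi * max 0 r)" for r
  proof -
    have "emeasure (density lborel (\<lambda>s. ennreal pi * indicator {0..} s)) {..r}
      = (\<integral>\<^sup>+s. ennreal pi * indicator {0..r} s \<partial>lborel)"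
      by (subst emeasure_density) (auto intro!: nn_integral_cong simp: indicator_def)
    also have "\<dots> = ennreal pi * emeasure lborel {0..r}" by (subst nn_integral_cmult) auto
    finally show ?thesis by (cases "r \<ge> 0") (auto simp: ennreal_mult)
  qed
  show "Int_stable (range (\<lambda>x::real. {..x}))"
    by (auto simp: Int_stable_def)
  show "emeasure (distr lborel borel (\<lambda>z::complex. (norm z)\<^sup>2)) X = emeasure (density lborel (\<lambda>s. ennreal pi * indicator {0..} s)) X"
    if "X \<in> range (\<lambda>x. {..x})" for X using that 1 2 by auto
  show "sets (distr lborel borel (\<lambda>z::complex. (norm z)\<^sup>2)) = sigma_sets UNIV (range (\<lambda>x::real. {..x}))"
    "sets (density lborel (\<lambda>s. ennreal pi * indicator {0..} s)) = sigma_sets UNIV (range (\<lambda>x::real. {..x}))"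
    by (simp_all add: borel_eq_atMost)
  show "(\<Union>i. {..real i}) = UNIV" using real_arch_simple by auto
  show "emeasure (distr lborel borel (\<lambda>z::complex. (norm z)\<^sup>2)) {..real i} \<noteq> \<infinity>" for i
    unfolding 1 by simp
qed auto

lemma nn_integral_norm_square:
  assumes [measurable]: "g \<in> borel_measurable borel"
  shows "(\<integral>\<^sup>+z. g ((norm (z::complex))\<^sup>2) \<partial>lborel) = ennreal pi * (\<integral>\<^sup>+s. g s * indicator {0..} s \<partial>lborel)"
proof -
  have "(\<integral>\<^sup>+z. g ((norm (z::complex))\<^sup>2) \<partial>lborel) = (\<integral>\<^sup>+s. g s \<partial>distr lborel borel (\<lambda>z::complex. (norm z)\<^sup>2))"
    by (subst nn_integral_distr) auto
  also have "\<dots> = (\<integral>\<^sup>+s. ennreal pi * (g s * indicator {0..} s) \<partial>lborel)"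
    unfolding distr_norm_square by (subst nn_integral_density) (auto simp: mult_ac)
  finally show ?thesis by (simp add: nn_integral_cmult)
qed

lemma nn_integral_power_exp:
  assumes c: "c > 0"
  shows "(\<integral>\<^sup>+s. ennreal (s ^ N * exp (- (c * s))) * indicator {0..} s \<partial>lborel) = ennreal (fact N / c ^ Suc N)"
proof -
  have "(\<integral>\<^sup>+s. ennreal (s ^ N * exp (-s)) * indicator {0..} s \<partial>lborel)
     = ennreal c * (\<integral>\<^sup>+s. ennreal ((c * s) ^ N * exp (- (c * s))) * indicator {0..} (c * s) \<partial>lborel)"
    using nn_integral_real_affine[of "\<lambda>s. ennreal (s ^ N * exp (-s)) * indicator {0..} s" c 0] c by simp
  also have "\<dots> = (\<integral>\<^sup>+s. ennreal (c ^ Suc N) * (ennreal (s ^ N * exp (- (c * s))) * indicator {0..} s) \<partial>lborel)"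
    using c by (subst nn_integral_cmult[symmetric])
      (auto intro!: nn_integral_cong simp: indicator_def zero_le_mult_iff power_mult_distrib mult_ac simp flip: ennreal_mult')
  also have "\<dots> = ennreal (c ^ Suc N) * (\<integral>\<^sup>+s. ennreal (s ^ N * exp (- (c * s))) * indicator {0..} s \<partial>lborel)"
    by (subst nn_integral_cmult) auto
  finally have eq: "ennreal (fact N) = ennreal (c ^ Suc N) * (\<integral>\<^sup>+s. ennreal (s ^ N * exp (- (c * s))) * indicator {0..} s \<partial>lborel)"
    (is "_ = _ * ?I") by (simp add: nn_intergal_power_times_exp_Ici)
  have "ennreal (fact N / c ^ Suc N) = ennreal (inverse (c ^ Suc N)) * ennreal (fact N)"
    using c by (simp add: ennreal_mult' divide_inverse mult.commute)
  also have "\<dots> = ennreal (inverse (c ^ Suc N) * c ^ Suc N) * ?I"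
    unfolding eq using c by (subst ennreal_mult') (auto simp: mult.assoc)
  also have "inverse (c ^ Suc N) * c ^ Suc N = 1" using c by (intro left_inverse) simp
  also have "ennreal 1 * ?I = ?I" by simp
  finally show ?thesis ..
qed

text \<open>
  The substitution \<open>u = e\<^sup>t / (e\<^sup>t + e\<^bsup>-t\<^esup>)\<close> turns the integral into half the beta integral
  \<open>B(k + v, k)\<close>. It is carried out from \<open>u\<close> to \<open>t\<close>, since integrability is evident on \<open>(0, 1)\<close>.
\<close>
lemma integral_exp_cosh_power:
  fixes k v :: nat
  assumes k: "k \<ge> 1"
  defines "f \<equiv> \<lambda>t. exp (real v * t) / (2 * cosh t) ^ (2 * k + v)"
  shows "integrable lborel f"
    and "(\<integral>t. f t \<partial>lborel) = fact (k - 1) * fact (k + v - 1) / (2 * fact (2 * k + v - 1))"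
proof -
  have pos: "exp t + exp (- t) > 0" for t :: real by (simp add: add_pos_pos)
  define g where "g u = (ln u - ln (1 - u)) / 2" for u :: real
  define B where "B u = u ^ (k + v - 1) * (1 - u) ^ (k - 1)" for u :: real
  have fg: "f (g u) * (1 / (2 * u * (1 - u))) = B u / 2" if u: "0 < u" "u < 1" for u
  proof -
    define t where "t = g u"
    have e: "exp t * exp t = u / (1 - u)"
      using u by (simp add: t_def g_def exp_diff flip: exp_add)
    have "1 + exp t * exp t = 1 / (1 - u)" unfolding e using u by (simp add: field_simps)
    moreover have "exp t + exp (- t) = (1 + exp t * exp t) / exp t" by (simp add: exp_minus field_simps)
    ultimately have D: "exp t + exp (- t) = 1 / (exp t * (1 - u))" by simp
    have "exp t * exp t * (1 - u) = u" unfolding e using u by simp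
    then have a: "exp t / (exp t + exp (- t)) = u" unfolding D using u by (simp add: mult.assoc)
    have b: "exp (- t) / (exp t + exp (- t)) = 1 - u" unfolding D using u by (simp add: exp_minus)
    have "f t = (exp t ^ (k + v) * exp (- t) ^ k) / (exp t + exp (- t)) ^ (2 * k + v)"
      unfolding f_def cosh_def by (simp add: algebra_simps flip: exp_of_nat_mult exp_add)
    also have "\<dots> = (exp t / (exp t + exp (- t))) ^ (k + v) * (exp (- t) / (exp t + exp (- t))) ^ k"
      by (simp add: power_divide mult_2 add_ac flip: power_add)
    also have "\<dots> = u ^ (k + v) * (1 - u) ^ k" unfolding a b ..
    also have "\<dots> = u * (1 - u) * B u"
      using k by (cases k) (auto simp: B_def)
    finally have *: "f (g u) = (u * (1 - u)) * B u" by (simp add: t_def)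
    define y where "y = u * (1 - u)"
    have "2 * u * (1 - u) = 2 * y" "y \<noteq> 0" using u by (auto simp: y_def)
    then show ?thesis unfolding * y_def[symmetric] by simp
  qed
  have "((\<lambda>u. u powr (real (k + v) - 1) * (1 - u) powr (real k - 1)) has_integral Beta (real (k + v)) (real k)) {0<..<1}"
    using has_integral_Beta_real[of "real (k + v)" "real k"] k by (simp add: has_integral_Icc_iff_Ioo)
  then have "(B has_integral Beta (real (k + v)) (real k)) {0<..<1}"
  proof (rule has_integral_eq[rotated])
    fix u :: real assume u: "u \<in> {0<..<1}"
    have "u powr (real (k + v) - 1) = u ^ (k + v - 1)" "(1 - u) powr (real k - 1) = (1 - u) ^ (k - 1)"
      using u k by (simp_all add: powr_realpow[symmetric] of_nat_diff)
    then show "u powr (real (k + v) - 1) * (1 - u) powr (real k - 1) = B u" by (simp add: B_def)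
  qed
  then have BI: "integral {0<..<1} B = Beta (real (k + v)) (real k)" by (rule integral_unique)
  have "set_integrable lborel {0..1} B"
    unfolding B_def by (intro borel_integrable_atLeastAtMost') (auto intro!: continuous_intros)
  then have Bs: "set_integrable lborel {0<..<1} B"
    by (rule set_integrable_subset) auto
  have BL: "(LBINT u:{0<..<1}. B u) = Beta (real (k + v)) (real k)"
    using set_borel_integral_eq_integral(2)[OF Bs] BI by simp
  have e01: "einterval (ereal 0) (ereal 1) = {0<..<1}" by (auto simp: einterval_def)
  have Bs2: "set_integrable lborel (einterval (ereal 0) (ereal 1)) (\<lambda>u. f (g u) * (1 / (2 * u * (1 - u))))"
    unfolding e01 by (subst set_integrable_cong[where f' = "\<lambda>u. B u / 2"]) (use Bs fg in auto)
  have l0: "filterlim g at_bot (at_right 0)" and l1: "filterlim g at_top (at_left 1)"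
    unfolding g_def by real_asymp+
  have cf: "isCont f t" for t
    unfolding f_def by (intro continuous_intros) (use cosh_real_pos[of t] in auto)
  have dg: "DERIV g u :> 1 / (2 * u * (1 - u))" if "0 < u" "u < 1" for u
  proof -
    have "DERIV g u :> (1 / u + 1 / (1 - u)) / 2"
      unfolding g_def using that by (auto intro!: derivative_eq_intros)
    also have "(1 / u + 1 / (1 - u)) / 2 = 1 / (2 * u * (1 - u))"
      using that by (simp add: divide_simps)
    finally show ?thesis .
  qed
  have prems: "ereal 0 < ereal 1"
    "\<And>u. ereal 0 < ereal u \<Longrightarrow> ereal u < ereal 1 \<Longrightarrow> DERIV g u :> 1 / (2 * u * (1 - u))"
    "\<And>u. ereal 0 < ereal u \<Longrightarrow> ereal u < ereal 1 \<Longrightarrow> isCont f (g u)"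
    "\<And>u. ereal 0 < ereal u \<Longrightarrow> ereal u < ereal 1 \<Longrightarrow> isCont (\<lambda>u. 1 / (2 * u * (1 - u))) u"
    "\<And>u. ereal 0 < ereal u \<Longrightarrow> ereal u < ereal 1 \<Longrightarrow> 0 \<le> f (g u)"
    "\<And>u. ereal 0 \<le> ereal u \<Longrightarrow> ereal u \<le> ereal 1 \<Longrightarrow> 0 \<le> 1 / (2 * u * (1 - u))"
    "((ereal \<circ> g \<circ> real_of_ereal) \<longlongrightarrow> -\<infinity>) (at_right (ereal 0))"
    "((ereal \<circ> g \<circ> real_of_ereal) \<longlongrightarrow> \<infinity>) (at_left (ereal 1))"
    using l0 l1 dg cf by (auto simp: ereal_tendsto_simps f_def intro!: continuous_intros)
  note * = interval_integral_substitution_nonneg[OF prems Bs2]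
  show "integrable lborel f"
    using *(1) by (simp add: set_integrable_def)
  have "(\<integral>t. f t \<partial>lborel) = (LBINT x=-\<infinity>..\<infinity>. f x)"
    by (simp add: interval_lebesgue_integral_def set_lebesgue_integral_def)
  also have "\<dots> = (LBINT u=ereal 0..ereal 1. f (g u) * (1 / (2 * u * (1 - u))))"
    by (rule *(2))
  also have "\<dots> = (LBINT u:{0<..<1}. f (g u) * (1 / (2 * u * (1 - u))))"
    by (simp add: interval_lebesgue_integral_def e01)
  also have "\<dots> = (LBINT u:{0<..<1}. B u / 2)"
  proof (rule set_lebesgue_integral_cong)
    show "\<forall>u. u \<in> {0<..<1} \<longrightarrow> f (g u) * (1 / (2 * u * (1 - u))) = B u / 2"
      by (intro allI impI fg) auto
  qed simp
  also have "\<dots> = Beta (real (k + v)) (real k) / 2" using BL by simp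
  also have "Beta (real (k + v)) (real k) = fact (k + v - 1) * fact (k - 1) / fact (2 * k + v - 1)"
  proof -
    have G: "Gamma (real m) = fact (m - 1)" if "m \<ge> 1" for m
      using Gamma_fact[of "m - 1", where 'a = real] that by (simp add: of_nat_diff)
    have "Beta (real (k + v)) (real k) = Gamma (real (k + v)) * Gamma (real k) / Gamma (real (2 * k + v))"
      by (simp add: Beta_def algebra_simps)
    also have "\<dots> = fact (k + v - 1) * fact (k - 1) / fact (2 * k + v - 1)"
      using k by (subst (1 2 3) G) auto
    finally show ?thesis .
  qed
  finally show "(\<integral>t. f t \<partial>lborel) = fact (k - 1) * fact (k + v - 1) / (2 * fact (2 * k + v - 1))"
    by (simp add: mult.commute)
qed

text \<open>
  The hyperbolic cosine is the even part of the exponential function, so folding the real line at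
  \<open>0\<close> gives half of the previous integral.
\<close>
lemma nn_integral_cosh_power:
  assumes k: "k \<ge> (1::nat)"
  shows "(\<integral>\<^sup>+t. ennreal (cosh (real v * t) / (2 * cosh t) ^ (2 * k + v)) * indicator {0..} t \<partial>lborel)
      = ennreal (fact (k - 1) * fact (k + v - 1) / (4 * fact (2 * k + v - 1)))"
    (is "?I = ennreal ?r")
proof -
  define f where "f t = exp (real v * t) / (2 * cosh t) ^ (2 * k + v)" for t
  have f0: "f t \<ge> 0" for t unfolding f_def using cosh_real_pos[of t] by simp
  have [measurable]: "f \<in> borel_measurable borel"
    using integral_exp_cosh_power(1)[OF k, of v] unfolding f_def by simp
  have [measurable]: "(cosh :: real \<Rightarrow> real) \<in> borel_measurable borel"
    by (intro borel_measurable_continuous_onI continuous_intros)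
  have "(\<integral>\<^sup>+t. ennreal (f t) \<partial>lborel) = ennreal (\<integral>t. f t \<partial>lborel)"
    using integral_exp_cosh_power(1)[OF k, of v] f0 by (intro nn_integral_eq_integral) (auto simp: f_def)
  also have "(\<integral>t. f t \<partial>lborel) = 2 * ?r"
    using integral_exp_cosh_power(2)[OF k, of v] by (simp add: f_def)
  finally have 1: "(\<integral>\<^sup>+t. ennreal (f t) \<partial>lborel) = ennreal (2 * ?r)" .
  have "(\<integral>\<^sup>+t. ennreal (f t) \<partial>lborel) = (\<integral>\<^sup>+t. ennreal (f t) * indicator {0..} t + ennreal (f t) * indicator {..<0} t \<partial>lborel)"
    by (intro nn_integral_cong) (auto simp: indicator_def)
  also have "\<dots> = (\<integral>\<^sup>+t. ennreal (f t) * indicator {0..} t \<partial>lborel) + (\<integral>\<^sup>+t. ennreal (f t) * indicator {..<0} t \<partial>lborel)"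
    by (intro nn_integral_add) auto
  also have "(\<integral>\<^sup>+t. ennreal (f t) * indicator {..<0} t \<partial>lborel) = (\<integral>\<^sup>+t. ennreal (f (- t)) * indicator {..<0} (- t) \<partial>lborel)"
    using nn_integral_real_affine[of "\<lambda>t. ennreal (f t) * indicator {..<0} t" "-1" 0] by simp
  also have "\<dots> = (\<integral>\<^sup>+t. ennreal (f (- t)) * indicator {0..} t \<partial>lborel)"
    using AE_lborel_singleton[of "0::real"]
    by (intro nn_integral_cong_AE) (auto elim!: eventually_mono simp: indicator_def)
  also have "(\<integral>\<^sup>+t. ennreal (f t) * indicator {0..} t \<partial>lborel) + \<dots>
     = (\<integral>\<^sup>+t. ennreal (f t) * indicator {0..} t + ennreal (f (- t)) * indicator {0..} t \<partial>lborel)"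
    by (intro nn_integral_add[symmetric]) auto
  also have "\<dots> = (\<integral>\<^sup>+t. 2 * (ennreal (cosh (real v * t) / (2 * cosh t) ^ (2 * k + v)) * indicator {0..} t) \<partial>lborel)"
  proof (intro nn_integral_cong)
    fix t :: real
    define X where "X = cosh (real v * t) / (2 * cosh t) ^ (2 * k + v)"
    have "f t + f (- t) = 2 * X"
      by (simp add: f_def X_def cosh_def[of "real v * t"] add_divide_distrib)
    then have "ennreal (f t) + ennreal (f (- t)) = ennreal (2 * X)"
      using f0[of t] f0[of "- t"] by (simp flip: ennreal_plus)
    also have "\<dots> = 2 * ennreal X" by (simp add: ennreal_mult')
    finally have "ennreal (f t) + ennreal (f (- t)) = 2 * ennreal (cosh (real v * t) / (2 * cosh t) ^ (2 * k + v))"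
      unfolding X_def .
    then show "ennreal (f t) * indicator {0..} t + ennreal (f (- t)) * indicator {0..} t
        = 2 * (ennreal (cosh (real v * t) / (2 * cosh t) ^ (2 * k + v)) * indicator {0..} t)"
      by (simp add: distrib_right[symmetric] mult.assoc)
  qed
  also have "\<dots> = 2 * ?I" by (intro nn_integral_cmult) measurable
  finally have "2 * ?I = ennreal (2 * ?r)" using 1 by (simp only:)
  also have "\<dots> = 2 * ennreal ?r" using ennreal_mult'[of 2 ?r] by simp
  finally have "2 * ?I = 2 * ennreal ?r" .
  then show ?thesis by (simp add: ennreal_mult_cancel_left)
qed

lemma bessel_K_measurable [measurable]: "bessel_K \<nu> \<in> borel_measurable borel"
proof -
  have [measurable]: "(cosh :: real \<Rightarrow> real) \<in> borel_measurable borel"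
    by (intro borel_measurable_continuous_onI continuous_intros)
  show ?thesis unfolding bessel_K_def[abs_def] set_lebesgue_integral_def by measurable
qed

lemma bessel_K_nonneg: "bessel_K \<nu> x \<ge> 0"
  unfolding bessel_K_def set_lebesgue_integral_def
  by (intro Bochner_Integration.integral_nonneg) (auto simp: indicator_def)

lemma nn_integral_bessel_K:
  assumes "x > 0"
  shows "ennreal (bessel_K \<nu> x) = (\<integral>\<^sup>+t. ennreal (exp (- (x * cosh t)) * cosh (\<nu> * t)) * indicator {0..} t \<partial>lborel)"
  using bessel_K_integrable[OF assms, of \<nu>]
  unfolding bessel_K_def set_lebesgue_integral_def set_integrable_def
  by (subst nn_integral_eq_integral[symmetric])
    (auto intro!: nn_integral_cong simp: indicator_def)

text \<open>
  After inserting the integral formula for \<open>K\<^sub>v\<close> and exchanging the integrals, the radial integral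
  is a gamma integral, and what is left is the integral of \<open>cosh (v t) / (2 cosh t)\<^bsup>2k+v\<^esup>\<close>. In the
  result, passing from \<open>k\<close> to \<open>k + 1\<close> multiplies by \<open>k (k + v) / c\<^sup>2\<close>.
\<close>
lemma nn_integral_bessel_K_moment:
  fixes c :: real
  assumes k: "k \<ge> (1::nat)" and c: "c > 0"
  shows "(\<integral>\<^sup>+z. ennreal (norm (z::complex) ^ (4 * (k - 1)) * (norm z ^ (2 * (v + 1)) * bessel_K (real v) (2 * c * (norm z)\<^sup>2))) \<partial>lborel)
     = ennreal (pi * fact (k - 1) * fact (k + v - 1) / (4 * c ^ (2 * k + v)))"
proof -
  define N where "N = 2 * k + v - 1"
  have N: "N > 0" "Suc N = 2 * k + v" using k by (auto simp: N_def)
  have [measurable]: "(cosh :: real \<Rightarrow> real) \<in> borel_measurable borel"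
    by (intro borel_measurable_continuous_onI continuous_intros)
  have e: "4 * (k - 1) + 2 * (v + 1) = 2 * N" using k by (auto simp: N_def)
  have "norm z ^ (4 * (k - 1)) * (norm z ^ (2 * (v + 1)) * bessel_K (real v) (2 * c * (norm z)\<^sup>2))
     = ((norm z)\<^sup>2) ^ N * bessel_K (real v) (2 * c * (norm z)\<^sup>2)" for z :: complex
    unfolding mult.assoc[symmetric] power_add[symmetric] e by (simp flip: power_mult)
  then have "(\<integral>\<^sup>+z. ennreal (norm (z::complex) ^ (4 * (k - 1)) * (norm z ^ (2 * (v + 1)) * bessel_K (real v) (2 * c * (norm z)\<^sup>2))) \<partial>lborel)
     = (\<integral>\<^sup>+z. ennreal (((norm (z::complex))\<^sup>2) ^ N * bessel_K (real v) (2 * c * (norm z)\<^sup>2)) \<partial>lborel)"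
    by (intro nn_integral_cong) (simp only:)
  also have "\<dots> = ennreal pi * (\<integral>\<^sup>+s. ennreal (s ^ N * bessel_K (real v) (2 * c * s)) * indicator {0..} s \<partial>lborel)"
    by (rule nn_integral_norm_square) measurable
  also have "(\<integral>\<^sup>+s. ennreal (s ^ N * bessel_K (real v) (2 * c * s)) * indicator {0..} s \<partial>lborel)
     = (\<integral>\<^sup>+s. \<integral>\<^sup>+t. ennreal (cosh (real v * t)) * indicator {0..} t *
          (ennreal (s ^ N * exp (- (2 * c * cosh t * s))) * indicator {0..} s) \<partial>lborel \<partial>lborel)"
  proof (intro nn_integral_cong)
    fix s :: real
    show "ennreal (s ^ N * bessel_K (real v) (2 * c * s)) * indicator {0..} s =
        (\<integral>\<^sup>+t. ennreal (cosh (real v * t)) * indicator {0..} t *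
          (ennreal (s ^ N * exp (- (2 * c * cosh t * s))) * indicator {0..} s) \<partial>lborel)"
    proof (cases "s > 0")
      case True
      then have "ennreal (s ^ N * bessel_K (real v) (2 * c * s)) * indicator {0..} s
        = ennreal (s ^ N) * ennreal (bessel_K (real v) (2 * c * s))"
        by (simp add: ennreal_mult bessel_K_nonneg)
      also have "\<dots> = (\<integral>\<^sup>+t. ennreal (s ^ N) * (ennreal (exp (- (2 * c * s * cosh t)) * cosh (real v * t)) * indicator {0..} t) \<partial>lborel)"
        using True c by (subst nn_integral_bessel_K) (auto simp: nn_integral_cmult)
      also have "\<dots> = (\<integral>\<^sup>+t. ennreal (cosh (real v * t)) * indicator {0..} t *
          (ennreal (s ^ N * exp (- (2 * c * cosh t * s))) * indicator {0..} s) \<partial>lborel)"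
        using True by (intro nn_integral_cong) (auto simp: ennreal_mult mult_ac)
      finally show ?thesis .
    next
      case False
      then show ?thesis using N(1) by (cases "s = 0") (auto simp: power_0_left)
    qed
  qed
  also have "\<dots> = (\<integral>\<^sup>+t. \<integral>\<^sup>+s. ennreal (cosh (real v * t)) * indicator {0..} t *
          (ennreal (s ^ N * exp (- (2 * c * cosh t * s))) * indicator {0..} s) \<partial>lborel \<partial>lborel)"
    by (intro lborel_pair.Fubini') measurable
  also have "\<dots> = (\<integral>\<^sup>+t. ennreal (fact N / c ^ Suc N) * (ennreal (cosh (real v * t) / (2 * cosh t) ^ (2 * k + v)) * indicator {0..} t) \<partial>lborel)"
  proof (intro nn_integral_cong)
    fix t :: real
    have "(\<integral>\<^sup>+s. ennreal (cosh (real v * t)) * indicator {0..} t *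
          (ennreal (s ^ N * exp (- (2 * c * cosh t * s))) * indicator {0..} s) \<partial>lborel)
       = ennreal (cosh (real v * t)) * indicator {0..} t * ennreal (fact N / (2 * c * cosh t) ^ Suc N)"
      using c cosh_real_pos[of t] by (subst nn_integral_cmult) (auto simp: nn_integral_power_exp)
    also have "fact N / (2 * c * cosh t) ^ Suc N = fact N / c ^ Suc N * (1 / (2 * cosh t) ^ (2 * k + v))"
      using c unfolding N by (simp add: power_mult_distrib)
    also have "ennreal (cosh (real v * t)) * indicator {0..} t * ennreal \<dots>
      = ennreal (fact N / c ^ Suc N) * (ennreal (cosh (real v * t) * (1 / (2 * cosh t) ^ (2 * k + v))) * indicator {0..} t)"
      using c cosh_real_pos[of t] by (subst (1 2) ennreal_mult) (auto simp: mult_ac)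
    finally show "(\<integral>\<^sup>+s. ennreal (cosh (real v * t)) * indicator {0..} t *
          (ennreal (s ^ N * exp (- (2 * c * cosh t * s))) * indicator {0..} s) \<partial>lborel)
       = ennreal (fact N / c ^ Suc N) * (ennreal (cosh (real v * t) / (2 * cosh t) ^ (2 * k + v)) * indicator {0..} t)"
      by simp
  qed
  also have "\<dots> = ennreal (fact N / c ^ Suc N) * ennreal (fact (k - 1) * fact (k + v - 1) / (4 * fact (2 * k + v - 1)))"
    unfolding nn_integral_cosh_power[OF k, symmetric] by (intro nn_integral_cmult) measurable
  also have "\<dots> = ennreal (fact (k - 1) * fact (k + v - 1) / (4 * c ^ (2 * k + v)))"
    using c unfolding N(2) by (subst ennreal_mult'[symmetric]) (auto simp: N_def)
  also have "ennreal pi * \<dots> = ennreal (pi * fact (k - 1) * fact (k + v - 1) / (4 * c ^ (2 * k + v)))"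
    by (subst ennreal_mult'[symmetric]) (auto simp: mult.assoc)
  finally show ?thesis .
qed

section \<open>Exponential tilting\<close>

text \<open>
  The moments are \<open>(k - 1)! (k + v - 1)! / v!\<close>, those of the product of two independent gamma
  variables with parameters \<open>1\<close> and \<open>v + 1\<close>. The index is shifted so that \<open>k\<close> counts the particles.
\<close>
locale gamma_product_law =
  fixes N :: "real measure" and v :: nat
  assumes sets_N [measurable_cong]: "sets N = sets borel"
    and AE_nonneg: "AE w in N. 0 \<le> w"
    and moments: "\<And>k. k \<ge> 1 \<Longrightarrow>
      has_bochner_integral N (\<lambda>w. w ^ (k - 1)) (\<Prod>i=1..<k. real i * real (i + v))"
begin

definition step :: "nat \<Rightarrow> real" where
  "step i = real i * real (i + v)"

definition mass :: "nat \<Rightarrow> real" where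
  "mass k = (\<Prod>i=1..<k. step i)"

text \<open>
  The probability of \<open>B\<close> after an exponential change of measure in \<open>log w\<close>; the denominator is the
  moment of \<open>N\<close> of order \<open>k - 1\<close>.
\<close>
definition tilt :: "nat \<Rightarrow> real set \<Rightarrow> real" where
  "tilt k B = (\<integral>w. w ^ (k - 1) * indicator B w \<partial>N) / mass k"

lemma step_pos: "i \<ge> 1 \<Longrightarrow> step i > 0"
  by (simp add: step_def)

lemma mass_pos: "mass k > 0"
  unfolding mass_def by (intro prod_pos) (auto simp: step_pos)

lemma mass_split: "1 \<le> k \<Longrightarrow> k \<le> k' \<Longrightarrow> mass k' = mass k * (\<Prod>i=k..<k'. step i)"
  unfolding mass_def by (rule prod.atLeastLessThan_concat[symmetric])

lemma mass_Suc: "1 \<le> k \<Longrightarrow> mass (Suc k) = mass k * step k"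
  unfolding mass_def by simp

lemma moment: "k \<ge> 1 \<Longrightarrow> has_bochner_integral N (\<lambda>w. w ^ (k - 1)) (mass k)"
  using moments[of k] by (simp add: step_def mass_def)

lemma integrable_power_indicator:
  assumes [measurable]: "B \<in> sets borel" and k: "k \<ge> 1"
  shows "integrable N (\<lambda>w. w ^ (k - 1) * indicator B w)"
  using integrable_mult_indicator[of B N "\<lambda>w. w ^ (k - 1)"] moment[OF k] sets_N
  by (auto simp: mult.commute has_bochner_integral_iff)

lemma tilt_UNIV: "k \<ge> 1 \<Longrightarrow> tilt k UNIV = 1"
  using moment[of k] less_imp_neq[OF mass_pos[of k]] by (simp add: tilt_def has_bochner_integral_iff)

text \<open>
  All tail estimates compare the densities \<open>w\<^bsup>k-1\<^esup>\<close> and \<open>w\<^bsup>k'-1\<^esup>\<close> pointwise on a set.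
\<close>
lemma tilt_compare:
  assumes [measurable]: "B \<in> sets borel" "B' \<in> sets borel" and k: "k \<ge> 1" "k' \<ge> 1"
    and le: "\<And>w. w \<ge> 0 \<Longrightarrow> w \<in> B \<Longrightarrow> w \<in> B' \<and> w ^ (k - 1) \<le> c * w ^ (k' - 1)"
    and c: "c \<ge> 0"
  shows "tilt k B * mass k \<le> c * (tilt k' B' * mass k')"
proof -
  have "(\<integral>w. w ^ (k - 1) * indicator B w \<partial>N) \<le> (\<integral>w. c * (w ^ (k' - 1) * indicator B' w) \<partial>N)"
  proof (rule integral_mono_AE)
    show "AE w in N. w ^ (k - 1) * indicator B w \<le> c * (w ^ (k' - 1) * indicator B' w)"
      using AE_nonneg by eventually_elim (use le c in \<open>auto simp: indicator_def\<close>)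
  qed (intro integrable_mult_right integrable_power_indicator k assms(1,2))+
  then show ?thesis
    using mass_pos[of k] mass_pos[of k'] by (simp add: tilt_def)
qed

lemma tilt_nonneg: "tilt k B \<ge> 0"
  unfolding tilt_def
  by (intro divide_nonneg_pos mass_pos integral_nonneg_AE)
    (use AE_nonneg in \<open>auto elim!: eventually_mono\<close>)

lemma tilt_mono:
  assumes "B \<in> sets borel" "B' \<in> sets borel" "B \<subseteq> B'" "k \<ge> 1"
  shows "tilt k B \<le> tilt k B'"
  using tilt_compare[of B B' k k 1] assms mass_pos[of k] by auto

lemma tilt_le_1: "B \<in> sets borel \<Longrightarrow> k \<ge> 1 \<Longrightarrow> tilt k B \<le> 1"
  using tilt_mono[of B UNIV k] tilt_UNIV[of k] by simp

lemma tilt_Compl: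
  assumes [measurable]: "B \<in> sets borel" and k: "k \<ge> 1"
  shows "tilt k (- B) = 1 - tilt k B"
proof -
  have "(\<integral>w. w ^ (k - 1) * indicator B w \<partial>N) + (\<integral>w. w ^ (k - 1) * indicator (- B) w \<partial>N)
      = (\<integral>w. w ^ (k - 1) * indicator B w + w ^ (k - 1) * indicator (- B) w \<partial>N)"
    by (intro Bochner_Integration.integral_add[symmetric] integrable_power_indicator k) auto
  also have "\<dots> = (\<integral>w. w ^ (k - 1) \<partial>N)"
    by (intro Bochner_Integration.integral_cong) (auto simp: indicator_def)
  also have "\<dots> = mass k" using moment[OF k] by (simp add: has_bochner_integral_iff)
  finally show ?thesis
    using mass_pos[of k] unfolding tilt_def by (simp add: field_simps del: One_nat_def)
qed

text \<open>
  Chernoff's bound, with the exponent chosen as a whole number: where \<open>w \<ge> R\<close>, the weight \<open>w\<^bsup>k-1\<^esup>\<close> is at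
  most \<open>w\<^bsup>k'-1\<^esup> / R\<^bsup>k'-k\<^esup>\<close>.
\<close>
lemma upper_tail_le:
  assumes k: "1 \<le> k" "k \<le> k'" and R: "R > 0"
  shows "tilt k {R..} \<le> (\<Prod>i=k..<k'. step i / R)"
proof -
  have "w ^ (k - 1) \<le> (1 / R) ^ (k' - k) * w ^ (k' - 1)" if "w \<ge> R" for w
  proof -
    have "w ^ (k - 1) * 1 \<le> w ^ (k - 1) * (w / R) ^ (k' - k)"
      using that R by (intro mult_left_mono one_le_power) auto
    also have "\<dots> = (1 / R) ^ (k' - k) * w ^ ((k - 1) + (k' - k))"
      by (simp add: power_divide power_add)
    finally show ?thesis using k by simp
  qed
  then have "tilt k {R..} * mass k \<le> (1 / R) ^ (k' - k) * (tilt k' UNIV * mass k')"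
    using k R by (intro tilt_compare) auto
  also have "\<dots> = (\<Prod>i=k..<k'. step i / R) * mass k"
    using k R by (simp add: tilt_UNIV mass_split[OF k] prod_dividef power_divide)
  finally show ?thesis using mass_pos[of k] by simp
qed

lemma lower_tail_le:
  assumes k: "1 \<le> k'" "k' \<le> k" and R: "R > 0"
  shows "tilt k {..R} \<le> (\<Prod>i=k'..<k. R / step i)"
proof -
  have "w ^ (k - 1) \<le> R ^ (k - k') * w ^ (k' - 1)" if "w \<le> R" "w \<ge> 0" for w
  proof -
    have "w ^ (k - k') * w ^ (k' - 1) \<le> R ^ (k - k') * w ^ (k' - 1)"
      using that by (intro mult_right_mono power_mono) auto
    then show ?thesis using k by (simp flip: power_add)
  qed
  then have "tilt k {..R} * mass k \<le> R ^ (k - k') * (tilt k' UNIV * mass k')"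
    using k R by (intro tilt_compare) auto
  also have "\<dots> = (\<Prod>i=k'..<k. R / step i) * mass k"
  proof -
    define P where "P = (\<Prod>i=k'..<k. step i)"
    have "P > 0" unfolding P_def using k by (intro prod_pos) (auto simp: step_pos)
    moreover have "(\<Prod>i=k'..<k. R / step i) = R ^ (k - k') / P" by (simp add: P_def prod_dividef)
    moreover have "mass k = mass k' * P" unfolding P_def by (rule mass_split[OF k])
    ultimately show ?thesis using k by (simp add: tilt_UNIV)
  qed
  finally show ?thesis using mass_pos[of k] by simp
qed

text \<open>
  A converse of Chernoff's bound: below \<open>R'\<close> the ratio \<open>w\<^bsup>k'-k\<^esup>\<close> of the two densities is at most
  \<open>R'\<^bsup>k'-k\<^esup>\<close>. The bound is effective if the tilt \<open>k'\<close> gives \<open>[R, R']\<close> a substantial mass.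
\<close>
lemma upper_tail_ge:
  assumes k: "1 \<le> k" "k \<le> k'" and R: "R' > 0"
  shows "(\<Prod>i=k..<k'. step i / R') * tilt k' {R..R'} \<le> tilt k {R..}"
proof -
  have "w ^ (k' - 1) \<le> R' ^ (k' - k) * w ^ (k - 1)" if "w \<le> R'" "w \<ge> 0" for w
  proof -
    have "w ^ (k' - k) * w ^ (k - 1) \<le> R' ^ (k' - k) * w ^ (k - 1)"
      using that by (intro mult_right_mono power_mono) auto
    then show ?thesis using k by (simp flip: power_add)
  qed
  then have "tilt k' {R..R'} * mass k' \<le> R' ^ (k' - k) * (tilt k {R..} * mass k)"
    using k R by (intro tilt_compare) auto
  then have "(tilt k' {R..R'} * (\<Prod>i=k..<k'. step i)) * mass k \<le> (R' ^ (k' - k) * tilt k {R..}) * mass k"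
    by (simp add: mass_split[OF k] mult_ac)
  then have "tilt k' {R..R'} * (\<Prod>i=k..<k'. step i) \<le> R' ^ (k' - k) * tilt k {R..}"
    using mass_pos[of k] by simp
  then show ?thesis using R by (simp add: prod_dividef field_simps)
qed

lemma lower_tail_ge:
  assumes k: "1 \<le> k'" "k' \<le> k" and R: "R' > 0"
  shows "(\<Prod>i=k'..<k. R' / step i) * tilt k' {R'..R} \<le> tilt k {..R}"
proof -
  have "w ^ (k' - 1) \<le> (1 / R') ^ (k - k') * w ^ (k - 1)" if "w \<ge> R'" for w
  proof -
    have "w ^ (k' - 1) * 1 \<le> w ^ (k' - 1) * (w / R') ^ (k - k')"
      using that R by (intro mult_left_mono one_le_power) auto
    also have "\<dots> = (1 / R') ^ (k - k') * w ^ ((k' - 1) + (k - k'))"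
      by (simp add: power_divide power_add)
    finally show ?thesis using k by simp
  qed
  then have "tilt k' {R'..R} * mass k' \<le> (1 / R') ^ (k - k') * (tilt k {..R} * mass k)"
    using k R by (intro tilt_compare) auto
  then have "tilt k' {R'..R} * mass k' \<le> ((1 / R') ^ (k - k') * (\<Prod>i=k'..<k. step i) * tilt k {..R}) * mass k'"
    by (simp add: mass_split[OF k] mult_ac)
  then have "tilt k' {R'..R} \<le> (1 / R') ^ (k - k') * (\<Prod>i=k'..<k. step i) * tilt k {..R}"
    using mass_pos[of k'] by simp
  moreover have "(\<Prod>i=k'..<k. step i) > 0" using k by (intro prod_pos) (auto simp: step_pos)
  ultimately show ?thesis using R by (simp add: prod_dividef field_simps power_divide)
qed

text \<open>
  Markov's inequality, since \<open>step k\<close> is the mean of the tilt \<open>k\<close>.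
\<close>
lemma lower_tail_markov:
  assumes k: "1 \<le> k" and R: "R > 0"
  shows "1 - step k / R \<le> tilt k {..R}"
proof -
  have "1 - tilt k {..R} = tilt k {R<..}"
    using tilt_Compl[of "{..R}" k] k by (simp add: Compl_atMost)
  also have "\<dots> \<le> tilt k {R..}" using k by (intro tilt_mono) auto
  also have "\<dots> \<le> step k / R" using upper_tail_le[of k "Suc k" R] k R by simp
  finally show ?thesis by simp
qed

text \<open>
  Chebyshev's inequality: the tilt \<open>k\<close> has mean \<open>k (k + v)\<close> and variance \<open>k (k + v) (2 k + v + 1)\<close>,
  and the variance divided by the square of the mean is at most \<open>3 / k\<close>.
\<close>
lemma concentration:
  assumes k: "1 \<le> k" and d: "d > 0" and dk: "6 \<le> real k * d\<^sup>2"
    and a: "a \<le> (1 - d) * step k" and b: "(1 + d) * step k \<le> b"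
  shows "1 / 2 \<le> tilt k {a..b}"
proof -
  let ?\<mu> = "step k"
  have pos: "?\<mu> > 0" using k by (rule step_pos)
  have m: "has_bochner_integral N (\<lambda>w. (w ^ (k + 1) - 2 * ?\<mu> * w ^ k + ?\<mu>\<^sup>2 * w ^ (k - 1)) * (1 / (d * ?\<mu>)\<^sup>2))
      (((mass (k+2)) - 2 * ?\<mu> * (mass (k+1)) + ?\<mu>\<^sup>2 * mass k) * (1 / (d * ?\<mu>)\<^sup>2))"
    using moment[of "k + 2"] moment[of "k + 1"] moment[of k] k
    by (intro has_bochner_integral_mult_left has_bochner_integral_add has_bochner_integral_diff
         has_bochner_integral_mult_right) auto
  have "(\<integral>w. w ^ (k - 1) * indicator (- {a..b}) w \<partial>N)
      \<le> (\<integral>w. (w ^ (k + 1) - 2 * ?\<mu> * w ^ k + ?\<mu>\<^sup>2 * w ^ (k - 1)) * (1 / (d * ?\<mu>)\<^sup>2) \<partial>N)"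
  proof (rule integral_mono_AE)
    show "integrable N (\<lambda>w. w ^ (k - 1) * indicator (- {a..b}) w)"
      using k by (intro integrable_power_indicator) auto
    show "integrable N (\<lambda>w. (w ^ (k + 1) - 2 * ?\<mu> * w ^ k + ?\<mu>\<^sup>2 * w ^ (k - 1)) * (1 / (d * ?\<mu>)\<^sup>2))"
      using m by (simp add: has_bochner_integral_iff)
    show "AE w in N. w ^ (k - 1) * indicator (- {a..b}) w
       \<le> (w ^ (k + 1) - 2 * ?\<mu> * w ^ k + ?\<mu>\<^sup>2 * w ^ (k - 1)) * (1 / (d * ?\<mu>)\<^sup>2)"
      using AE_nonneg
    proof eventually_elim
      fix w :: real assume w: "0 \<le> w"
      obtain k0 where k0: "k = Suc k0" using k by (cases k) auto
      have eq: "(w ^ (k + 1) - 2 * ?\<mu> * w ^ k + ?\<mu>\<^sup>2 * w ^ (k - 1)) * (1 / (d * ?\<mu>)\<^sup>2)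
         = w ^ (k - 1) * ((w - ?\<mu>) / (d * ?\<mu>))\<^sup>2"
        unfolding k0 by (simp add: power_divide power2_eq_square algebra_simps add_divide_distrib diff_divide_distrib)
      have "1 \<le> ((w - ?\<mu>) / (d * ?\<mu>))\<^sup>2" if "w \<notin> {a..b}"
      proof -
        have "d * ?\<mu> \<le> \<bar>w - ?\<mu>\<bar>"
          using that a b by (auto simp: algebra_simps)
        then have "1 \<le> \<bar>(w - ?\<mu>) / (d * ?\<mu>)\<bar>" using d pos by (simp add: abs_mult)
        then show ?thesis using one_le_power[of "\<bar>(w - ?\<mu>) / (d * ?\<mu>)\<bar>" 2] by (simp only: power2_abs)
      qed
      then have "indicator (- {a..b}) w \<le> ((w - ?\<mu>) / (d * ?\<mu>))\<^sup>2"
        by (auto simp: indicator_def)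
      then show "w ^ (k - 1) * indicator (- {a..b}) w
       \<le> (w ^ (k + 1) - 2 * ?\<mu> * w ^ k + ?\<mu>\<^sup>2 * w ^ (k - 1)) * (1 / (d * ?\<mu>)\<^sup>2)"
        unfolding eq using w by (intro mult_left_mono) auto
    qed
  qed
  also have "\<dots> = ((mass (k+2)) - 2 * ?\<mu> * (mass (k+1)) + ?\<mu>\<^sup>2 * mass k) * (1 / (d * ?\<mu>)\<^sup>2)"
    using m by (simp add: has_bochner_integral_iff)
  also have "\<dots> = mass k * ((step (Suc k) - ?\<mu>) / (d\<^sup>2 * ?\<mu>))"
    using k pos d by (simp add: mass_Suc power2_eq_square field_simps)
  finally have "tilt k (- {a..b}) \<le> (step (Suc k) - ?\<mu>) / (d\<^sup>2 * ?\<mu>)"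
    using mass_pos[of k] by (simp add: tilt_def field_simps)
  also have "\<dots> \<le> 1 / 2"
  proof -
    have "2 * (step (Suc k) - ?\<mu>) = 2 * (2 * real k + v + 1)" by (simp add: step_def algebra_simps)
    also have "\<dots> \<le> 6 * real (k + v)" using k by simp
    also have "\<dots> \<le> real k * d\<^sup>2 * real (k + v)" using dk by (intro mult_right_mono) auto
    finally show ?thesis using pos d by (simp add: step_def field_simps)
  qed
  finally show ?thesis using tilt_Compl[of "{a..b}" k] k by simp
qed

end

section \<open>Independence of the moduli\<close>

text \<open>
  The law \<open>N\<close> is the image of the normalised one-particle weight under \<open>z \<mapsto> n\<^sup>2 \<bar>z\<bar>\<^sup>4\<close>. Restricting
  all particles to \<open>B\<close> replaces every radial moment by the same moment over \<open>B\<close>, and the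
  constants \<open>C\<close>, \<open>n!\<close> and \<open>2\<^bsup>-n\<^esup>\<close> drop out on comparing with \<open>B = UNIV\<close>.
\<close>
lemma joint_law:
  fixes n v :: nat
  assumes n: "n \<ge> 1" and "prob_space M"
    and Z: "distributed M (lborel_vec n) Z (\<lambda>z. ennreal (chiral_density n v z))"
  obtains N where "gamma_product_law N v"
    and "\<And>B. B \<in> sets borel \<Longrightarrow>
      measure M {\<omega> \<in> space M. \<forall>i\<in>{1..n}. (real n)\<^sup>2 * norm (Z \<omega> i) ^ 4 \<in> B}
        = (\<Prod>k=1..n. gamma_product_law.tilt N v k B)"
proof -
  interpret prob_space M by fact
  define r where "r s = s ^ (2 * (v + 1)) * bessel_K (real v) (2 * real n * s\<^sup>2)" for s
  define W where "W z = (real n)\<^sup>2 * norm z ^ 4" for z :: complex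
  define c where "c a = pi * fact a * fact (a + v) / (4 * real n ^ (2 * a + 2 + v))" for a
  have [measurable]: "r \<in> borel_measurable borel" unfolding r_def by measurable
  have [measurable]: "W \<in> borel_measurable borel" unfolding W_def by measurable
  have r0: "r (norm z) \<ge> 0" for z :: complex by (simp add: r_def bessel_K_nonneg)
  have c0: "c a > 0" for a using n by (simp add: c_def)
  have mom: "has_bochner_integral lborel (\<lambda>z::complex. norm z ^ (4 * a) * r (norm z)) (c a)" for a
  proof (rule has_bochner_integral_nn_integral)
    show "(\<integral>\<^sup>+z. ennreal (norm (z::complex) ^ (4 * a) * r (norm z)) \<partial>lborel) = ennreal (c a)"
      using nn_integral_bessel_K_moment[of "Suc a" "real n" v] n by (simp add: r_def c_def mult.assoc)
  qed (use c0[of a] r0 in auto)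
  define N where "N = distr (density lborel (\<lambda>z. ennreal (r (norm z) / c 0))) borel W"
  have N_int: "integral\<^sup>L N g = (\<integral>z. r (norm z) / c 0 * g (W z) \<partial>lborel)"
    and N_ible: "integrable N g \<longleftrightarrow> integrable lborel (\<lambda>z. r (norm z) / c 0 * g (W z))"
    if [measurable]: "g \<in> borel_measurable borel" for g :: "real \<Rightarrow> real"
    unfolding N_def using r0 c0[of 0]
    by (simp_all add: integral_distr integrable_distr_eq integral_real_density integrable_real_density)
  have W_pow: "W z ^ a = real n ^ (2 * a) * norm z ^ (4 * a)" for z a
    by (simp add: W_def power_mult_distrib flip: power_mult)
  have c_prod: "real n ^ (2 * a) * c a / c 0 = (\<Prod>i=1..<Suc a. real i * real (i + v))" for a
  proof (induction a)
    case 0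
    then show ?case using c0[of 0] by simp
  next
    case (Suc a)
    have "real n ^ (2 * Suc a) * c (Suc a) / c 0 = (real n ^ (2 * a) * c a / c 0) * (real (Suc a) * real (Suc a + v))"
      using n by (simp add: c_def field_simps power_add)
    then show ?case using Suc by simp
  qed
  interpret gamma_product_law N v
  proof
    show "sets N = sets borel" by (simp add: N_def)
    show "AE w in N. 0 \<le> w"
      unfolding N_def by (subst AE_distr_iff) (auto simp: W_def)
    show "has_bochner_integral N (\<lambda>w. w ^ (k - 1)) (\<Prod>i=1..<k. real i * real (i + v))" if k: "k \<ge> 1" for k
    proof -
      have eq: "r (norm z) / c 0 * W z ^ (k - 1) = real n ^ (2 * (k - 1)) / c 0 * (norm z ^ (4 * (k - 1)) * r (norm z))" for z
        by (simp add: W_pow)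
      have m: "(\<lambda>w::real. w ^ (k - 1)) \<in> borel_measurable borel" by measurable
      have "has_bochner_integral lborel (\<lambda>z. r (norm z) / c 0 * W z ^ (k - 1)) (real n ^ (2 * (k - 1)) / c 0 * c (k - 1))"
        unfolding eq by (intro has_bochner_integral_mult_right mom)
      moreover have "real n ^ (2 * (k - 1)) / c 0 * c (k - 1) = (\<Prod>i=1..<k. real i * real (i + v))"
        using c_prod[of "k - 1"] k by simp
      ultimately have "has_bochner_integral lborel (\<lambda>z. r (norm z) / c 0 * W z ^ (k - 1)) (\<Prod>i=1..<k. real i * real (i + v))"
        by (simp only:)
      then show ?thesis unfolding has_bochner_integral_iff N_int[OF m] N_ible[OF m] .
    qed
  qed
  define I where "I a B = (\<integral>z. norm z ^ (4 * a) * (r (norm z) * indicator B ((real n)\<^sup>2 * norm (z::complex) ^ 4)) \<partial>lborel)" for a B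
  have tilt_I: "tilt (Suc a) B = I a B / I a UNIV" if [measurable]: "B \<in> sets borel" for a B
  proof -
    have 1: "(\<integral>w. w ^ a * indicator B w \<partial>N) = real n ^ (2 * a) / c 0 * I a B" if [measurable]: "B \<in> sets borel" for B
    proof -
      have "(\<integral>w. w ^ a * indicator B w \<partial>N) = (\<integral>z. r (norm z) / c 0 * (W z ^ a * indicator B (W z)) \<partial>lborel)"
        by (rule N_int) measurable
      also have "\<dots> = (\<integral>z. real n ^ (2 * a) / c 0 * (norm z ^ (4 * a) * (r (norm z) * indicator B ((real n)\<^sup>2 * norm (z::complex) ^ 4))) \<partial>lborel)"
        by (intro Bochner_Integration.integral_cong refl) (simp add: W_pow W_def[symmetric])
      also have "\<dots> = real n ^ (2 * a) / c 0 * I a B"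
        unfolding I_def by (rule integral_mult_right_zero)
      finally show ?thesis .
    qed
    have "tilt (Suc a) B = tilt (Suc a) B / tilt (Suc a) UNIV" using tilt_UNIV[of "Suc a"] by simp
    also have "\<dots> = (\<integral>w. w ^ a * indicator B w \<partial>N) / (\<integral>w. w ^ a * indicator UNIV w \<partial>N)"
      using mass_pos[of "Suc a"] by (simp add: tilt_def)
    also have "\<dots> = I a B / I a UNIV"
      unfolding 1[OF that] 1[of UNIV, OF sets.top[of borel, unfolded space_borel]] using n c0[of 0] by simp
    finally show ?thesis .
  qed
  have prob: "prob {\<omega> \<in> space M. \<forall>i\<in>{1..n}. (real n)\<^sup>2 * norm (Z \<omega> i) ^ 4 \<in> B}
      = chiral_const n v * (fact n * (\<Prod>a<n. 1 / 2 * I a B))" if B[measurable]: "B \<in> sets borel" for B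
  proof -
    \<comment> \<open>the one-particle weight restricted to \<open>B\<close>\<close>
    define \<rho> where "\<rho> s = r s * indicator B ((real n)\<^sup>2 * s ^ 4)" for s
    have [measurable]: "\<rho> \<in> borel_measurable borel" unfolding \<rho>_def by measurable
    define A where "A = {z \<in> space (lborel_vec n). \<forall>i\<in>{1..n}. (real n)\<^sup>2 * norm (z i) ^ 4 \<in> B}"
    have A: "A \<in> sets (lborel_vec n)" unfolding A_def lborel_vec_def by measurable
    have Cnn: "chiral_const n v \<ge> 0" by (simp add: chiral_const_def)
    have \<rho>0: "\<rho> s \<ge> 0" for s
      unfolding \<rho>_def r_def
      by (intro mult_nonneg_nonneg bessel_K_nonneg zero_le_even_power dvd_triv_left) (simp add: indicator_def)
    have Zm: "Z \<in> measurable M (lborel_vec n)" using Z by (simp add: distributed_def)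
    have "{\<omega> \<in> space M. \<forall>i\<in>{1..n}. (real n)\<^sup>2 * norm (Z \<omega> i) ^ 4 \<in> B} = Z -` A \<inter> space M"
      using measurable_space[OF Zm] by (auto simp: A_def)
    then have "emeasure M {\<omega> \<in> space M. \<forall>i\<in>{1..n}. (real n)\<^sup>2 * norm (Z \<omega> i) ^ 4 \<in> B}
      = (\<integral>\<^sup>+z. ennreal (chiral_density n v z) * indicator A z \<partial>lborel_vec n)"
      using distributed_emeasure[OF Z A] by simp
    also have "\<dots> = (\<integral>\<^sup>+z. ennreal (chiral_const n v) * ennreal (if \<forall>j\<in>{1..n}. Re (z j) > 0 then
        (\<Prod>k=1..n. \<Prod>j=1..<k. (norm ((z j)\<^sup>2 - (z k)\<^sup>2))\<^sup>2) * (\<Prod>j=1..n. \<rho> (norm (z j))) else 0) \<partial>lborel_vec n)"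
    proof (rule nn_integral_cong)
      fix z assume z: "z \<in> space (lborel_vec n)"
      have "(\<Prod>j=1..n. \<rho> (norm (z j))) = (\<Prod>j=1..n. r (norm (z j))) * indicator A z"
      proof (cases "z \<in> A")
        case True
        then show ?thesis by (auto simp: \<rho>_def A_def intro!: prod.cong)
      next
        case False
        then obtain i where "i \<in> {1..n}" "(real n)\<^sup>2 * norm (z i) ^ 4 \<notin> B" using z by (auto simp: A_def)
        then have "(\<Prod>j=1..n. \<rho> (norm (z j))) = 0"
          by (intro prod_zero) (auto simp: \<rho>_def intro!: bexI[of _ i])
        then show ?thesis using False by simp
      qed
      then have "chiral_weight n v z * indicator A z = (if \<forall>j\<in>{1..n}. Re (z j) > 0 then
        (\<Prod>k=1..n. \<Prod>j=1..<k. (norm ((z j)\<^sup>2 - (z k)\<^sup>2))\<^sup>2) * (\<Prod>j=1..n. \<rho> (norm (z j))) else 0)" (is "_ = ?f")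
        unfolding chiral_weight_def r_def by simp
      moreover have "ennreal (chiral_density n v z) * indicator A z
        = ennreal (chiral_const n v) * ennreal (chiral_weight n v z * indicator A z)"
        unfolding chiral_density_def using Cnn by (subst ennreal_mult') (auto simp: indicator_def)
      ultimately show "ennreal (chiral_density n v z) * indicator A z = ennreal (chiral_const n v) * ennreal ?f"
        by simp
    qed
    also have "\<dots> = ennreal (chiral_const n v) * (\<integral>\<^sup>+z. ennreal (if \<forall>j\<in>{1..n}. Re (z j) > 0 then
        (\<Prod>k=1..n. \<Prod>j=1..<k. (norm ((z j)\<^sup>2 - (z k)\<^sup>2))\<^sup>2) * (\<Prod>j=1..n. \<rho> (norm (z j))) else 0) \<partial>lborel_vec n)"
    proof (rule nn_integral_cmult)
      have [measurable]: "(\<lambda>z. z j) \<in> measurable (lborel_vec n) borel" if "j \<in> {1..n}" for j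
        using measurable_component_singleton[OF that, of "\<lambda>_. lborel :: complex measure"]
        by (simp add: lborel_vec_def)
      show "(\<lambda>z. ennreal (if \<forall>j\<in>{1..n}. Re (z j) > 0 then
        (\<Prod>k=1..n. \<Prod>j=1..<k. (norm ((z j)\<^sup>2 - (z k)\<^sup>2))\<^sup>2) * (\<Prod>j=1..n. \<rho> (norm (z j))) else 0)) \<in> borel_measurable (lborel_vec n)"
        by measurable
    qed
    also have "(\<integral>\<^sup>+z. ennreal (if \<forall>j\<in>{1..n}. Re (z j) > 0 then
        (\<Prod>k=1..n. \<Prod>j=1..<k. (norm ((z j)\<^sup>2 - (z k)\<^sup>2))\<^sup>2) * (\<Prod>j=1..n. \<rho> (norm (z j))) else 0) \<partial>lborel_vec n)
      = ennreal (fact n * (\<Prod>a<n. 1 / 2 * (\<integral>z. norm z ^ (4 * a) * \<rho> (norm (z::complex)) \<partial>lborel)))"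
    proof (rule nn_integral_vandermonde_radial)
      show "integrable lborel (\<lambda>z::complex. norm z ^ (4 * a) * \<rho> (norm z))" for a
      proof (rule Bochner_Integration.integrable_bound)
        show "integrable lborel (\<lambda>z::complex. norm z ^ (4 * a) * r (norm z))"
          using mom[of a] by (simp add: has_bochner_integral_iff)
      qed (auto simp: \<rho>_def indicator_def abs_mult)
    qed (auto simp: \<rho>0)
    also have "(\<lambda>a. (\<integral>z. norm z ^ (4 * a) * \<rho> (norm (z::complex)) \<partial>lborel)) = (\<lambda>a. I a B)"
      by (simp add: I_def \<rho>_def)
    finally have "emeasure M {\<omega> \<in> space M. \<forall>i\<in>{1..n}. (real n)\<^sup>2 * norm (Z \<omega> i) ^ 4 \<in> B}
      = ennreal (chiral_const n v * (fact n * (\<Prod>a<n. 1 / 2 * I a B)))"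
      using Cnn by (simp add: ennreal_mult')
    moreover have "I a B \<ge> 0" for a
      unfolding I_def using r0 by (intro Bochner_Integration.integral_nonneg) auto
    ultimately show ?thesis
      using Cnn by (simp add: measure_def prod_nonneg)
  qed
  have "(\<Prod>k=1..n. tilt k B) = measure M {\<omega> \<in> space M. \<forall>i\<in>{1..n}. (real n)\<^sup>2 * norm (Z \<omega> i) ^ 4 \<in> B}"
    if B: "B \<in> sets borel" for B
  proof -
    \<comment> \<open>the total mass of the density\<close>
    define b where "b = chiral_const n v * (fact n * (\<Prod>a<n. 1 / 2 * I a UNIV))"
    have b: "b = 1" using prob[of UNIV] prob_space by (simp add: b_def)
    have "(\<Prod>k=1..n. tilt k B) = (\<Prod>a<n. tilt (Suc a) B)"
      by (rule prod.reindex_bij_witness[of _ Suc "\<lambda>j. j - 1"]) auto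
    also have "\<dots> = (\<Prod>a<n. (1 / 2 * I a B) / (1 / 2 * I a UNIV))"
      using tilt_I[OF B] by simp
    also have "\<dots> = (\<Prod>a<n. 1 / 2 * I a B) / (\<Prod>a<n. 1 / 2 * I a UNIV)"
      by (rule prod_dividef)
    also have "\<dots> = (chiral_const n v * (fact n * (\<Prod>a<n. 1 / 2 * I a B))) / b"
    proof -
      have "chiral_const n v \<noteq> 0" using b unfolding b_def by auto
      then show ?thesis unfolding b_def by simp
    qed
    finally show ?thesis using prob[OF B] b by simp
  qed
  then show thesis using that[OF gamma_product_law_axioms] by simp
qed

section \<open>The rate functions as Riemann sums\<close>

text \<open>
  With \<open>\<beta> = v / n\<close> and \<open>u = i / n\<close> this is the logarithm of \<open>i (i + v) / (x\<^sup>2 n (n + v))\<close>, the factor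
  contributed by the index \<open>i\<close> to a change of tilt.
\<close>
definition log_ratio :: "real \<Rightarrow> real \<Rightarrow> real \<Rightarrow> real" where
  "log_ratio \<beta> x u = ln (u * (u + \<beta>) / (x\<^sup>2 * (1 + \<beta>)))"

text \<open>
  This makes \<open>kappa \<beta> x\<close> the positive zero of \<open>u (u + \<beta>) - x\<^sup>2 (1 + \<beta>)\<close>: the sign change of the
  logarithms that are summed below.
\<close>
lemma kappa_eq:
  assumes "x > 0" "\<beta> \<ge> 0"
  shows "kappa \<beta> x > 0" "kappa \<beta> x * (kappa \<beta> x + \<beta>) = x\<^sup>2 * (1 + \<beta>)"
proof -
  define s where "s = sqrt (\<beta>\<^sup>2 + 4 * (1 + \<beta>) * x\<^sup>2)"
  have s2: "s\<^sup>2 = \<beta>\<^sup>2 + 4 * (1 + \<beta>) * x\<^sup>2" unfolding s_def using assms by simp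
  have "s > 0" unfolding s_def using assms by (simp add: add_nonneg_pos)
  then show "kappa \<beta> x > 0" unfolding kappa_def s_def[symmetric]
    using assms by (intro divide_pos_pos mult_pos_pos) (auto intro: add_nonneg_pos)
  have "(s - \<beta>) * (\<beta> + s) = 4 * (1 + \<beta>) * x\<^sup>2" using s2 by (simp add: algebra_simps power2_eq_square)
  then have "kappa \<beta> x = (s - \<beta>) / 2"
    unfolding kappa_def s_def[symmetric] using \<open>s > 0\<close> assms by (simp add: field_simps)
  then have "kappa \<beta> x * (kappa \<beta> x + \<beta>) = (s\<^sup>2 - \<beta>\<^sup>2) / 4"
    by (simp only:) (simp add: field_simps power2_eq_square)
  then show "kappa \<beta> x * (kappa \<beta> x + \<beta>) = x\<^sup>2 * (1 + \<beta>)"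
    unfolding s2 by (simp add: field_simps)
qed

lemma kappa_le_iff:
  assumes "x > 0" "\<beta> \<ge> 0" "u > 0"
  shows "kappa \<beta> x \<le> u \<longleftrightarrow> x\<^sup>2 * (1 + \<beta>) \<le> u * (u + \<beta>)"
proof
  assume "kappa \<beta> x \<le> u"
  then show "x\<^sup>2 * (1 + \<beta>) \<le> u * (u + \<beta>)"
    unfolding kappa_eq(2)[OF assms(1,2), symmetric] using kappa_eq(1)[OF assms(1,2)] assms
    by (intro mult_mono) auto
next
  assume *: "x\<^sup>2 * (1 + \<beta>) \<le> u * (u + \<beta>)"
  show "kappa \<beta> x \<le> u"
  proof (rule ccontr)
    assume "\<not> kappa \<beta> x \<le> u"
    then have "u * (u + \<beta>) < kappa \<beta> x * (kappa \<beta> x + \<beta>)"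
      using assms by (intro mult_strict_mono) auto
    then show False using * kappa_eq(2)[OF assms(1,2)] by simp
  qed
qed

lemma le_kappa_iff:
  assumes "x > 0" "\<beta> \<ge> 0" "u > 0"
  shows "u \<le> kappa \<beta> x \<longleftrightarrow> u * (u + \<beta>) \<le> x\<^sup>2 * (1 + \<beta>)"
proof
  assume "u \<le> kappa \<beta> x"
  then show "u * (u + \<beta>) \<le> x\<^sup>2 * (1 + \<beta>)"
    unfolding kappa_eq(2)[OF assms(1,2), symmetric] using assms by (intro mult_mono) auto
next
  assume *: "u * (u + \<beta>) \<le> x\<^sup>2 * (1 + \<beta>)"
  show "u \<le> kappa \<beta> x"
  proof (rule ccontr)
    assume "\<not> u \<le> kappa \<beta> x"
    then have "kappa \<beta> x * (kappa \<beta> x + \<beta>) < u * (u + \<beta>)"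
      using assms kappa_eq(1)[OF assms(1,2)] by (intro mult_strict_mono) auto
    then show False using * kappa_eq(2)[OF assms(1,2)] by simp
  qed
qed

lemma kappa_bounds_below_1:
  assumes "0 < x" "x \<le> 1" "\<beta> \<ge> 0"
  shows "x\<^sup>2 \<le> kappa \<beta> x" "kappa \<beta> x \<le> 1"
proof -
  have "x\<^sup>2 \<le> 1" using assms by (simp add: power_le_one)
  then show "x\<^sup>2 \<le> kappa \<beta> x"
    using assms by (subst le_kappa_iff) (auto intro!: mult_left_mono)
  show "kappa \<beta> x \<le> 1"
    using assms \<open>x\<^sup>2 \<le> 1\<close> by (subst kappa_le_iff) (auto intro!: mult_left_le_one_le)
qed

lemma kappa_bounds_above_1:
  assumes "1 \<le> x" "\<beta> \<ge> 0"
  shows "1 \<le> kappa \<beta> x" "kappa \<beta> x \<le> x\<^sup>2"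
proof -
  have "x\<^sup>2 \<ge> 1" using assms by simp
  then show "kappa \<beta> x \<le> x\<^sup>2"
    using assms by (subst kappa_le_iff) (auto intro!: mult_left_mono)
  show "1 \<le> kappa \<beta> x"
    using assms \<open>x\<^sup>2 \<ge> 1\<close> mult_right_mono[of 1 "x\<^sup>2" "1 + \<beta>"] by (subst le_kappa_iff) auto
qed

lemma log_ratio_eq:
  assumes "x > 0" "\<beta> \<ge> 0" "u > 0"
  shows "log_ratio \<beta> x u = ln u + ln (u + \<beta>) - (2 * ln x + ln (1 + \<beta>))"
  using assms by (simp add: log_ratio_def ln_div ln_mult ln_realpow)

lemma log_ratio_nonneg:
  assumes "x > 0" "\<beta> \<ge> 0" "kappa \<beta> x \<le> u"
  shows "log_ratio \<beta> x u \<ge> 0"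
proof -
  have u: "u > 0" using kappa_eq(1)[OF assms(1,2)] assms(3) by simp
  then have "1 \<le> u * (u + \<beta>) / (x\<^sup>2 * (1 + \<beta>))"
    using kappa_le_iff[OF assms(1,2) u] assms by (simp add: le_divide_eq)
  then show ?thesis by (simp add: log_ratio_def)
qed

lemma log_ratio_nonpos:
  assumes "x > 0" "\<beta> \<ge> 0" "u > 0" "u \<le> kappa \<beta> x"
  shows "log_ratio \<beta> x u \<le> 0"
proof -
  have "u * (u + \<beta>) / (x\<^sup>2 * (1 + \<beta>)) \<le> 1"
    using le_kappa_iff[OF assms(1-3)] assms by (simp add: divide_le_eq)
  moreover have "u * (u + \<beta>) / (x\<^sup>2 * (1 + \<beta>)) > 0" using assms by (simp add: add_pos_nonneg)
  ultimately show ?thesis unfolding log_ratio_def by (simp add: ln_le_zero_iff)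
qed

lemma log_ratio_kappa:
  assumes "x > 0" "\<beta> \<ge> 0"
  shows "log_ratio \<beta> x (kappa \<beta> x) = 0"
  unfolding log_ratio_def kappa_eq(2)[OF assms] using assms by simp

lemma log_ratio_deriv:
  assumes "x > 0" "\<beta> \<ge> 0" "u > 0"
  shows "(log_ratio \<beta> x has_real_derivative (1 / u + 1 / (u + \<beta>))) (at u)"
proof -
  have "((\<lambda>u. ln u + ln (u + \<beta>) - (2 * ln x + ln (1 + \<beta>))) has_real_derivative (1 / u + 1 / (u + \<beta>))) (at u)"
    using assms by (auto intro!: derivative_eq_intros)
  then show ?thesis
    by (rule DERIV_cong_ev[OF refl _ refl, THEN iffD2, rotated])
      (use assms in \<open>auto intro!: eventually_mono[OF eventually_gt_at_top] log_ratio_eq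
        eventually_mono[OF eventually_nhds_in_open[of "{0<..}" u]]\<close>)
qed

lemma abs_diff_le_of_deriv:
  fixes f f' :: "real \<Rightarrow> real"
  assumes "\<And>t. t \<in> {a..b} \<Longrightarrow> (f has_real_derivative f' t) (at t)"
    and "\<And>t. t \<in> {a..b} \<Longrightarrow> \<bar>f' t\<bar> \<le> L" and "u \<in> {a..b}" "w \<in> {a..b}"
  shows "\<bar>f u - f w\<bar> \<le> L * \<bar>u - w\<bar>"
  using field_differentiable_bound[of "{a..b}" f f' L u w] assms
  by (auto intro: has_field_derivative_at_within)

text \<open>
  The derivative \<open>1/u + 1/(u + \<beta>)\<close> is bounded by \<open>2/u\<close> whatever \<open>\<beta>\<close> is. This is the source of
  all uniformity in \<open>\<beta>\<close>.
\<close>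
lemma log_ratio_bound:
  assumes "x > 0" "\<beta> \<ge> 0" "c > 0" "c \<le> kappa \<beta> x" "c \<le> u"
  shows "\<bar>log_ratio \<beta> x u\<bar> \<le> 2 / c * \<bar>u - kappa \<beta> x\<bar>"
proof -
  have "\<bar>log_ratio \<beta> x u - log_ratio \<beta> x (kappa \<beta> x)\<bar> \<le> 2 / c * \<bar>u - kappa \<beta> x\<bar>"
  proof (rule abs_diff_le_of_deriv[where a = c and b = "max u (kappa \<beta> x)"])
    fix t assume t: "t \<in> {c..max u (kappa \<beta> x)}"
    show "(log_ratio \<beta> x has_real_derivative (1 / t + 1 / (t + \<beta>))) (at t)"
      using assms t by (intro log_ratio_deriv) auto
    have "1 / t \<le> 1 / c" "1 / (t + \<beta>) \<le> 1 / c"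
      using assms t by (auto intro!: divide_left_mono mult_pos_pos)
    then show "\<bar>1 / t + 1 / (t + \<beta>)\<bar> \<le> 2 / c" using assms t by auto
  qed (use assms in auto)
  then show ?thesis using log_ratio_kappa[OF assms(1,2)] by simp
qed

text \<open>
  By the mean value theorem each increment of the primitive \<open>\<Phi>\<close> is \<open>1/n\<close> times a value of \<open>\<phi>\<close> on the
  corresponding cell, which differs from the left end value by at most \<open>L/n\<close>.
\<close>
lemma riemann_sum_error:
  fixes \<Phi> \<phi> \<phi>' :: "real \<Rightarrow> real"
  assumes n: "n \<ge> (1::nat)" and ab: "a \<le> b"
    and \<Phi>: "\<And>t. t \<in> {real a / real n..real b / real n} \<Longrightarrow> (\<Phi> has_real_derivative \<phi> t) (at t)"
    and \<phi>: "\<And>t. t \<in> {real a / real n..real b / real n} \<Longrightarrow> (\<phi> has_real_derivative \<phi>' t) (at t)"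
    and L: "\<And>t. t \<in> {real a / real n..real b / real n} \<Longrightarrow> \<bar>\<phi>' t\<bar> \<le> L"
  shows "\<bar>(\<Sum>i=a..<b. \<phi> (real i / real n)) / real n - (\<Phi> (real b / real n) - \<Phi> (real a / real n))\<bar>
    \<le> L * (real b - real a) / (real n)\<^sup>2"
proof -
  have step: "\<bar>\<phi> (real i / n) / n - (\<Phi> (real (Suc i) / n) - \<Phi> (real i / n))\<bar> \<le> L / (real n)\<^sup>2"
    if i: "i \<in> {a..<b}" for i
  proof -
    have sub: "real a / n \<le> real i / n" "real (Suc i) / n \<le> real b / n" "real i / n < real (Suc i) / n"
      using i n by (auto intro!: divide_right_mono divide_strict_right_mono)
    then obtain \<xi> where \<xi>: "real i / n < \<xi>" "\<xi> < real (Suc i) / n"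
      "\<Phi> (real (Suc i) / n) - \<Phi> (real i / n) = (real (Suc i) / n - real i / n) * \<phi> \<xi>"
      using MVT2[of "real i / n" "real (Suc i) / n" \<Phi> \<phi>] \<Phi> by (smt (verit) atLeastAtMost_iff)
    have w: "real (Suc i) / n - real i / n = 1 / n" by (simp add: diff_divide_distrib[symmetric])
    have "\<bar>\<phi> (real i / n) - \<phi> \<xi>\<bar> \<le> L * \<bar>real i / n - \<xi>\<bar>"
      by (rule abs_diff_le_of_deriv[OF \<phi> L]) (use sub \<xi> in auto)
    also have "\<dots> \<le> L * (1 / n)"
    proof (rule mult_left_mono)
      show "0 \<le> L" using L[of "real a / n"] ab n by (auto simp: divide_right_mono)
      show "\<bar>real i / n - \<xi>\<bar> \<le> 1 / n" using \<xi> w by linarith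
    qed
    finally have "\<bar>\<phi> (real i / n) - \<phi> \<xi>\<bar> / n \<le> L * (1 / n) / n"
      by (intro divide_right_mono) auto
    moreover have "\<phi> (real i / n) / n - (\<Phi> (real (Suc i) / n) - \<Phi> (real i / n)) = (\<phi> (real i / n) - \<phi> \<xi>) / n"
      unfolding \<xi>(3) w by (simp add: diff_divide_distrib)
    ultimately show ?thesis using n by (simp add: power2_eq_square)
  qed
  have "(\<Sum>i=a..<b. \<phi> (real i / n)) / n - (\<Phi> (real b / n) - \<Phi> (real a / n))
     = (\<Sum>i=a..<b. \<phi> (real i / n) / n - (\<Phi> (real (Suc i) / n) - \<Phi> (real i / n)))"
    using sum_Suc_diff'[OF ab, of "\<lambda>i. \<Phi> (real i / n)"]
    by (simp only: sum_subtractf[of "\<lambda>i. \<phi> (real i / n) / n"] sum_divide_distrib)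
  also have "\<bar>\<dots>\<bar> \<le> (\<Sum>i=a..<b. L / (real n)\<^sup>2)"
    by (rule order_trans[OF sum_abs sum_mono[OF step]])
  finally show ?thesis using ab by (simp add: of_nat_diff mult.commute)
qed

text \<open>
  The first index \<open>i\<close> with \<open>i (i + v) \<ge> x\<^sup>2 n (n + v)\<close>, when \<open>\<beta> = v / n\<close>: the optimal
  tilt, at which the factors of a change of tilt pass through \<open>1\<close>.
\<close>
definition first_index :: "real \<Rightarrow> real \<Rightarrow> nat \<Rightarrow> nat" where
  "first_index \<beta> x n = nat \<lceil>kappa \<beta> x * real n\<rceil>"

lemma first_index_bounds:
  assumes "x > 0" "\<beta> \<ge> 0"
  shows "kappa \<beta> x * real n \<le> real (first_index \<beta> x n)" "real (first_index \<beta> x n) \<le> kappa \<beta> x * real n + 1"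
  using kappa_eq(1)[OF assms] by (auto simp: first_index_def less_imp_le ceiling_correct) 

definition right_sum :: "real \<Rightarrow> real \<Rightarrow> nat \<Rightarrow> real" where
  "right_sum \<beta> x n = (\<Sum>i=n..<first_index \<beta> x n. log_ratio \<beta> x (real i / real n))"

text \<open>
  An index \<open>i\<close> beyond the first one enters the change of tilt for each of the \<open>n - i\<close> particles
  \<open>k = i + 1, \<dots>, n\<close>.
\<close>
definition left_sum :: "real \<Rightarrow> real \<Rightarrow> nat \<Rightarrow> real" where
  "left_sum \<beta> x n = (\<Sum>i=first_index \<beta> x n..<n. (real n - real i) * log_ratio \<beta> x (real i / real n))"

lemma right_sum_approx:
  assumes x: "x > 1" and \<beta>: "\<beta> \<ge> 0" and n: "n \<ge> 1"
  shows "\<bar>right_sum \<beta> x n / real n + rate_right_fin \<beta> x\<bar> \<le> (2 * x\<^sup>2 + 2) / real n"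
proof -
  define \<kappa> where "\<kappa> = kappa \<beta> x"
  define k where "k = first_index \<beta> x n"
  have x0: "x > 0" using x by simp
  have \<kappa>: "1 \<le> \<kappa>" "\<kappa> \<le> x\<^sup>2" "\<kappa> * (\<kappa> + \<beta>) = x\<^sup>2 * (1 + \<beta>)"
    using kappa_bounds_above_1[of x \<beta>] kappa_eq(2)[OF x0 \<beta>] x \<beta> by (auto simp: \<kappa>_def)
  have k: "\<kappa> * n \<le> k" "k \<le> \<kappa> * n + 1"
    using first_index_bounds[OF x0 \<beta>, of n] by (auto simp: \<kappa>_def k_def)
  have nk: "n \<le> k"
  proof -
    have "1 * real n \<le> \<kappa> * n" using \<kappa>(1) by (rule mult_right_mono) simp
    then show ?thesis using k by linarith
  qed
  have kn: "\<kappa> \<le> k / n" "k / n \<le> \<kappa> + 1 / n"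
    using k n by (auto simp: field_simps)
  define c where "c = 2 * ln x + ln (1 + \<beta>)"
  \<comment> \<open>a primitive of \<open>log_ratio \<beta> x\<close>\<close>
  define G where "G u = u * ln u + (u + \<beta>) * ln (u + \<beta>) - 2 * u - u * c" for u
  have G: "(G has_real_derivative log_ratio \<beta> x t) (at t)" if "t > 0" for t
  proof -
    have tb: "t + \<beta> > 0" using that \<beta> by simp
    have m1: "((\<lambda>u. u * ln u) has_real_derivative (1 * ln t + 1 / t * t)) (at t)"
      by (intro DERIV_mult DERIV_ident DERIV_ln_divide that)
    have l2: "((\<lambda>u. ln (u + \<beta>)) has_real_derivative 1 / (t + \<beta>)) (at t)"
      using tb by (auto intro!: derivative_eq_intros)
    have a2: "((\<lambda>u. u + \<beta>) has_real_derivative 1) (at t)" by (auto intro!: derivative_eq_intros)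
    have l3: "((\<lambda>u. 2 * u) has_real_derivative 2) (at t)" "((\<lambda>u. u * c) has_real_derivative c) (at t)"
      by (auto intro!: derivative_eq_intros)
    show ?thesis
      unfolding G_def[abs_def]
      by (rule DERIV_cong[OF DERIV_diff[OF DERIV_diff[OF DERIV_add[OF m1 DERIV_mult[OF a2 l2]] l3(1)] l3(2)]])
        (use that tb in \<open>simp add: log_ratio_eq[OF x0 \<beta> that] c_def[symmetric]\<close>)
  qed
  have deriv_bound: "\<bar>1 / t + 1 / (t + \<beta>)\<bar> \<le> 2" if "t \<ge> 1" for t
  proof -
    have "1 / t \<le> 1" "1 / (t + \<beta>) \<le> 1" "0 \<le> 1 / t" "0 \<le> 1 / (t + \<beta>)" using that \<beta> by auto
    then show ?thesis by linarith
  qed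
  have 1: "\<bar>right_sum \<beta> x n / n - (G (k / n) - G 1)\<bar> \<le> 2 * (real k - real n) / (real n)\<^sup>2"
    using riemann_sum_error[OF n nk, of G "log_ratio \<beta> x" "\<lambda>t. 1 / t + 1 / (t + \<beta>)" 2] G log_ratio_deriv[OF x0 \<beta>] deriv_bound n
    by (simp add: right_sum_def k_def)
  have "2 * (real k - real n) / (real n)\<^sup>2 \<le> 2 * (x\<^sup>2 * n) / (real n)\<^sup>2"
  proof (intro divide_right_mono mult_left_mono)
    have "\<kappa> * n \<le> x\<^sup>2 * n" using \<kappa> by (intro mult_right_mono) auto
    then show "real k - real n \<le> x\<^sup>2 * real n" using k n by linarith
  qed auto
  also have "\<dots> = 2 * x\<^sup>2 / n" using n by (simp add: power2_eq_square)
  finally have 2: "2 * (real k - real n) / (real n)\<^sup>2 \<le> 2 * x\<^sup>2 / n" .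
  have "\<bar>G (k / n) - G \<kappa>\<bar> \<le> 2 * \<bar>k / n - \<kappa>\<bar>"
  proof (rule abs_diff_le_of_deriv[where a = \<kappa> and b = "k / n"])
    fix t assume t: "t \<in> {\<kappa>..k / n}"
    show "(G has_real_derivative log_ratio \<beta> x t) (at t)" using t \<kappa> by (intro G) auto
    have "\<bar>log_ratio \<beta> x t\<bar> \<le> 2 / 1 * \<bar>t - kappa \<beta> x\<bar>"
      using t \<kappa> by (intro log_ratio_bound x0 \<beta>) (auto simp: \<kappa>_def)
    also have "\<dots> \<le> 2 * 1"
    proof (intro mult_mono)
      have "1 / real n \<le> 1" using n by simp
      then show "\<bar>t - kappa \<beta> x\<bar> \<le> 1" using t kn by (auto simp: \<kappa>_def)
    qed auto
    finally show "\<bar>log_ratio \<beta> x t\<bar> \<le> 2" by simp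
  qed (use kn in auto)
  also have "\<dots> \<le> 2 * (1 / n)" using kn by (intro mult_left_mono) auto
  finally have 3: "\<bar>G (k / n) - G \<kappa>\<bar> \<le> 2 / n" by simp
  have "G \<kappa> - G 1 = - rate_right_fin \<beta> x"
  proof -
    \<comment> \<open>the logarithm of the equation for \<open>\<kappa>\<close>, which cancels the logarithms of \<open>\<kappa>\<close> in the primitive\<close>
    have c: "c = ln \<kappa> + ln (\<kappa> + \<beta>)"
    proof -
      have "ln (\<kappa> * (\<kappa> + \<beta>)) = ln (x\<^sup>2 * (1 + \<beta>))" by (simp only: \<kappa>)
      then show ?thesis using \<kappa>(1) x0 \<beta> by (simp add: ln_mult ln_realpow c_def)
    qed
    have "G \<kappa> = \<beta> * ln (\<kappa> + \<beta>) - 2 * \<kappa>" by (simp add: G_def c algebra_simps)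
    moreover have "G 1 = \<beta> * ln (1 + \<beta>) - 2 - 2 * ln x" by (simp add: G_def c_def algebra_simps)
    moreover have "rate_right_fin \<beta> x = \<beta> * (ln (1 + \<beta>) - ln (\<beta> + \<kappa>)) + 2 * (\<kappa> - ln x - 1)"
      unfolding rate_right_fin_def \<kappa>_def[symmetric] using \<kappa> \<beta> by (simp add: ln_div)
    ultimately show ?thesis by (simp add: algebra_simps)
  qed
  moreover have "(2 * x\<^sup>2 + 2) / real n = 2 * x\<^sup>2 / n + 2 / n" by (simp add: add_divide_distrib)
  ultimately show ?thesis using 1 2 3 by linarith
qed

lemma left_sum_approx:
  assumes x: "0 < x" "x < 1" and \<beta>: "\<beta> \<ge> 0" and n: "n \<ge> 1"
  shows "\<bar>left_sum \<beta> x n / (real n)\<^sup>2 - rate_left_fin \<beta> x\<bar> \<le> (6 / x\<^sup>2) / real n"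
proof -
  define \<kappa> where "\<kappa> = kappa \<beta> x"
  define k where "k = first_index \<beta> x n"
  note x0 = x(1)
  have \<kappa>: "\<kappa> > 0" "x\<^sup>2 \<le> \<kappa>" "\<kappa> \<le> 1" "\<kappa> * (\<kappa> + \<beta>) = x\<^sup>2 * (1 + \<beta>)"
    using kappa_bounds_below_1[of x \<beta>] kappa_eq[OF x0 \<beta>] x \<beta> by (auto simp: \<kappa>_def)
  have k: "\<kappa> * n \<le> k" "k \<le> \<kappa> * n + 1"
    using first_index_bounds[OF x0 \<beta>, of n] by (auto simp: \<kappa>_def k_def)
  have nk: "k \<le> n"
  proof -
    have "\<kappa> * n \<le> n" using \<kappa> by (intro mult_left_le_one_le) auto
    then show ?thesis by (simp add: k_def first_index_def \<kappa>_def nat_le_iff ceiling_le_iff)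
  qed
  have kn: "\<kappa> \<le> k / n" "k / n \<le> \<kappa> + 1 / n" "k / n \<le> 1"
    using k n nk by (auto simp: field_simps)
  define c where "c = 2 * ln x + ln (1 + \<beta>)"
  define \<phi> where "\<phi> u = (1 - u) * log_ratio \<beta> x u" for u
  define \<phi>' where "\<phi>' u = (1 - u) * (1 / u + 1 / (u + \<beta>)) - log_ratio \<beta> x u" for u
  \<comment> \<open>a primitive of \<open>\<phi>\<close>\<close>
  define \<Phi> where "\<Phi> u = (u - u\<^sup>2 / 2) * ln u + (u\<^sup>2 / 2 - 2 * u) + (u - u\<^sup>2 / 2 + \<beta> + \<beta>\<^sup>2 / 2) * ln (u + \<beta>)
      - \<beta> * u / 2 - c * (u - u\<^sup>2 / 2)" for u
  have \<Phi>: "(\<Phi> has_real_derivative \<phi> t) (at t)" if "t > 0" for t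
  proof -
    have tb: "t + \<beta> > 0" using that \<beta> by simp
    have lr: "log_ratio \<beta> x t = ln t + ln (t + \<beta>) - c"
      using log_ratio_eq[OF x0 \<beta> that] by (simp add: c_def)
    have l1: "(ln has_real_derivative 1 / t) (at t)" by (rule DERIV_ln_divide[OF that])
    have l2: "((\<lambda>u. ln (u + \<beta>)) has_real_derivative 1 / (t + \<beta>)) (at t)"
      using tb by (auto intro!: derivative_eq_intros)
    have p1: "((\<lambda>u. u - u\<^sup>2 / 2) has_real_derivative 1 - t) (at t)"
      and p2: "((\<lambda>u. u - u\<^sup>2 / 2 + \<beta> + \<beta>\<^sup>2 / 2) has_real_derivative 1 - t) (at t)"
      and p3: "((\<lambda>u. u\<^sup>2 / 2 - 2 * u) has_real_derivative t - 2) (at t)"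
      and p4: "((\<lambda>u. \<beta> * u / 2) has_real_derivative \<beta> / 2) (at t)"
      by (auto intro!: derivative_eq_intros)
    have e1: "1 / t * (t - t\<^sup>2 / 2) = 1 - t / 2" using that by (simp add: field_simps power2_eq_square)
    have e2: "1 / (t + \<beta>) * (t - t\<^sup>2 / 2 + \<beta> + \<beta>\<^sup>2 / 2) = 1 - (t - \<beta>) / 2"
    proof -
      have "t - t\<^sup>2 / 2 + \<beta> + \<beta>\<^sup>2 / 2 = (t + \<beta>) * (1 - (t - \<beta>) / 2)"
        by (simp add: field_simps power2_eq_square)
      then show ?thesis using tb by simp
    qed
    show ?thesis
      unfolding \<Phi>_def[abs_def]
      by (rule DERIV_cong[OF DERIV_diff[OF DERIV_diff[OF DERIV_add[OF DERIV_add[OF DERIV_mult[OF p1 l1] p3]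
              DERIV_mult[OF p2 l2]] p4] DERIV_cmult[OF p1]]], unfold e1 e2)
        (simp add: \<phi>_def lr algebra_simps diff_divide_distrib)
  qed
  have \<phi>: "(\<phi> has_real_derivative \<phi>' t) (at t)" if "t > 0" for t
    unfolding \<phi>_def \<phi>'_def using log_ratio_deriv[OF x0 \<beta> that]
    by (auto intro!: derivative_eq_intros)
  have lb: "\<bar>log_ratio \<beta> x t\<bar> \<le> 2 / x\<^sup>2" if "t \<in> {\<kappa>..1}" for t
  proof -
    have "\<bar>log_ratio \<beta> x t\<bar> \<le> 2 / x\<^sup>2 * \<bar>t - kappa \<beta> x\<bar>"
      using that \<kappa> x by (intro log_ratio_bound x0 \<beta>) (auto simp: \<kappa>_def)
    also have "\<dots> \<le> 2 / x\<^sup>2 * 1"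
      using that \<kappa> by (intro mult_left_mono) (auto simp: \<kappa>_def)
    finally show ?thesis by simp
  qed
  have \<phi>b: "\<bar>\<phi> t\<bar> \<le> 2 / x\<^sup>2" if "t \<in> {\<kappa>..1}" for t
  proof -
    have "\<bar>\<phi> t\<bar> = (1 - t) * \<bar>log_ratio \<beta> x t\<bar>" using that by (simp add: \<phi>_def abs_mult)
    also have "\<dots> \<le> 1 * (2 / x\<^sup>2)" using that \<kappa> lb[OF that] by (intro mult_mono) auto
    finally show ?thesis by simp
  qed
  have \<phi>'b: "\<bar>\<phi>' t\<bar> \<le> 4 / x\<^sup>2" if "t \<in> {\<kappa>..1}" for t
  proof -
    have t: "t > 0" "x\<^sup>2 \<le> t" using that \<kappa> by auto
    have "1 / t \<le> 1 / x\<^sup>2" "1 / (t + \<beta>) \<le> 1 / x\<^sup>2"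
      using t \<beta> x by (auto intro!: divide_left_mono mult_pos_pos add_pos_nonneg)
    moreover have nn: "0 \<le> 1 / t + 1 / (t + \<beta>)" using t \<beta> by simp
    ultimately have "(1 - t) * (1 / t + 1 / (t + \<beta>)) \<le> 1 * (2 / x\<^sup>2)"
      using t that by (intro mult_mono) auto
    moreover have "0 \<le> (1 - t) * (1 / t + 1 / (t + \<beta>))" using nn that by (intro mult_nonneg_nonneg) auto
    ultimately have "\<bar>\<phi>' t\<bar> \<le> 2 / x\<^sup>2 + 2 / x\<^sup>2" using lb[OF that] unfolding \<phi>'_def by linarith
    then show ?thesis by simp
  qed
  have eq: "left_sum \<beta> x n / (real n)\<^sup>2 = (\<Sum>i=k..<n. \<phi> (real i / n)) / n"
  proof -
    have "left_sum \<beta> x n = n * (\<Sum>i=k..<n. \<phi> (real i / n))"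
      unfolding left_sum_def k_def[symmetric] sum_distrib_left \<phi>_def
      using n by (intro sum.cong) (auto simp: field_simps)
    then show ?thesis using n by (simp add: power2_eq_square)
  qed
  have 1: "\<bar>(\<Sum>i=k..<n. \<phi> (real i / n)) / n - (\<Phi> (real n / n) - \<Phi> (k / n))\<bar> \<le> (4 / x\<^sup>2) * (real n - real k) / (real n)\<^sup>2"
    by (rule riemann_sum_error[OF n nk, of \<Phi> \<phi> \<phi>' "4 / x\<^sup>2"])
      (use kn \<kappa> n in \<open>auto intro!: \<Phi> \<phi> \<phi>'b\<close>)
  have "(4 / x\<^sup>2) * (real n - real k) / (real n)\<^sup>2 \<le> (4 / x\<^sup>2) * real n / (real n)\<^sup>2"
    by (intro divide_right_mono mult_left_mono) auto
  also have "\<dots> = (4 / x\<^sup>2) / n" using n by (simp add: power2_eq_square)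
  finally have 2: "(4 / x\<^sup>2) * (real n - real k) / (real n)\<^sup>2 \<le> (4 / x\<^sup>2) / n" .
  have "\<bar>\<Phi> (k / n) - \<Phi> \<kappa>\<bar> \<le> (2 / x\<^sup>2) * \<bar>k / n - \<kappa>\<bar>"
    by (rule abs_diff_le_of_deriv[where a = \<kappa> and b = "k / n" and f' = \<phi>])
      (use kn \<kappa> in \<open>auto intro!: \<Phi> \<phi>b\<close>)
  also have "\<dots> \<le> (2 / x\<^sup>2) * (1 / n)" using kn by (intro mult_left_mono) auto
  finally have 3: "\<bar>\<Phi> (k / n) - \<Phi> \<kappa>\<bar> \<le> (2 / x\<^sup>2) / n" by simp
  have "\<Phi> 1 - \<Phi> \<kappa> = rate_left_fin \<beta> x"
  proof -
    have c: "c = ln \<kappa> + ln (\<kappa> + \<beta>)"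
    proof -
      have "ln (\<kappa> * (\<kappa> + \<beta>)) = ln (x\<^sup>2 * (1 + \<beta>))" by (simp only: \<kappa>)
      then show ?thesis using \<kappa>(1) x0 \<beta> by (simp add: ln_mult ln_realpow c_def)
    qed
    have "\<Phi> \<kappa> = (\<beta> + \<beta>\<^sup>2 / 2) * ln (\<kappa> + \<beta>) - 2 * \<kappa> + \<kappa>\<^sup>2 / 2 - \<beta> * \<kappa> / 2"
      unfolding \<Phi>_def c by (simp add: algebra_simps)
    moreover have "\<Phi> 1 = (\<beta> + \<beta>\<^sup>2 / 2) * ln (1 + \<beta>) - ln x - 3 / 2 - \<beta> / 2"
      unfolding \<Phi>_def c_def by (simp add: field_simps)
    moreover have "rate_left_fin \<beta> x = (\<beta> + \<beta>\<^sup>2 / 2) * (ln (1 + \<beta>) - ln (\<kappa> + \<beta>)) - ln x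
        - (\<beta> + 3 - \<kappa>) * (1 - \<kappa>) / 2"
      unfolding rate_left_fin_def \<kappa>_def[symmetric] using \<kappa> \<beta> by (simp add: ln_div)
    ultimately show ?thesis by (simp add: field_simps power2_eq_square)
  qed
  moreover have "(6 / x\<^sup>2) / real n = (4 / x\<^sup>2) / n + (2 / x\<^sup>2) / n" by (simp add: add_divide_distrib[symmetric])
  moreover have "real n / n = 1" using n by simp
  ultimately show ?thesis unfolding eq using 1 2 3 by simp
qed

section \<open>Tail bounds\<close>

lemma step_over_scale:
  assumes "n \<ge> (1::nat)" "x > 0"
  shows "real i * real (i + v) / (x\<^sup>2 * (real n * real (n + v)))
    = (real i / n) * (real i / n + real v / n) / (x\<^sup>2 * (1 + real v / n))"
proof -
  have 1: "real i / n * (real i / n + real v / n) = real i * real (i + v) / (real n * real n)"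
    by (simp add: add_divide_distrib[symmetric])
  have 2: "x\<^sup>2 * (1 + real v / n) = x\<^sup>2 * (real n * real (n + v)) / (real n * real n)"
    using assms by (simp add: field_simps)
  show ?thesis unfolding 1 2 using assms by simp
qed

context gamma_product_law
begin

text \<open>
  The scaled maximum reaches \<open>x\<close> precisely if some \<open>n\<^sup>2 \<bar>\<zeta>\<^sub>i\<bar>\<^sup>4\<close> reaches this value.
\<close>
definition threshold :: "nat \<Rightarrow> real \<Rightarrow> real" where
  "threshold n x = x\<^sup>2 * (real n * real (n + v))"

definition log_step :: "nat \<Rightarrow> real \<Rightarrow> nat \<Rightarrow> real" where
  "log_step n x i = log_ratio (real v / real n) x (real i / real n)"

lemma threshold_pos: "n \<ge> 1 \<Longrightarrow> x > 0 \<Longrightarrow> threshold n x > 0"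
  by (simp add: threshold_def)

lemma exp_log_step:
  assumes "n \<ge> 1" "x > 0" "i \<ge> 1"
  shows "step i / threshold n x = exp (log_step n x i)"
proof -
  have "step i / threshold n x > 0" using assms by (simp add: threshold_pos step_pos)
  moreover have "log_step n x i = ln (step i / threshold n x)"
    unfolding log_step_def log_ratio_def step_def threshold_def step_over_scale[OF assms(1,2)] ..
  ultimately show ?thesis by simp
qed

lemma exp_neg_log_step:
  assumes "n \<ge> 1" "x > 0" "i \<ge> 1"
  shows "threshold n x / step i = exp (- log_step n x i)"
  unfolding exp_minus exp_log_step[OF assms, symmetric] by simp

lemma log_step_change:
  assumes "n \<ge> 1" "x > 0" "y > 0" "i \<ge> 1"
  shows "log_step n y i = log_step n x i - 2 * ln (y / x)"
proof -
  have "real i / real n > 0" using assms by simp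
  then show ?thesis using assms by (simp add: log_step_def log_ratio_eq ln_div)
qed

abbreviation idx :: "nat \<Rightarrow> real \<Rightarrow> nat" where
  "idx n x \<equiv> first_index (real v / real n) x n"

lemma log_step_nonneg:
  assumes "n \<ge> 1" "x > 0" "idx n x \<le> i"
  shows "log_step n x i \<ge> 0"
proof -
  have "kappa (real v / n) x * n \<le> i"
    using first_index_bounds(1)[of x "real v / n" n] assms by simp
  then show ?thesis unfolding log_step_def using assms by (intro log_ratio_nonneg) (auto simp: field_simps)
qed

lemma log_step_nonpos:
  assumes "n \<ge> 1" "x > 0" "i \<ge> 1" "i < idx n x"
  shows "log_step n x i \<le> 0"
proof -
  have "int i < \<lceil>kappa (real v / n) x * n\<rceil>"
    using assms by (simp add: first_index_def)
  then have "real i \<le> kappa (real v / n) x * n" by (simp add: less_ceiling_iff)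
  then show ?thesis unfolding log_step_def using assms by (intro log_ratio_nonpos) (auto simp: field_simps)
qed

lemma idx_pos: "n \<ge> 1 \<Longrightarrow> x > 0 \<Longrightarrow> idx n x \<ge> 1"
  using first_index_bounds(1)[of x "real v / n" n] kappa_eq(1)[of x "real v / n"]
  by (cases "idx n x") (auto simp: mult_le_0_iff)

text \<open>
  The summands change sign from negative to positive at the first index, so the sum is smallest if it
  stops there. When a concentrating tilt replaces the optimal one, the sum therefore changes in the
  favourable direction.
\<close>
lemma sum_log_step_ge_right:
  assumes "n \<ge> 1" "x > 0" "n \<le> k"
  shows "right_sum (real v / n) x n \<le> (\<Sum>i=n..<k. log_step n x i)"
proof (cases "k \<le> idx n x")
  case True
  then have "(\<Sum>i=n..<idx n x. log_step n x i) = (\<Sum>i=n..<k. log_step n x i) + (\<Sum>i=k..<idx n x. log_step n x i)"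
    using assms by (simp add: sum.atLeastLessThan_concat)
  moreover have "(\<Sum>i=k..<idx n x. log_step n x i) \<le> 0"
    using assms by (intro sum_nonpos log_step_nonpos) auto
  ultimately show ?thesis by (simp add: right_sum_def log_step_def)
next
  case False
  have "(\<Sum>i=n..<idx n x. log_step n x i) \<le> (\<Sum>i=n..<k. log_step n x i)"
    using False assms by (intro sum_mono2 log_step_nonneg) auto
  then show ?thesis by (simp add: right_sum_def log_step_def)
qed

lemma sum_log_step_le_left:
  assumes "n \<ge> 1" "x > 0" "1 \<le> k1" "k1 \<le> k"
  shows "(\<Sum>i=k1..<k. log_step n x i) \<le> (\<Sum>i=idx n x..<k. log_step n x i)"
proof (cases "k1 \<le> idx n x")
  case False
  then show ?thesis using assms by (intro sum_mono2 log_step_nonneg) auto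
next
  case True
  show ?thesis
  proof (cases "idx n x \<le> k")
    case le: True
    have "(\<Sum>i=k1..<k. log_step n x i) = (\<Sum>i=k1..<idx n x. log_step n x i) + (\<Sum>i=idx n x..<k. log_step n x i)"
      using True le by (simp add: sum.atLeastLessThan_concat)
    moreover have "(\<Sum>i=k1..<idx n x. log_step n x i) \<le> 0"
      using assms by (intro sum_nonpos log_step_nonpos) auto
    ultimately show ?thesis by simp
  next
    case False
    then have "(\<Sum>i=k1..<k. log_step n x i) \<le> 0"
      using assms by (intro sum_nonpos log_step_nonpos) auto
    then show ?thesis using False by simp
  qed
qed

text \<open>
  The mean of the tilt \<open>\<lfloor>\<kappa>(y) n\<rfloor>\<close> is just below \<open>threshold n y\<close>, and for \<open>y\<^sup>2\<close> halfway between \<open>a\<^sup>2\<close>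
  and \<open>b\<^sup>2\<close> it stays away from the thresholds at \<open>a\<close> and \<open>b\<close> by a fixed proportion. The size required of
  \<open>n\<close> does not involve \<open>v\<close>.
\<close>
lemma concentration_index:
  assumes a: "0 < a" and ab: "a < b" and y: "y > 0" "y\<^sup>2 = (a\<^sup>2 + b\<^sup>2) / 2"
    and n: "n \<ge> 1" "6 / ((b\<^sup>2 - a\<^sup>2) / (4 * b\<^sup>2))\<^sup>2 + 1 \<le> min 1 (y\<^sup>2) * real n"
  defines "k \<equiv> nat \<lfloor>kappa (real v / real n) y * real n\<rfloor>"
  shows "1 \<le> k" "step k \<le> threshold n y" "1 / 2 \<le> tilt k {threshold n a..threshold n b}"
proof -
  \<comment> \<open>the relative deviation from its mean that the tilt is allowed\<close>
  define \<eta> where "\<eta> = (b\<^sup>2 - a\<^sup>2) / (4 * b\<^sup>2)"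
  define \<beta> where "\<beta> = real v / real n"
  define K where "K = kappa \<beta> y * real n"
  have \<beta>: "\<beta> \<ge> 0" by (simp add: \<beta>_def)
  have v: "real v = \<beta> * real n" using n by (simp add: \<beta>_def)
  have b2: "b\<^sup>2 > a\<^sup>2" "b\<^sup>2 > 0" using a ab by (auto intro: power_strict_mono)
  have \<eta>: "0 < \<eta>" "\<eta> \<le> 1 / 4"
    using b2 a by (auto simp: \<eta>_def divide_simps)
  have \<eta>b: "\<eta> * b\<^sup>2 = (b\<^sup>2 - a\<^sup>2) / 4" using b2 by (simp add: \<eta>_def)
  have ylt: "y\<^sup>2 < b\<^sup>2" using y b2 by simp
  have K_eq: "K * (K + real v) = threshold n y"
  proof -
    have "K * (K + real v) = (kappa \<beta> y * (kappa \<beta> y + \<beta>)) * (real n * real n)"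
      by (simp add: K_def v algebra_simps)
    also have "\<dots> = y\<^sup>2 * (real n * (real n + real v))"
      unfolding kappa_eq(2)[OF y(1) \<beta>] by (simp add: v algebra_simps)
    finally show ?thesis by (simp add: threshold_def)
  qed
  have "min 1 (y\<^sup>2) \<le> kappa \<beta> y"
    using kappa_bounds_below_1(1)[OF y(1) _ \<beta>] kappa_bounds_above_1(1)[OF _ \<beta>, of y]
    by (cases "y \<le> 1") auto
  then have "min 1 (y\<^sup>2) * real n \<le> K" unfolding K_def by (intro mult_right_mono) auto
  then have K1: "6 / \<eta>\<^sup>2 + 1 \<le> K" using n(2) by (simp add: \<eta>_def)
  have "6 / \<eta>\<^sup>2 \<ge> 0" by simp
  have kK: "real k \<le> K" "K - 1 \<le> real k"
  proof -
    have "K \<ge> 0" using K1 \<open>6 / \<eta>\<^sup>2 \<ge> 0\<close> by linarith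
    then have "real k = of_int \<lfloor>K\<rfloor>" by (simp add: k_def K_def \<beta>_def)
    then show "real k \<le> K" "K - 1 \<le> real k" by linarith+
  qed
  have k6: "6 / \<eta>\<^sup>2 \<le> real k" using K1 kK by simp
  have "6 / \<eta>\<^sup>2 \<ge> 6"
    using \<eta> power_le_one[of \<eta> 2] by (simp add: le_divide_eq)
  then show k1: "1 \<le> k" using k6 by linarith
  show sk: "step k \<le> threshold n y"
    unfolding K_eq[symmetric] step_def using kK by (intro mult_mono) auto
  have "2 / \<eta> \<le> K"
  proof -
    have "2 * \<eta> \<le> 6" using \<eta> by simp
    then have "2 / \<eta> \<le> 6 / \<eta>\<^sup>2" using \<eta> by (simp add: divide_simps power2_eq_square)
    then show ?thesis using K1 by simp
  qed
  then have "1 \<le> K * (\<eta> / 2)" using \<eta> by (simp add: field_simps)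
  then have k_ge: "(1 - \<eta> / 2) * K \<le> real k" using kK by (simp add: algebra_simps)
  have "real v * (\<eta> / 2) \<ge> 0" using \<eta> by simp
  then have kv_ge: "(1 - \<eta> / 2) * (K + real v) \<le> real (k + v)"
    using k_ge by (simp add: algebra_simps add_divide_distrib)
  have "(1 - \<eta>) * threshold n y \<le> ((1 - \<eta> / 2) * (1 - \<eta> / 2)) * threshold n y"
  proof (rule mult_right_mono)
    have "0 \<le> (\<eta> / 2)\<^sup>2" by simp
    then show "1 - \<eta> \<le> (1 - \<eta> / 2) * (1 - \<eta> / 2)" by (simp add: algebra_simps power2_eq_square)
    show "0 \<le> threshold n y" using threshold_pos[of n y] n y by simp
  qed
  also have "\<dots> = ((1 - \<eta> / 2) * K) * ((1 - \<eta> / 2) * (K + real v))"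
    unfolding K_eq[symmetric] by simp
  also have "\<dots> \<le> step k"
  proof -
    have "K \<ge> 0" using K1 \<open>6 / \<eta>\<^sup>2 \<ge> 0\<close> by linarith
    then have "0 \<le> (1 - \<eta> / 2) * (K + real v)" using \<eta> by (intro mult_nonneg_nonneg) auto
    then show ?thesis unfolding step_def using k_ge kv_ge by (intro mult_mono) auto
  qed
  finally have sk2: "(1 - \<eta>) * threshold n y \<le> step k" .
  have nv: "real n * real (n + v) \<ge> 0" by simp
  show "1 / 2 \<le> tilt k {threshold n a..threshold n b}"
  proof (rule concentration[OF k1 \<eta>(1)])
    show "6 \<le> real k * \<eta>\<^sup>2" using k6 \<eta> by (simp add: field_simps)
    have "(1 + \<eta>) * step k \<le> (1 + \<eta>) * threshold n y" using sk \<eta> by (intro mult_left_mono) auto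
    also have "\<dots> = ((1 + \<eta>) * y\<^sup>2) * (real n * real (n + v))" by (simp add: threshold_def)
    also have "\<dots> \<le> b\<^sup>2 * (real n * real (n + v))"
    proof (rule mult_right_mono[OF _ nv])
      have "\<eta> * y\<^sup>2 \<le> \<eta> * b\<^sup>2" using \<eta> ylt by (intro mult_left_mono) auto
      moreover have "(1 + \<eta>) * y\<^sup>2 = y\<^sup>2 + \<eta> * y\<^sup>2" by (simp add: algebra_simps)
      moreover have "Y + e \<le> B" if "e \<le> (B - A) / 4" "Y = (A + B) / 2" "A < B" for A B Y e :: real
        using that by (simp add: field_simps)
      ultimately show "(1 + \<eta>) * y\<^sup>2 \<le> b\<^sup>2" using \<eta>b y(2) b2(1) by (simp only:)
    qed
    finally show "(1 + \<eta>) * step k \<le> threshold n b" by (simp add: threshold_def)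
    have "threshold n a = a\<^sup>2 * (real n * real (n + v))" by (simp add: threshold_def)
    also have "\<dots> \<le> ((1 - \<eta>) * (1 - \<eta>) * y\<^sup>2) * (real n * real (n + v))"
    proof (rule mult_right_mono[OF _ nv])
      have "\<eta> * y\<^sup>2 \<le> \<eta> * b\<^sup>2" using \<eta> ylt by (intro mult_left_mono) auto
      moreover have "0 \<le> \<eta> * \<eta> * y\<^sup>2" using \<eta> by simp
      moreover have "(1 - \<eta>) * (1 - \<eta>) * y\<^sup>2 = y\<^sup>2 - 2 * (\<eta> * y\<^sup>2) + \<eta> * \<eta> * y\<^sup>2" by (simp add: algebra_simps)
      moreover have "A \<le> Y - 2 * e + f" if "e \<le> (B - A) / 4" "Y = (A + B) / 2" "0 \<le> f" for A B Y e f :: real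
        using that by (simp add: field_simps)
      ultimately show "a\<^sup>2 \<le> (1 - \<eta>) * (1 - \<eta>) * y\<^sup>2" using \<eta>b y(2) by (simp only:)
    qed
    also have "\<dots> = (1 - \<eta>) * ((1 - \<eta>) * threshold n y)" by (simp add: threshold_def)
    also have "\<dots> \<le> (1 - \<eta>) * step k" using sk2 \<eta> by (intro mult_left_mono) auto
    finally show "threshold n a \<le> (1 - \<eta>) * step k" .
  qed
qed

text \<open>
  A union bound. Chernoff's bound with a fixed number of steps is largest for \<open>k = n\<close>.
\<close>
lemma right_tail_upper:
  assumes n: "n \<ge> 1" and x: "x > 1"
  shows "1 - (\<Prod>k=1..n. 1 - tilt k {threshold n x..}) \<le> real n * exp (right_sum (real v / n) x n)"
proof -
  have x0: "x > 0" using x by simp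
  define m where "m = idx n x - n"
  have mono: "tilt k {threshold n x..} \<le> exp (right_sum (real v / n) x n)" if k: "k \<in> {1..n}" for k
  proof -
    have shift: "(\<Prod>i=j..<j+m. step i / threshold n x) = (\<Prod>i<m. step (j + i) / threshold n x)" for j
      by (rule prod.reindex_bij_witness[of _ "\<lambda>i. j + i" "\<lambda>i. i - j"]) auto
    have "tilt k {threshold n x..} \<le> (\<Prod>i=k..<k+m. step i / threshold n x)"
      using k threshold_pos[OF n x0] by (intro upper_tail_le) auto
    also have "\<dots> \<le> (\<Prod>i=n..<n+m. step i / threshold n x)"
      unfolding shift using k threshold_pos[OF n x0]
      by (intro prod_mono) (auto simp: step_def intro!: divide_right_mono mult_mono)
    also have "\<dots> = (\<Prod>i=n..<n+m. exp (log_step n x i))"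
      using n by (intro prod.cong refl exp_log_step x0) auto
    also have "\<dots> = exp (\<Sum>i=n..<n+m. log_step n x i)" by (simp add: exp_sum)
    also have "{n..<n+m} = {n..<idx n x}" by (auto simp: m_def)
    finally show ?thesis by (simp add: right_sum_def log_step_def)
  qed
  have "1 - (\<Prod>k=1..n. 1 - tilt k {threshold n x..}) \<le> (\<Sum>k=1..n. tilt k {threshold n x..})"
  proof -
    have "1 - (\<Sum>k=1..j. tilt k {threshold n x..}) \<le> (\<Prod>k=1..j. 1 - tilt k {threshold n x..}) \<and> (\<Prod>k=1..j. 1 - tilt k {threshold n x..}) \<le> 1" for j
    proof (induction j)
      case (Suc j)
      let ?P = "\<Prod>k=1..j. 1 - tilt k {threshold n x..}" and ?q = "tilt (Suc j) {threshold n x..}"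
      have q: "0 \<le> ?q" "?q \<le> 1" by (simp_all add: tilt_nonneg tilt_le_1)
      have P0: "0 \<le> ?P" by (intro prod_nonneg) (auto simp: tilt_le_1)
      have "?P * ?q \<le> 1 * ?q" using Suc q by (intro mult_right_mono) auto
      moreover have "0 \<le> ?P * ?q" using P0 q by simp
      moreover have "(\<Prod>k=1..Suc j. 1 - tilt k {threshold n x..}) = ?P - ?P * ?q" by (simp add: algebra_simps)
      ultimately show ?case using Suc by simp
    qed simp
    from this[of n] show ?thesis by simp
  qed
  also have "\<dots> \<le> (\<Sum>k=1..n. exp (right_sum (real v / n) x n))" by (intro sum_mono mono)
  finally show ?thesis by simp
qed

text \<open>
  Only the factor \<open>k = n\<close> is kept. It is bounded below by means of a tilt concentrated between the
  thresholds at \<open>x\<close> and \<open>z\<close>; replacing \<open>x\<close> by \<open>z\<close> in the at most \<open>z\<^sup>2 n\<close> factors costs the second term in the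
  exponent.
\<close>
lemma right_tail_lower:
  assumes x: "x > 1" and z: "z > x" and n: "n \<ge> 1"
    and large: "6 / ((z\<^sup>2 - x\<^sup>2) / (4 * z\<^sup>2))\<^sup>2 + 1 \<le> real n"
  shows "exp (right_sum (real v / n) x n - 2 * z\<^sup>2 * ln (z / x) * real n) / 2
    \<le> 1 - (\<Prod>k=1..n. 1 - tilt k {threshold n x..})"
proof -
  have x0: "x > 0" and z0: "z > 0" using x z by auto
  define y where "y = sqrt ((x\<^sup>2 + z\<^sup>2) / 2)"
  have xz: "x\<^sup>2 \<le> z\<^sup>2" "x\<^sup>2 > 1" using x z by (auto intro: power_mono simp: one_less_power)
  have y2: "y\<^sup>2 = (x\<^sup>2 + z\<^sup>2) / 2" by (simp add: y_def)
  have "y\<^sup>2 \<ge> 1" unfolding y2 using xz by simp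
  then have y: "y \<ge> 1" "y > 0" unfolding y_def using xz by (auto simp: real_le_rsqrt)
  define \<beta> where "\<beta> = real v / n"
  have \<beta>: "\<beta> \<ge> 0" by (simp add: \<beta>_def)
  define k where "k = nat \<lfloor>kappa \<beta> y * real n\<rfloor>"
  have "min 1 (y\<^sup>2) = 1" using \<open>y\<^sup>2 \<ge> 1\<close> by simp
  then have c: "1 \<le> k" "1 / 2 \<le> tilt k {threshold n x..threshold n z}"
    using concentration_index[OF x0 z y(2) y2 n] large by (auto simp: k_def \<beta>_def)
  have "kappa \<beta> y * n \<ge> 1 * real n" using kappa_bounds_above_1(1)[OF y(1) \<beta>] by (intro mult_right_mono) auto
  then have nk: "n \<le> k" by (simp add: k_def le_nat_floor)
  have kz: "real (k - n) \<le> z\<^sup>2 * n"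
  proof -
    have "real k \<le> kappa \<beta> y * n" using kappa_eq(1)[OF y(2) \<beta>] by (simp add: k_def)
    also have "\<dots> \<le> z\<^sup>2 * n"
    proof (rule mult_right_mono)
      show "kappa \<beta> y \<le> z\<^sup>2"
        using kappa_bounds_above_1(2)[OF y(1) \<beta>] xz by (simp add: y2)
    qed simp
    finally show ?thesis using nk by (simp add: of_nat_diff)
  qed
  have lz: "ln (z / x) \<ge> 0" using x0 z by simp
  have "(\<Sum>i=n..<k. log_step n z i) = (\<Sum>i=n..<k. log_step n x i - 2 * ln (z / x))"
    using n by (intro sum.cong refl log_step_change x0 z0) auto
  also have "\<dots> = (\<Sum>i=n..<k. log_step n x i) - real (k - n) * (2 * ln (z / x))"
    by (simp add: sum_subtractf)
  also have "\<dots> \<ge> right_sum \<beta> x n - z\<^sup>2 * n * (2 * ln (z / x))"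
    using sum_log_step_ge_right[OF n x0 nk] mult_right_mono[OF kz, of "2 * ln (z / x)"] lz
    by (simp add: \<beta>_def)
  finally have sum: "right_sum \<beta> x n - 2 * z\<^sup>2 * ln (z / x) * n \<le> (\<Sum>i=n..<k. log_step n z i)"
    by (simp add: mult_ac)
  have "exp (right_sum \<beta> x n - 2 * z\<^sup>2 * ln (z / x) * n) * (1 / 2) \<le> exp (\<Sum>i=n..<k. log_step n z i) * tilt k {threshold n x..threshold n z}"
    using sum c by (intro mult_mono) auto
  also have "exp (\<Sum>i=n..<k. log_step n z i) = (\<Prod>i=n..<k. step i / threshold n z)"
    using n by (simp add: exp_sum exp_log_step z0)
  also have "\<dots> * tilt k {threshold n x..threshold n z} \<le> tilt n {threshold n x..}"
    using n nk threshold_pos[OF n z0] by (intro upper_tail_ge) auto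
  also have "\<dots> \<le> 1 - (\<Prod>k=1..n. 1 - tilt k {threshold n x..})"
  proof -
    have "(\<Prod>k=1..n. 1 - tilt k {threshold n x..}) = (1 - tilt n {threshold n x..}) * (\<Prod>k\<in>{1..n} - {n}. 1 - tilt k {threshold n x..})"
      using n by (subst prod.remove[of _ n]) auto
    also have "\<dots> \<le> (1 - tilt n {threshold n x..}) * 1"
      using n by (intro mult_left_mono prod_le_1) (auto simp: tilt_nonneg tilt_le_1)
    finally show ?thesis by simp
  qed
  finally show ?thesis by (simp add: \<beta>_def)
qed

lemma left_sum_eq:
  assumes n: "n \<ge> 1" and x: "0 < x" "x < 1"
  shows "left_sum (real v / n) x n = (\<Sum>k=1..n. \<Sum>i=idx n x..<k. log_step n x i)"
proof -
  have "(\<Sum>k=1..n. \<Sum>i=idx n x..<k. log_step n x i) = (\<Sum>k=1..n. \<Sum>i\<in>{i\<in>{idx n x..<n}. i < k}. log_step n x i)"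
    by (intro sum.cong refl) auto
  also have "\<dots> = (\<Sum>i=idx n x..<n. \<Sum>k\<in>{k\<in>{1..n}. i < k}. log_step n x i)"
    by (intro sum.swap_restrict) auto
  also have "\<dots> = (\<Sum>i=idx n x..<n. (real n - real i) * log_step n x i)"
  proof (intro sum.cong refl)
    fix i assume i: "i \<in> {idx n x..<n}"
    have "{k\<in>{1..n}. i < k} = {Suc i..n}" by auto
    then show "(\<Sum>k\<in>{k\<in>{1..n}. i < k}. log_step n x i) = (real n - real i) * log_step n x i"
      using i by (simp add: of_nat_diff)
  qed
  finally show ?thesis by (simp add: left_sum_def log_step_def)
qed

text \<open>
  Particles up to the first index are likely to lie below the threshold, and their factors are
  bounded by \<open>1\<close>; Chernoff's bound serves for the others.
\<close>
lemma left_tail_upper: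
  assumes n: "n \<ge> 1" and x: "0 < x" "x < 1"
  shows "(\<Prod>k=1..n. tilt k {..threshold n x}) \<le> exp (- left_sum (real v / n) x n)"
proof -
  have "(\<Prod>k=1..n. tilt k {..threshold n x}) \<le> (\<Prod>k=1..n. exp (- (\<Sum>i=idx n x..<k. log_step n x i)))"
  proof (rule prod_mono, intro conjI)
    fix k assume k: "k \<in> {1..n}"
    show "0 \<le> tilt k {..threshold n x}" by (rule tilt_nonneg)
    show "tilt k {..threshold n x} \<le> exp (- (\<Sum>i=idx n x..<k. log_step n x i))"
    proof (cases "idx n x \<le> k")
      case True
      have "tilt k {..threshold n x} \<le> (\<Prod>i=idx n x..<k. threshold n x / step i)"
        using True idx_pos[OF n x(1)] threshold_pos[OF n x(1)] by (intro lower_tail_le) auto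
      also have "\<dots> = (\<Prod>i=idx n x..<k. exp (- log_step n x i))"
        using idx_pos[OF n x(1)] by (intro prod.cong refl exp_neg_log_step n x) auto
      also have "\<dots> = exp (- (\<Sum>i=idx n x..<k. log_step n x i))" by (simp add: exp_sum flip: sum_negf)
      finally show ?thesis .
    next
      case False
      then show ?thesis using k tilt_le_1[of "{..threshold n x}" k] by simp
    qed
  qed
  also have "\<dots> = exp (- left_sum (real v / n) x n)"
    by (simp add: left_sum_eq[OF n x] exp_sum flip: sum_negf)
  finally show ?thesis .
qed

text \<open>
  The auxiliary tilt concentrates between the thresholds at \<open>z\<close> and \<open>x\<close>. Particles up to that index
  lie below the threshold at \<open>x\<close> with a probability bounded from below by Markov's inequality,
  the others are tilted down to it. The losses per particle are a factor \<open>(x/z)\<^bsup>2n\<^esup>\<close> and a constant;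
  the first adds up to \<open>2 n\<^sup>2 log (x/z)\<close> in the exponent, which is small if \<open>z\<close> is close to \<open>x\<close>.
\<close>
lemma left_tail_lower:
  assumes x: "0 < x" "x < 1" and z: "0 < z" "z < x" and n: "n \<ge> 1"
    and large: "6 / ((x\<^sup>2 - z\<^sup>2) / (4 * x\<^sup>2))\<^sup>2 + 1 \<le> (z\<^sup>2 + x\<^sup>2) / 2 * real n"
  shows "exp (- left_sum (real v / n) x n - 2 * ln (x / z) * (real n)\<^sup>2) * ((x\<^sup>2 - z\<^sup>2) / (2 * x\<^sup>2)) ^ n
    \<le> (\<Prod>k=1..n. tilt k {..threshold n x})"
proof -
  define \<delta> where "\<delta> = (x\<^sup>2 - z\<^sup>2) / (2 * x\<^sup>2)"
  define y where "y = sqrt ((z\<^sup>2 + x\<^sup>2) / 2)"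
  have xz: "z\<^sup>2 < x\<^sup>2" "x\<^sup>2 < 1" "z\<^sup>2 > 0" using x z by (auto intro: power_strict_mono simp: power_less_one_iff)
  have y2: "y\<^sup>2 = (z\<^sup>2 + x\<^sup>2) / 2" by (simp add: y_def)
  have "0 < (z\<^sup>2 + x\<^sup>2) / 2" using x z by (intro divide_pos_pos add_pos_pos) auto
  then have y: "y > 0" unfolding y_def by (rule real_sqrt_gt_zero)
  have \<delta>: "0 < \<delta>" "\<delta> \<le> 1 / 2" "\<delta> = 1 - y\<^sup>2 / x\<^sup>2"
    using xz x by (auto simp: \<delta>_def y2 divide_simps)
  \<comment> \<open>an index at which the tilt concentrates between the thresholds at \<open>z\<close> and \<open>x\<close>\<close>
  define k1 where "k1 = nat \<lfloor>kappa (real v / n) y * real n\<rfloor>"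
  have "min 1 (y\<^sup>2) = (z\<^sup>2 + x\<^sup>2) / 2" unfolding y2 using xz by simp
  then have "6 / ((x\<^sup>2 - z\<^sup>2) / (4 * x\<^sup>2))\<^sup>2 + 1 \<le> min 1 (y\<^sup>2) * real n"
    using large by (simp only:)
  note c = concentration_index[OF z(1,2) y y2 n this, folded k1_def]
  have lz: "ln (x / z) \<ge> 0" using z by simp
  have ge: "exp (- (\<Sum>i=idx n x..<k. log_step n x i) - 2 * ln (x / z) * n) * \<delta> \<le> tilt k {..threshold n x}"
    if k: "k \<in> {1..n}" for k
  proof (cases "k \<le> k1")
    case True
    have "0 \<le> (\<Sum>i=idx n x..<k. log_step n x i)" using n x by (intro sum_nonneg log_step_nonneg) auto
    moreover have "0 \<le> 2 * ln (x / z) * n" using lz by simp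
    ultimately have "- (\<Sum>i=idx n x..<k. log_step n x i) - 2 * ln (x / z) * n \<le> 0" by linarith
    then have "exp (- (\<Sum>i=idx n x..<k. log_step n x i) - 2 * ln (x / z) * n) \<le> 1" by (simp only: exp_le_one_iff)
    then have "exp (- (\<Sum>i=idx n x..<k. log_step n x i) - 2 * ln (x / z) * n) * \<delta> \<le> 1 * \<delta>"
      using \<delta> by (intro mult_right_mono) auto
    also have "1 * \<delta> = 1 - threshold n y / threshold n x" using n x by (simp add: \<delta>(3) threshold_def)
    also have "\<dots> \<le> 1 - step k / threshold n x"
    proof -
      have "step k \<le> step k1" unfolding step_def using True by (intro mult_mono) auto
      then have "step k \<le> threshold n y" using c by simp
      then show ?thesis using threshold_pos[OF n x(1)] by (simp add: divide_right_mono)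
    qed
    also have "\<dots> \<le> tilt k {..threshold n x}" using k threshold_pos[OF n x(1)] by (intro lower_tail_markov) auto
    finally show ?thesis .
  next
    case False
    have "(\<Sum>i=k1..<k. log_step n z i) = (\<Sum>i=k1..<k. log_step n x i - 2 * ln (z / x))"
      using c by (intro sum.cong refl log_step_change n x z) auto
    also have "\<dots> = (\<Sum>i=k1..<k. log_step n x i) - real (k - k1) * (2 * ln (z / x))"
      by (simp add: sum_subtractf)
    also have "\<dots> = (\<Sum>i=k1..<k. log_step n x i) + real (k - k1) * (2 * ln (x / z))"
      using x z by (simp add: ln_div algebra_simps)
    also have "\<dots> \<le> (\<Sum>i=idx n x..<k. log_step n x i) + real n * (2 * ln (x / z))"
      using sum_log_step_le_left[OF n x(1) c(1), of k] False k lz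
      by (intro add_mono mult_right_mono) auto
    finally have s: "- (\<Sum>i=idx n x..<k. log_step n x i) - 2 * ln (x / z) * n \<le> - (\<Sum>i=k1..<k. log_step n z i)"
      by (simp add: mult_ac)
    have "exp (- (\<Sum>i=idx n x..<k. log_step n x i) - 2 * ln (x / z) * n) * \<delta>
        \<le> exp (- (\<Sum>i=k1..<k. log_step n z i)) * tilt k1 {threshold n z..threshold n x}"
      using s c \<delta> by (intro mult_mono) auto
    also have "exp (- (\<Sum>i=k1..<k. log_step n z i)) = (\<Prod>i=k1..<k. exp (- log_step n z i))"
      by (simp add: exp_sum flip: sum_negf)
    also have "\<dots> = (\<Prod>i=k1..<k. threshold n z / step i)"
      using c by (intro prod.cong refl exp_neg_log_step[symmetric] n z) auto
    also have "\<dots> * tilt k1 {threshold n z..threshold n x} \<le> tilt k {..threshold n x}"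
      using c False threshold_pos[OF n z(1)] by (intro lower_tail_ge) auto
    finally show ?thesis .
  qed
  have "exp (- left_sum (real v / n) x n - 2 * ln (x / z) * (real n)\<^sup>2) * \<delta> ^ n
     = (\<Prod>k=1..n. exp (- (\<Sum>i=idx n x..<k. log_step n x i) - 2 * ln (x / z) * n) * \<delta>)"
    by (simp add: prod.distrib left_sum_eq[OF n x] sum_subtractf sum_negf power2_eq_square mult_ac flip: exp_sum)
  also have "\<dots> \<le> (\<Prod>k=1..n. tilt k {..threshold n x})"
    using ge \<delta> by (intro prod_mono) auto
  finally show ?thesis by (simp add: \<delta>_def)
qed

end

section \<open>The large deviation limits\<close>

text \<open>
  Since \<open>\<beta>\<^sub>n = 0\<close> may occur when \<open>\<alpha> = 0\<close>, the value of \<open>F\<close> at \<open>0\<close> has to agree with the limit from the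
  right.
\<close>
lemma extend_by_limits_tendsto:
  fixes F :: "real \<Rightarrow> real \<Rightarrow> real" and \<beta> :: "nat \<Rightarrow> real"
  assumes lim: "(\<lambda>n. ereal (\<beta> n)) \<longlonglongrightarrow> \<alpha>" and nonneg: "\<And>n. \<beta> n \<ge> 0"
    and at_0: "((\<lambda>b. F b x) \<longlongrightarrow> F 0 x) (at_right 0)"
    and at_top: "((\<lambda>b. F b x) \<longlongrightarrow> L) at_top"
    and cont: "\<And>b. b > 0 \<Longrightarrow> isCont (\<lambda>b. F b x) b"
  shows "(\<lambda>n. F (\<beta> n) x) \<longlonglongrightarrow> extend_by_limits F \<alpha> x"
proof -
  have "\<alpha> \<ge> 0"
    by (rule tendsto_lowerbound[OF lim]) (auto simp: nonneg)
  then consider "\<alpha> = 0" | "\<alpha> = \<infinity>" | b where "b > 0" "\<alpha> = ereal b"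
    by (cases \<alpha>) (auto simp: less_le)
  then show ?thesis
  proof cases
    case 1
    then have b0: "\<beta> \<longlonglongrightarrow> 0" using lim by (simp add: zero_ereal_def)
    have "((\<lambda>b. F b x) \<longlongrightarrow> F 0 x) (at 0 within {0<..})" using at_0 by simp
    then have "continuous (at 0 within {0..}) (\<lambda>b. F b x)"
      unfolding continuous_within by (simp add: at_within_Ici_at_right)
    then have "(\<lambda>n. F (\<beta> n) x) \<longlonglongrightarrow> F 0 x"
      using continuous_within_tendsto_compose'[of 0 "{0..}" "\<lambda>b. F b x" \<beta> sequentially] b0 nonneg by auto
    moreover have "extend_by_limits F \<alpha> x = F 0 x"
      using 1 tendsto_Lim[OF _ at_0] by (simp add: extend_by_limits_def)
    ultimately show ?thesis by simp
  next
    case 2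
    then have "filterlim \<beta> at_top sequentially"
      using lim by (simp add: tendsto_PInfty_eq_at_top)
    then have "(\<lambda>n. F (\<beta> n) x) \<longlonglongrightarrow> L" by (rule filterlim_compose[OF at_top])
    moreover have "extend_by_limits F \<alpha> x = L"
      using 2 tendsto_Lim[OF _ at_top] by (simp add: extend_by_limits_def)
    ultimately show ?thesis by simp
  next
    case 3
    then have "\<beta> \<longlonglongrightarrow> b" using lim by simp
    then have "(\<lambda>n. F (\<beta> n) x) \<longlonglongrightarrow> F b x" by (rule isCont_tendsto_compose[OF cont[OF 3(1)]])
    then show ?thesis using 3 by (simp add: extend_by_limits_def)
  qed
qed

lemma kappa_0: "x > 0 \<Longrightarrow> kappa 0 x = x"
  by (simp add: kappa_def real_sqrt_mult power2_eq_square)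

lemma isCont_kappa:
  assumes "x > 0" "b > 0"
  shows "isCont (\<lambda>\<beta>. kappa \<beta> x) b"
proof -
  have "b + sqrt (b\<^sup>2 + 4 * (1 + b) * x\<^sup>2) > 0"
    using assms by (intro add_pos_nonneg) auto
  then show ?thesis unfolding kappa_def by (intro continuous_intros) auto
qed

lemma rate_right_tendsto:
  assumes "(\<lambda>n. ereal (\<beta> n)) \<longlonglongrightarrow> \<alpha>" "\<And>n. \<beta> n \<ge> 0" and x: "x > 0"
  shows "(\<lambda>n. rate_right_fin (\<beta> n) x) \<longlonglongrightarrow> rate_right \<alpha> x"
  unfolding rate_right_def
proof (rule extend_by_limits_tendsto[where F = rate_right_fin and x = x, OF assms(1,2) _ rate_right_fin_at_infinity[OF x]])
  show "((\<lambda>b. rate_right_fin b x) \<longlongrightarrow> rate_right_fin 0 x) (at_right 0)"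
    using rate_right_fin_at_0[OF x] by (simp add: rate_right_fin_def kappa_0[OF x] algebra_simps)
  show "isCont (\<lambda>b. rate_right_fin b x) b" if b: "b > 0" for b
  proof -
    have "b + kappa b x > 0" using kappa_eq(1)[OF x, of b] b by simp
    then show ?thesis unfolding rate_right_fin_def
      using b by (intro continuous_intros isCont_kappa[OF x b]) auto
  qed
qed

lemma rate_left_tendsto:
  assumes "(\<lambda>n. ereal (\<beta> n)) \<longlonglongrightarrow> \<alpha>" "\<And>n. \<beta> n \<ge> 0" and x: "x > 0"
  shows "(\<lambda>n. rate_left_fin (\<beta> n) x) \<longlonglongrightarrow> rate_left \<alpha> x"
  unfolding rate_left_def
proof (rule extend_by_limits_tendsto[where F = rate_left_fin and x = x, OF assms(1,2) _ rate_left_fin_at_infinity[OF x]])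
  show "((\<lambda>b. rate_left_fin b x) \<longlongrightarrow> rate_left_fin 0 x) (at_right 0)"
    using rate_left_fin_at_0[OF x] by (simp add: rate_left_fin_def kappa_0[OF x] mult.commute)
  show "isCont (\<lambda>b. rate_left_fin b x) b" if b: "b > 0" for b
  proof -
    have "kappa b x + b > 0" using kappa_eq(1)[OF x, of b] b by simp
    then show ?thesis unfolding rate_left_fin_def
      using b by (intro continuous_intros isCont_kappa[OF x b]) auto
  qed
qed

lemma scaled_ge_iff:
  assumes n: "n \<ge> (1::nat)" and x: "x > 0" and s: "s \<ge> 0"
  shows "x \<le> sqrt (real n / (real n + real v)) * s \<longleftrightarrow> x\<^sup>2 * (real n * real (n + v)) \<le> (real n)\<^sup>2 * s\<^sup>2"
    and "sqrt (real n / (real n + real v)) * s \<le> x \<longleftrightarrow> (real n)\<^sup>2 * s\<^sup>2 \<le> x\<^sup>2 * (real n * real (n + v))"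
proof -
  let ?t = "sqrt (real n / (real n + real v)) * s"
  have t2: "?t\<^sup>2 = real n * s\<^sup>2 / (real n + real v)" using n by (simp add: power_mult_distrib)
  have t0: "?t \<ge> 0" using s by simp
  have pos: "real n + real v > 0" "real n > 0" using n by auto
  have e: "?t\<^sup>2 * (real n * real (n + v)) = (real n)\<^sup>2 * s\<^sup>2"
    unfolding t2 using pos by (simp add: power2_eq_square)
  have p: "real n * real (n + v) > 0" using pos by simp
  have "x \<le> ?t \<longleftrightarrow> x\<^sup>2 \<le> ?t\<^sup>2" using x t0 by (simp only: power_mono_iff[of x ?t 2] less_imp_le zero_less_numeral)
  also have "\<dots> \<longleftrightarrow> x\<^sup>2 * (real n * real (n + v)) \<le> (real n)\<^sup>2 * s\<^sup>2"
    unfolding e[symmetric] using p by (simp only: mult_le_cancel_right_pos)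
  finally show "x \<le> ?t \<longleftrightarrow> x\<^sup>2 * (real n * real (n + v)) \<le> (real n)\<^sup>2 * s\<^sup>2" .
  have "?t \<le> x \<longleftrightarrow> ?t\<^sup>2 \<le> x\<^sup>2" using x t0 by (simp only: power_mono_iff[of ?t x 2] less_imp_le zero_less_numeral)
  also have "\<dots> \<longleftrightarrow> (real n)\<^sup>2 * s\<^sup>2 \<le> x\<^sup>2 * (real n * real (n + v))"
    unfolding e[symmetric] using p by (simp only: mult_le_cancel_right_pos)
  finally show "?t \<le> x \<longleftrightarrow> (real n)\<^sup>2 * s\<^sup>2 \<le> x\<^sup>2 * (real n * real (n + v))" .
qed

lemma max_tail_probabilities:
  fixes n v :: nat
  assumes n: "n \<ge> 1" and M: "prob_space M"
    and Z: "distributed M (lborel_vec n) Z (\<lambda>z. ennreal (chiral_density n v z))"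
  obtains N where "gamma_product_law N v"
    and "\<And>x. x > 0 \<Longrightarrow> measure M {\<omega> \<in> space M. x \<le> sqrt (real n / (real n + real v)) * Max ((\<lambda>i. (norm (Z \<omega> i))\<^sup>2) ` {1..n})}
       = 1 - (\<Prod>k=1..n. 1 - gamma_product_law.tilt N v k {gamma_product_law.threshold v n x..})"
    and "\<And>x. x > 0 \<Longrightarrow> measure M {\<omega> \<in> space M. sqrt (real n / (real n + real v)) * Max ((\<lambda>i. (norm (Z \<omega> i))\<^sup>2) ` {1..n}) \<le> x}
       = (\<Prod>k=1..n. gamma_product_law.tilt N v k {..gamma_product_law.threshold v n x})"
proof -
  interpret prob_space M by fact
  obtain N where N: "gamma_product_law N v" and law: "\<And>B. B \<in> sets borel \<Longrightarrow>
      measure M {\<omega> \<in> space M. \<forall>i\<in>{1..n}. (real n)\<^sup>2 * norm (Z \<omega> i) ^ 4 \<in> B}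
        = (\<Prod>k=1..n. gamma_product_law.tilt N v k B)"
    using joint_law[OF n M Z] by blast
  interpret gamma_product_law N v by fact
  let ?c = "sqrt (real n / (real n + real v))"
  let ?m = "\<lambda>\<omega>. Max ((\<lambda>i. (norm (Z \<omega> i))\<^sup>2) ` {1..n})"
  have c0: "?c \<ge> 0" by simp
  have sq: "(real n)\<^sup>2 * ((norm (Z \<omega> i))\<^sup>2)\<^sup>2 = (real n)\<^sup>2 * norm (Z \<omega> i) ^ 4" for \<omega> i
    by (simp flip: power_mult)
  have fin: "finite ((\<lambda>i. (norm (Z \<omega> i))\<^sup>2) ` {1..n})" "(\<lambda>i. (norm (Z \<omega> i))\<^sup>2) ` {1..n} \<noteq> {}" for \<omega>
    using n by auto
  have le: "?c * ?m \<omega> \<le> x \<longleftrightarrow> (\<forall>i\<in>{1..n}. (real n)\<^sup>2 * norm (Z \<omega> i) ^ 4 \<in> {..threshold n x})"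
    and ge: "x \<le> ?c * ?m \<omega> \<longleftrightarrow> \<not> (\<forall>i\<in>{1..n}. (real n)\<^sup>2 * norm (Z \<omega> i) ^ 4 \<in> {..<threshold n x})"
    if x: "x > 0" for x \<omega>
  proof -
    have "?c * ?m \<omega> = Max ((\<lambda>y. ?c * y) ` ((\<lambda>i. (norm (Z \<omega> i))\<^sup>2) ` {1..n}))"
      by (intro mono_Max_commute fin) (auto intro!: monoI mult_left_mono)
    then have eq: "?c * ?m \<omega> = Max ((\<lambda>i. ?c * (norm (Z \<omega> i))\<^sup>2) ` {1..n})"
      by (simp add: image_image)
    have fin': "finite ((\<lambda>i. ?c * (norm (Z \<omega> i))\<^sup>2) ` {1..n})" "(\<lambda>i. ?c * (norm (Z \<omega> i))\<^sup>2) ` {1..n} \<noteq> {}"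
      using n by auto
    show "?c * ?m \<omega> \<le> x \<longleftrightarrow> (\<forall>i\<in>{1..n}. (real n)\<^sup>2 * norm (Z \<omega> i) ^ 4 \<in> {..threshold n x})"
      unfolding eq Max_le_iff[OF fin']
      using scaled_ge_iff(2)[OF n x zero_le_power2, of v] by (simp add: threshold_def sq)
    have "x \<le> ?c * ?m \<omega> \<longleftrightarrow> (\<exists>i\<in>{1..n}. x \<le> ?c * (norm (Z \<omega> i))\<^sup>2)"
      unfolding eq Max_ge_iff[OF fin'] by auto
    also have "\<dots> \<longleftrightarrow> (\<exists>i\<in>{1..n}. threshold n x \<le> (real n)\<^sup>2 * norm (Z \<omega> i) ^ 4)"
      using scaled_ge_iff(1)[OF n x zero_le_power2, of v] by (simp add: threshold_def sq)
    finally show "x \<le> ?c * ?m \<omega> \<longleftrightarrow> \<not> (\<forall>i\<in>{1..n}. (real n)\<^sup>2 * norm (Z \<omega> i) ^ 4 \<in> {..<threshold n x})"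
      by (auto simp: not_less)
  qed
  show thesis
  proof (rule that[OF N])
    fix x :: real assume x: "x > 0"
    show "measure M {\<omega> \<in> space M. ?c * ?m \<omega> \<le> x} = (\<Prod>k=1..n. tilt k {..threshold n x})"
      unfolding le[OF x] by (rule law) simp
    let ?E = "{\<omega> \<in> space M. \<forall>i\<in>{1..n}. (real n)\<^sup>2 * norm (Z \<omega> i) ^ 4 \<in> {..<threshold n x}}"
    have "measure M {\<omega> \<in> space M. x \<le> ?c * ?m \<omega>} = prob (space M - ?E)"
      unfolding ge[OF x] by (rule arg_cong[where f = prob]) auto
    also have "\<dots> = 1 - prob ?E"
    proof (rule prob_compl)
      have Zm: "Z \<in> measurable M (lborel_vec n)" using Z by (simp add: distributed_def)
      have [measurable]: "(\<lambda>\<omega>. Z \<omega> i) \<in> borel_measurable M" if "i \<in> {1..n}" for i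
        using measurable_compose[OF Zm[unfolded lborel_vec_def] measurable_component_singleton[OF that]] by simp
      show "?E \<in> events" by measurable
    qed
    also have "prob ?E = (\<Prod>k=1..n. tilt k {..<threshold n x})" by (rule law) simp
    also have "\<dots> = (\<Prod>k=1..n. 1 - tilt k {threshold n x..})"
    proof (intro prod.cong refl)
      fix k assume "k \<in> {1..n}"
      then show "tilt k {..<threshold n x} = 1 - tilt k {threshold n x..}"
        using tilt_Compl[of "{threshold n x..}" k] by (simp add: Compl_atLeast)
    qed
    finally show "measure M {\<omega> \<in> space M. x \<le> ?c * ?m \<omega>} = 1 - (\<Prod>k=1..n. 1 - tilt k {threshold n x..})" .
  qed
qed

text \<open>
  For fixed \<open>z\<close> the last term vanishes as \<open>n\<close> grows, and the first is small for \<open>z\<close> close to \<open>x\<close>.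
\<close>
lemma right_log_estimate:
  fixes n v :: nat
  assumes n: "n \<ge> 1" and M: "prob_space M"
    and Z: "distributed M (lborel_vec n) Z (\<lambda>z. ennreal (chiral_density n v z))"
    and x: "x > 1" and z: "z > x"
    and large: "6 / ((z\<^sup>2 - x\<^sup>2) / (4 * z\<^sup>2))\<^sup>2 + 1 \<le> real n"
  shows "\<bar>1 / real n * ln (measure M {\<omega> \<in> space M.
        sqrt (real n / (real n + real v)) * Max ((\<lambda>i. (norm (Z \<omega> i))\<^sup>2) ` {1..n}) \<ge> x}) + rate_right_fin (real v / n) x\<bar>
    \<le> 2 * z\<^sup>2 * ln (z / x) + (2 * x\<^sup>2 + 2 + ln 2 + ln (real n)) / real n"
proof -
  obtain N where N: "gamma_product_law N v"
    and law: "\<And>x. x > 0 \<Longrightarrow> measure M {\<omega> \<in> space M. x \<le> sqrt (real n / (real n + real v)) * Max ((\<lambda>i. (norm (Z \<omega> i))\<^sup>2) ` {1..n})}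
       = 1 - (\<Prod>k=1..n. 1 - gamma_product_law.tilt N v k {gamma_product_law.threshold v n x..})"
    using max_tail_probabilities[OF n M Z] by blast
  interpret gamma_product_law N v by fact
  define p where "p = 1 - (\<Prod>k=1..n. 1 - tilt k {threshold n x..})"
  define S where "S = right_sum (real v / n) x n"
  define e where "e = 2 * z\<^sup>2 * ln (z / x)"
  have n0: "real n > 0" using n by simp
  have low: "exp (S - e * n) / 2 \<le> p" and up: "p \<le> real n * exp S"
    using right_tail_lower[OF x z n large] right_tail_upper[OF n x] by (auto simp: p_def S_def e_def)
  have p0: "p > 0" by (rule less_le_trans[OF _ low]) simp
  have e0: "e \<ge> 0" using x z by (simp add: e_def)
  have "ln (exp (S - e * n) / 2) \<le> ln p" using low p0 by (subst ln_le_cancel_iff) auto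
  then have 1: "S - e * n - ln 2 \<le> ln p" by (simp add: ln_div)
  have "ln p \<le> ln (real n * exp S)" using up p0 n0 by (subst ln_le_cancel_iff) auto
  then have 2: "ln p \<le> ln n + S" using n0 by (simp add: ln_mult)
  have "(S - e * n - ln 2) / n \<le> ln p / n" "ln p / n \<le> (ln n + S) / n"
    using 1 2 by (auto intro: divide_right_mono)
  then have 3: "S / n - e - ln 2 / n \<le> ln p / n" "ln p / n \<le> ln n / n + S / n"
    using n0 by (auto simp: diff_divide_distrib add_divide_distrib)
  have 4: "\<bar>S / n + rate_right_fin (real v / n) x\<bar> \<le> (2 * x\<^sup>2 + 2) / n"
    unfolding S_def by (rule right_sum_approx[OF x _ n]) simp
  have 5: "0 \<le> ln 2 / real n" "0 \<le> ln (real n) / n" using n by auto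
  have "(2 * x\<^sup>2 + 2 + ln 2 + ln (real n)) / real n = (2 * x\<^sup>2 + 2) / n + ln 2 / n + ln n / n"
    by (simp add: add_divide_distrib)
  then have "\<bar>ln p / n + rate_right_fin (real v / n) x\<bar> \<le> e + (2 * x\<^sup>2 + 2 + ln 2 + ln (real n)) / real n"
    using 3 4 5 e0 by linarith
  then show ?thesis using law[of x] x by (simp add: p_def e_def)
qed

lemma left_log_estimate:
  fixes n v :: nat
  assumes n: "n \<ge> 1" and M: "prob_space M"
    and Z: "distributed M (lborel_vec n) Z (\<lambda>z. ennreal (chiral_density n v z))"
    and x: "0 < x" "x < 1" and z: "0 < z" "z < x"
    and large: "6 / ((x\<^sup>2 - z\<^sup>2) / (4 * x\<^sup>2))\<^sup>2 + 1 \<le> (z\<^sup>2 + x\<^sup>2) / 2 * real n"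
  shows "\<bar>1 / (real n)\<^sup>2 * ln (measure M {\<omega> \<in> space M.
        sqrt (real n / (real n + real v)) * Max ((\<lambda>i. (norm (Z \<omega> i))\<^sup>2) ` {1..n}) \<le> x}) + rate_left_fin (real v / n) x\<bar>
    \<le> 2 * ln (x / z) + (6 / x\<^sup>2 - ln ((x\<^sup>2 - z\<^sup>2) / (2 * x\<^sup>2))) / real n"
proof -
  obtain N where N: "gamma_product_law N v"
    and law: "\<And>x. x > 0 \<Longrightarrow> measure M {\<omega> \<in> space M. sqrt (real n / (real n + real v)) * Max ((\<lambda>i. (norm (Z \<omega> i))\<^sup>2) ` {1..n}) \<le> x}
       = (\<Prod>k=1..n. gamma_product_law.tilt N v k {..gamma_product_law.threshold v n x})"
    using max_tail_probabilities[OF n M Z] by blast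
  interpret gamma_product_law N v by fact
  define p where "p = (\<Prod>k=1..n. tilt k {..threshold n x})"
  define T where "T = left_sum (real v / n) x n"
  define e where "e = 2 * ln (x / z)"
  define \<delta> where "\<delta> = (x\<^sup>2 - z\<^sup>2) / (2 * x\<^sup>2)"
  have n0: "real n > 0" using n by simp
  have xz: "z\<^sup>2 < x\<^sup>2" "x\<^sup>2 > 0" using x z by (auto intro: power_strict_mono)
  have "x\<^sup>2 - z\<^sup>2 \<le> x\<^sup>2" by simp
  also have "x\<^sup>2 < 2 * x\<^sup>2" using xz by simp
  finally have \<delta>: "0 < \<delta>" "\<delta> < 1" using xz by (auto simp: \<delta>_def)
  have low: "exp (- T - e * (real n)\<^sup>2) * \<delta> ^ n \<le> p" and up: "p \<le> exp (- T)"
    using left_tail_lower[OF x z n large] left_tail_upper[OF n x] by (auto simp: p_def T_def e_def \<delta>_def)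
  have l0: "exp (- T - e * (real n)\<^sup>2) * \<delta> ^ n > 0" using \<delta> by simp
  have p0: "p > 0" by (rule less_le_trans[OF l0 low])
  have e0: "e \<ge> 0" using x z by (simp add: e_def)
  have "ln (exp (- T - e * (real n)\<^sup>2) * \<delta> ^ n) \<le> ln p" using low p0 l0 by (subst ln_le_cancel_iff) auto
  then have 1: "- T - e * (real n)\<^sup>2 + n * ln \<delta> \<le> ln p" using \<delta> by (simp add: ln_mult ln_realpow)
  have "ln p \<le> ln (exp (- T))" using up p0 by (subst ln_le_cancel_iff) auto
  then have 2: "ln p \<le> - T" by simp
  have "(- T - e * (real n)\<^sup>2 + n * ln \<delta>) / (real n)\<^sup>2 = - (T / (real n)\<^sup>2) - e + ln \<delta> / n"
    using n0 by (simp add: diff_divide_distrib add_divide_distrib power2_eq_square)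
  with divide_right_mono[OF 1 zero_le_power2[of "real n"]] divide_right_mono[OF 2 zero_le_power2[of "real n"]]
  have 3: "- (T / (real n)\<^sup>2) - e + ln \<delta> / n \<le> ln p / (real n)\<^sup>2" "ln p / (real n)\<^sup>2 \<le> - (T / (real n)\<^sup>2)"
    by (simp_all only: minus_divide_left)
  have 4: "\<bar>T / (real n)\<^sup>2 - rate_left_fin (real v / n) x\<bar> \<le> (6 / x\<^sup>2) / n"
    unfolding T_def by (rule left_sum_approx[OF x _ n]) simp
  have 5: "ln \<delta> / n \<le> 0" using \<delta> n0 by (intro divide_nonpos_pos) auto
  have "(6 / x\<^sup>2 - ln \<delta>) / real n = (6 / x\<^sup>2) / n - ln \<delta> / n"
    by (simp add: diff_divide_distrib)
  then have "\<bar>ln p / (real n)\<^sup>2 + rate_left_fin (real v / n) x\<bar> \<le> e + (6 / x\<^sup>2 - ln \<delta>) / real n"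
    using 3 4 5 e0 by linarith
  then show ?thesis using law[of x] x by (simp add: p_def e_def \<delta>_def)
qed

lemma tendsto_uminus_of_small_sum:
  fixes a I :: "nat \<Rightarrow> real"
  assumes small: "\<And>\<epsilon>. \<epsilon> > 0 \<Longrightarrow> \<forall>\<^sub>F n in sequentially. \<bar>a n + I n\<bar> < \<epsilon>" and I: "I \<longlonglongrightarrow> L"
  shows "a \<longlonglongrightarrow> - L"
proof -
  have "(\<lambda>n. a n + I n) \<longlonglongrightarrow> 0"
    by (rule tendstoI) (use small in simp)
  from tendsto_diff[OF this I] show ?thesis by simp
qed

theorem theorem1:
  fixes v :: "nat \<Rightarrow> nat"
    and \<alpha> :: ereal
    and M :: "nat \<Rightarrow> 'a measure"
    and \<zeta> :: "nat \<Rightarrow> 'a \<Rightarrow> nat \<Rightarrow> complex"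
  assumes "(\<lambda>n. ereal (real (v n) / real n)) \<longlonglongrightarrow> \<alpha>"
    and "\<And>n. n \<ge> 1 \<Longrightarrow> prob_space (M n)"
    and "\<And>n. n \<ge> 1 \<Longrightarrow>
           distributed (M n) (lborel_vec n) (\<zeta> n) (\<lambda>z. ennreal (chiral_density n (v n) z))"
  shows
    "(\<forall>x::real. x > 1 \<longrightarrow>
        (\<lambda>n. 1 / real n *
             ln (measure (M n)
               {\<omega> \<in> space (M n).
                  sqrt (real n / (real n + real (v n))) * Max ((\<lambda>i. (norm (\<zeta> n \<omega> i))\<^sup>2) ` {1..n}) \<ge> x}))
          \<longlonglongrightarrow> - rate_right \<alpha> x) \<and>
     (\<forall>x::real. 0 < x \<and> x < 1 \<longrightarrow>
        (\<lambda>n. 1 / (real n)\<^sup>2 *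
             ln (measure (M n)
               {\<omega> \<in> space (M n).
                  sqrt (real n / (real n + real (v n))) * Max ((\<lambda>i. (norm (\<zeta> n \<omega> i))\<^sup>2) ` {1..n}) \<le> x}))
          \<longlonglongrightarrow> - rate_left \<alpha> x)"
proof (intro conjI allI impI)
  fix x :: real assume x: "x > 1"
  show "(\<lambda>n. 1 / real n * ln (measure (M n) {\<omega> \<in> space (M n).
        sqrt (real n / (real n + real (v n))) * Max ((\<lambda>i. (norm (\<zeta> n \<omega> i))\<^sup>2) ` {1..n}) \<ge> x}))
      \<longlonglongrightarrow> - rate_right \<alpha> x"
  proof (rule tendsto_uminus_of_small_sum)
    show "(\<lambda>n. rate_right_fin (real (v n) / real n) x) \<longlonglongrightarrow> rate_right \<alpha> x"
      using x by (intro rate_right_tendsto assms(1)) auto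
    fix \<epsilon> :: real assume \<epsilon>: "\<epsilon> > 0"
    have "((\<lambda>z. 2 * z\<^sup>2 * ln (z / x)) \<longlongrightarrow> 2 * x\<^sup>2 * ln (x / x)) (at_right x)"
      using x by (intro tendsto_intros) auto
    then have "\<forall>\<^sub>F z in at_right x. 2 * z\<^sup>2 * ln (z / x) < \<epsilon> / 2"
      using x \<epsilon> by (intro order_tendstoD(2)) auto
    then have "\<forall>\<^sub>F z in at_right x. 2 * z\<^sup>2 * ln (z / x) < \<epsilon> / 2 \<and> x < z"
      using eventually_at_right_less[of x] by eventually_elim simp
    then obtain z where z: "2 * z\<^sup>2 * ln (z / x) < \<epsilon> / 2" "x < z"
      using eventually_happens[of _ "at_right x"] by auto
    have "(\<lambda>n::nat. (2 * x\<^sup>2 + 2 + ln 2 + ln (real n)) / real n) \<longlonglongrightarrow> 0"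
      by real_asymp
    then have "\<forall>\<^sub>F n in sequentially. (2 * x\<^sup>2 + 2 + ln 2 + ln (real n)) / real n < \<epsilon> / 2"
      using \<epsilon> by (intro order_tendstoD(2)) auto
    moreover have "\<forall>\<^sub>F n in sequentially. 6 / ((z\<^sup>2 - x\<^sup>2) / (4 * z\<^sup>2))\<^sup>2 + 1 \<le> real n"
      using filterlim_real_sequentially by (simp add: filterlim_at_top)
    ultimately show "\<forall>\<^sub>F n in sequentially. \<bar>1 / real n * ln (measure (M n) {\<omega> \<in> space (M n).
        sqrt (real n / (real n + real (v n))) * Max ((\<lambda>i. (norm (\<zeta> n \<omega> i))\<^sup>2) ` {1..n}) \<ge> x})
        + rate_right_fin (real (v n) / real n) x\<bar> < \<epsilon>"
      using eventually_ge_at_top[of 1]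
    proof eventually_elim
      case (elim n)
      show ?case
        using right_log_estimate[OF elim(3) assms(2)[OF elim(3)] assms(3)[OF elim(3)] x z(2) elim(2)] elim(1) z(1)
        by linarith
    qed
  qed
next
  fix x :: real assume "0 < x \<and> x < 1"
  then have x: "0 < x" "x < 1" by auto
  show "(\<lambda>n. 1 / (real n)\<^sup>2 * ln (measure (M n) {\<omega> \<in> space (M n).
        sqrt (real n / (real n + real (v n))) * Max ((\<lambda>i. (norm (\<zeta> n \<omega> i))\<^sup>2) ` {1..n}) \<le> x}))
      \<longlonglongrightarrow> - rate_left \<alpha> x"
  proof (rule tendsto_uminus_of_small_sum)
    show "(\<lambda>n. rate_left_fin (real (v n) / real n) x) \<longlonglongrightarrow> rate_left \<alpha> x"
      using x by (intro rate_left_tendsto assms(1)) auto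
    fix \<epsilon> :: real assume \<epsilon>: "\<epsilon> > 0"
    have "((\<lambda>z. 2 * ln (x / z)) \<longlongrightarrow> 2 * ln (x / x)) (at_left x)"
      using x by (intro tendsto_intros) auto
    then have "\<forall>\<^sub>F z in at_left x. 2 * ln (x / z) < \<epsilon> / 2"
      using x \<epsilon> by (intro order_tendstoD(2)) auto
    then have "\<forall>\<^sub>F z in at_left x. 2 * ln (x / z) < \<epsilon> / 2 \<and> z \<in> {0<..<x}"
      using eventually_at_left_real[OF x(1)] by eventually_elim simp
    then obtain z where z: "2 * ln (x / z) < \<epsilon> / 2" "0 < z" "z < x"
      using eventually_happens[of _ "at_left x"] by auto
    have "(\<lambda>n::nat. (6 / x\<^sup>2 - ln ((x\<^sup>2 - z\<^sup>2) / (2 * x\<^sup>2))) / real n) \<longlonglongrightarrow> 0"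
      by (intro tendsto_divide_0[OF tendsto_const] filterlim_at_top_imp_at_infinity filterlim_real_sequentially)
    then have "\<forall>\<^sub>F n in sequentially. (6 / x\<^sup>2 - ln ((x\<^sup>2 - z\<^sup>2) / (2 * x\<^sup>2))) / real n < \<epsilon> / 2"
      using \<epsilon> by (intro order_tendstoD(2)) auto
    moreover have "\<forall>\<^sub>F n in sequentially. (6 / ((x\<^sup>2 - z\<^sup>2) / (4 * x\<^sup>2))\<^sup>2 + 1) / ((z\<^sup>2 + x\<^sup>2) / 2) \<le> real n"
      using filterlim_real_sequentially by (simp add: filterlim_at_top)
    ultimately show "\<forall>\<^sub>F n in sequentially. \<bar>1 / (real n)\<^sup>2 * ln (measure (M n) {\<omega> \<in> space (M n).
        sqrt (real n / (real n + real (v n))) * Max ((\<lambda>i. (norm (\<zeta> n \<omega> i))\<^sup>2) ` {1..n}) \<le> x})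
        + rate_left_fin (real (v n) / real n) x\<bar> < \<epsilon>"
      using eventually_ge_at_top[of 1]
    proof eventually_elim
      case (elim n)
      have "(z\<^sup>2 + x\<^sup>2) / 2 > 0" using x by (intro divide_pos_pos add_nonneg_pos) auto
      then have "6 / ((x\<^sup>2 - z\<^sup>2) / (4 * x\<^sup>2))\<^sup>2 + 1 \<le> (z\<^sup>2 + x\<^sup>2) / 2 * real n"
        using elim(2) by (simp only: divide_le_eq mult.commute if_True)
      from left_log_estimate[OF elim(3) assms(2)[OF elim(3)] assms(3)[OF elim(3)] x z(2,3) this] elim(1) z(1)
      show ?case by linarith
    qed
  qed
qed

end
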